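(* Let $H$ be a transcendental entire function such that $H(-z)=-H(z)$ for all $z$, $H'(0)\neq 0$, and the entire function $z\mapsto H(\sin z)$ has finite order. For $a\in\mathbb{C}$ put $H_a(z):=\cos z\,(H(\sin z)+2a)$. Then there exists an at most countable set $E\subset\mathbb{C}$ such that for each $a\notin E$: (i) $H_a$ is prime; (ii) $\#\{[z]: H_a'(z)=0\}=\infty$, where $[z]=\{z+2\pi n: n\in\mathbb{Z}\}$; (iii) for every $c\in\mathbb{C}$ and any $z_1,z_2\in\{z\in\mathbb{C}: H_a(z)=c,\ H_a'(z)=0\}$ we have $\cos z_1=\cos z_2$; (iv) $H_a'$ has only simple zeros.
   Context: A meromorphic function $F$ is factorized as $F=f\circ g$ with $f$ meromorphic and $g$ entire ($g$ may be meromorphic when $f$ is rational). $F$ is called prime if for every such factorization either $f$ is bilinear (a Möbius transformation) or $g$ is linear. Here $H_a$ is $2\pi$-periodic and $[z]$ denotes the orbit of $z$ under translation by the period $2\pi$. *)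

theory Defs
  imports "HOL-Complex_Analysis.Complex_Analysis" "HOL-Computational_Algebra.Polynomial"
begin

text \<open>Meromorphic functions are represented by total functions complex => complex;
  their values at isolated points (poles, removable singularities) are irrelevant, so
  identities between meromorphic functions are stated as equality in a punctured
  neighbourhood of every point.\<close>

definition mero_eq :: "(complex \<Rightarrow> complex) \<Rightarrow> (complex \<Rightarrow> complex) \<Rightarrow> bool" where
  "mero_eq F G \<longleftrightarrow> (\<forall>z. \<forall>\<^sub>F w in at z. F w = G w)"

definition transcendental_entire :: "(complex \<Rightarrow> complex) \<Rightarrow> bool" where
  "transcendental_entire H \<longleftrightarrow> H holomorphic_on UNIV \<and> \<not> (\<exists>p. \<forall>z. H z = poly p z)"

definition finite_order :: "(complex \<Rightarrow> complex) \<Rightarrow> bool" where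
  "finite_order G \<longleftrightarrow> (\<exists>\<rho>::real. \<exists>R::real. \<forall>z. R \<le> norm z \<longrightarrow> norm (G z) \<le> exp (norm z powr \<rho>))"

definition bilinear_fun :: "(complex \<Rightarrow> complex) \<Rightarrow> bool" where
  "bilinear_fun f \<longleftrightarrow> (\<exists>a b c d. a * d - b * c \<noteq> 0 \<and> mero_eq f (\<lambda>w. (a * w + b) / (c * w + d)))"

definition linear_fun :: "(complex \<Rightarrow> complex) \<Rightarrow> bool" where
  "linear_fun g \<longleftrightarrow> (\<exists>a b. a \<noteq> 0 \<and> mero_eq g (\<lambda>w. a * w + b))"

definition rational_fun :: "(complex \<Rightarrow> complex) \<Rightarrow> bool" where
  "rational_fun f \<longleftrightarrow> (\<exists>p q. q \<noteq> 0 \<and> mero_eq f (\<lambda>w. poly p w / poly q w))"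

definition prime_fun :: "(complex \<Rightarrow> complex) \<Rightarrow> bool" where
  "prime_fun F \<longleftrightarrow>
     (\<forall>f g. f meromorphic_on UNIV \<and> g holomorphic_on UNIV \<and> mero_eq F (f \<circ> g)
        \<longrightarrow> bilinear_fun f \<or> linear_fun g) \<and>
     (\<forall>f g. rational_fun f \<and> g meromorphic_on UNIV \<and> mero_eq F (f \<circ> g)
        \<longrightarrow> bilinear_fun f \<or> linear_fun g)"

definition period_orbit :: "complex \<Rightarrow> complex set" where
  "period_orbit z = {z + of_int n * 2 * of_real pi | n::int. True}"

definition Hfun :: "(complex \<Rightarrow> complex) \<Rightarrow> complex \<Rightarrow> complex \<Rightarrow> complex" where
  "Hfun H a z = cos z * (H (sin z) + 2 * a)"

end

theory Submission
  imports Defs "HOL-Real_Asymp.Real_Asymp" "HOL-Computational_Algebra.Fundamental_Theorem_Algebra"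
begin

text \<open>
  Write \<open>F = Hfun H a\<close>. A point \<open>z\<close> is critical for \<open>F\<close> iff \<open>a = N z\<close>, where \<open>N = (Hfun H 0)' / (2 sin)\<close>.
  Along a branch of critical points the critical value moves with velocity \<open>2 cos z\<close> in \<open>a\<close>, so two
  branches with different cosines agree in their critical values for countably many \<open>a\<close> only. Since
  \<open>N\<close> is odd, for all other \<open>a \<noteq> 0\<close> the critical points of \<open>F\<close> on one level form one orbit; they are simple
  for all but countably many \<open>a\<close>, and Picard's theorem gives infinitely many orbits.

  Now let \<open>F = f \<circ> g\<close> with \<open>f, g\<close> entire and transcendental. As \<open>F\<close> has finite order, \<open>f\<close> has order zero
  (Polya), hence is large on arbitrarily large circles (Wiman), while \<open>F\<close> is bounded on horizontal
  lines; so \<open>g\<close> is bounded there, finitely many translates \<open>g (z + 2\<pi>k)\<close> are distinct, and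
  \<open>g z = \<gamma> (exp (iz/m))\<close>. Every zero \<open>w\<close> of \<open>f'\<close> is taken by \<open>g\<close> on a single orbit, so \<open>\<gamma>\<close> takes it
  finitely often and all its preimages have the same modulus. By Picard \<open>\<gamma>\<close> has at most poles at
  \<open>0\<close> and \<open>\<infinity>\<close>. They are both poles, since \<open>F\<close> is unbounded at both ends of the cylinder, and then large
  zeros of \<open>f'\<close> have both large and small preimages, a contradiction. If \<open>g\<close> is a polynomial, the sum of
  the roots of \<open>g = w\<close> is fixed and confines the critical points to finitely many orbits. The remaining
  factorizations reduce to these, to polynomial \<open>f\<close>, or to \<open>g = w\<^sub>0 + exp h\<close>.
\<close>

section \<open>Entire functions of order below 1/2\<close>

text \<open>One orbit, rather than one cosine, is what the primality proof rests on. Equal cosines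
  still allow the pair z, -z, whose images under exp (iz/m) have reciprocal moduli, so a large and a
  small preimage of one zero of f' would be no contradiction. That pair is excluded by oddness of H
  together with a \<noteq> 0, while H'(0) \<noteq> 0 keeps the critical points away from the zeros
  of sin, where the parameter N has poles. A second symmetry, F (pi - z) = - F z, exchanges the two
  ends of the cylinder; growth is therefore only estimated at one end. It also provides a second
  special level when a polynomial left factor has a single critical point. The threshold 1/2 in the
  circle estimate comes from interpolating at nodes of modulus lam j^2: on a circle of radius about
  n^2 a function of order \<rho> is at most exp (K n^(2 \<rho>)), and the interpolation error gains
  the factor 3^(-n), which wins exactly when 2 \<rho> < 1.\<close>

lemma contour_integral_divided_difference:
  fixes f :: "complex \<Rightarrow> complex"
  assumes f: "f holomorphic_on UNIV" and A: "finite A" "A \<subseteq> ball 0 S" and S: "S > 0"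
  shows "contour_integral (circlepath 0 S) (\<lambda>z. f z / (\<Prod>p\<in>A. z - p)) =
           2 * pi * \<i> * (\<Sum>p\<in>A. f p / (\<Prod>q\<in>A - {p}. p - q))"
proof -
  let ?h = "\<lambda>z. f z / (\<Prod>p\<in>A. z - p)"
  have "contour_integral (circlepath 0 S) ?h = 2 * pi * \<i> *
          (\<Sum>p\<in>A. winding_number (circlepath 0 S) p * residue ?h p)"
  proof (rule Residue_theorem)
    show "?h holomorphic_on UNIV - A"
      using A by (intro holomorphic_intros holomorphic_on_subset[OF f]) auto
    show "path_image (circlepath 0 S) \<subseteq> UNIV - A"
      using A S by (auto simp: subset_iff)
  qed (use A in auto)
  also have "(\<Sum>p\<in>A. winding_number (circlepath 0 S) p * residue ?h p) =
             (\<Sum>p\<in>A. f p / (\<Prod>q\<in>A - {p}. p - q))"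
  proof (rule sum.cong)
    fix p assume p: "p \<in> A"
    have "residue ?h p = f p / (\<Prod>q\<in>A - {p}. p - q)"
    proof -
      let ?k = "\<lambda>z. f z / (\<Prod>q\<in>A - {p}. z - q)"
      have eq: "?h = (\<lambda>w. ?k w / (w - p))"
        using p A by (simp add: prod.remove mult_ac fun_eq_iff)
      have "residue (\<lambda>w. ?k w / (w - p)) p = ?k p"
      proof (rule residue_simple)
        show "open (- (A - {p}))" using A by (intro open_Compl finite_imp_closed) auto
        show "?k holomorphic_on - (A - {p})"
          using A by (intro holomorphic_intros holomorphic_on_subset[OF f]) auto
      qed auto
      then show ?thesis by (simp only: eq)
    qed
    moreover have "winding_number (circlepath 0 S) p = 1"
      using p A S by (intro winding_number_circlepath) (auto simp: dist_norm)
    ultimately show "winding_number (circlepath 0 S) p * residue ?h p = f p / (\<Prod>q\<in>A - {p}. p - q)"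
      by simp
  qed auto
  finally show ?thesis .
qed

text \<open>The sum is the divided difference of \<open>f\<close> over \<open>A\<close>. The factor
  \<open>S\<close> is the length of the circle divided by 2 pi, and \<open>S - norm p\<close> is a
  lower bound for the distance of its points from \<open>p\<close>.\<close>

lemma norm_divided_difference_le:
  fixes f :: "complex \<Rightarrow> complex"
  assumes f: "f holomorphic_on UNIV" and A: "finite A" "A \<subseteq> ball 0 S" and S: "S > 0"
    and M: "\<And>z. norm z = S \<Longrightarrow> norm (f z) \<le> M" 
  shows "norm (\<Sum>p\<in>A. f p / (\<Prod>q\<in>A - {p}. p - q)) \<le> S * M / (\<Prod>p\<in>A. S - norm p)"
proof -
  let ?h = "\<lambda>z. f z / (\<Prod>p\<in>A. z - p)"
  let ?s = "\<Sum>p\<in>A. f p / (\<Prod>q\<in>A - {p}. p - q)"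
  have M0: "0 \<le> M" using M[of "of_real S"] S by (auto intro: order_trans[OF norm_ge_zero])
  have P: "0 < (\<Prod>p\<in>A. S - norm p)" using A by (intro prod_pos) (auto simp: dist_norm)
  have "continuous_on (path_image (circlepath 0 S)) ?h"
    using A S by (intro continuous_intros holomorphic_on_imp_continuous_on[OF holomorphic_on_subset[OF f]]) auto
  then have "(?h has_contour_integral contour_integral (circlepath 0 S) ?h) (circlepath 0 S)"
    by (simp add: contour_integrable_continuous_circlepath has_contour_integral_integral)
  then have I: "(?h has_contour_integral 2 * pi * \<i> * ?s) (circlepath 0 S)"
    using contour_integral_divided_difference[OF f A S] by simp
  have "norm (2 * pi * \<i> * ?s) \<le> M / (\<Prod>p\<in>A. S - norm p) * (2 * pi * S)"
  proof (rule has_contour_integral_bound_circlepath[OF I])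
    fix x :: complex assume x: "norm (x - 0) = S"
    have "(\<Prod>p\<in>A. S - norm p) \<le> (\<Prod>p\<in>A. norm (x - p))"
    proof (rule prod_mono)
      fix p assume "p \<in> A"
      then have "norm p < S" using A by auto
      then show "0 \<le> S - norm p \<and> S - norm p \<le> norm (x - p)" using norm_triangle_ineq2[of x p] x by simp
    qed
    then show "norm (?h x) \<le> M / (\<Prod>p\<in>A. S - norm p)"
      using M[of x] x M0 P by (auto simp: norm_divide prod_norm[symmetric] intro!: frac_le)
  qed (use M0 P S in auto)
  then have "(2 * pi) * norm ?s \<le> (2 * pi) * (S * M / (\<Prod>p\<in>A. S - norm p))"
    by (simp add: norm_mult mult_ac)
  then show ?thesis by (subst (asm) mult_le_cancel_left_pos) auto
qed

lemma abs_diff_squares_nat: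
  assumes "k \<le> i"
  shows "\<bar>real i ^ 2 - real k ^ 2\<bar> = real (i - k) * real (i + k)"
proof -
  have "real i ^ 2 - real k ^ 2 = real (i - k) * real (i + k)"
    using assms by (simp add: of_nat_diff power2_eq_square algebra_simps)
  then show ?thesis by simp
qed

text \<open>These are the moduli at 0 of the Lagrange basis polynomials for the nodes 1, 4, ...,
  n^2. Factoring i^2 - j^2 = (i - j)(i + j) turns them into factorials.\<close>

lemma prod_square_ratio:
  assumes "1 \<le> i" "i \<le> n"
  shows "(\<Prod>j\<in>{1..n} - {i}. real j ^ 2 / \<bar>real i ^ 2 - real j ^ 2\<bar>) = 2 * fact n ^ 2 / (fact (n - i) * fact (n + i))"
  using assms(2)
proof (induction n rule: dec_induct)
  case base
  have s: "{1..i} - {i} = {1..<i}" by auto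
  \<comment> \<open>For n = i only the factors below \<open>i\<close> occur. They are accumulated up
    to \<open>k\<close>; the truncated subtractions are exact because 1 \<le> k \<le> i.\<close>
  have "(\<Prod>j\<in>{1..<k}. real j ^ 2 / \<bar>real i ^ 2 - real j ^ 2\<bar>) = fact (k - 1) ^ 2 * fact i * fact (i - k) / (fact (i - 1) * fact (i + k - 1))"
    if "1 \<le> k" "k \<le> i" for k
    using that
  proof (induction k rule: dec_induct)
    case base then show ?case by (cases i) auto
  next
    case (step k)
    have k: "k < i" using step by auto
    have e: "{1..<Suc k} = insert k {1..<k}" using step by auto
    have ab: "\<bar>real i ^ 2 - real k ^ 2\<bar> = real (i - k) * real (i + k)"
      using k by (intro abs_diff_squares_nat) simp
    have f1: "(fact (i - k) :: real) = real (i - k) * fact (i - Suc k)"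
      using k by (metis Suc_diff_Suc fact_Suc)
    have f2: "(fact (i + Suc k - 1) :: real) = real (i + k) * fact (i + k - 1)"
      using k step by (cases "i + k") auto
    have f3: "(fact k :: real) = real k * fact (k - 1)"
      using step by (cases k) auto
    have nz: "real (i - k) \<noteq> 0" "real (i + k) \<noteq> 0" using k by auto
    have fk: "(fact (Suc k - 1) :: real) = real k * fact (k - 1)" using f3 by simp
    show ?case unfolding e
      by (subst prod.insert, simp, simp, subst step.IH, use step in simp)
        (unfold ab f1 f2 fk, use nz in \<open>simp add: field_simps power2_eq_square del: of_nat_add of_nat_diff of_nat_Suc\<close>)
  qed
  from this[of i] assms have "(\<Prod>j\<in>{1..<i}. real j ^ 2 / \<bar>real i ^ 2 - real j ^ 2\<bar>) = fact (i - 1) * fact i / fact (i + i - 1)"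
    by (simp add: power2_eq_square)
  moreover have "(fact i::real) = real i * fact (i - 1)" "(fact (i + i)::real) = real (i + i) * fact (i + i - 1)"
    using assms by (cases i, auto)+
  ultimately show ?case unfolding s using assms by (simp add: field_simps power2_eq_square)
next
  case (step n)
  have e: "{1..Suc n} - {i} = insert (Suc n) ({1..n} - {i})" using step by auto
  have ab: "\<bar>real i ^ 2 - real (Suc n) ^ 2\<bar> = real (Suc n - i) * real (Suc n + i)"
    using step abs_diff_squares_nat[of i "Suc n"] by (simp only: abs_minus_commute)
  have f1: "(fact (Suc n - i) :: real) = real (Suc n - i) * fact (n - i)"
    using step by (metis Suc_diff_le fact_Suc)
  have nz: "real (Suc n - i) \<noteq> 0" "real (Suc n + i) \<noteq> 0" using step by auto
  have f2: "(fact (Suc n + i) :: real) = real (Suc n + i) * fact (n + i)" by simp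
  have f3: "(fact (Suc n) :: real) = real (Suc n) * fact n" by simp
  show ?case unfolding e
    by (subst prod.insert, simp, simp, subst step.IH)
       (unfold ab f1 f2 f3, use nz in \<open>simp add: field_simps power2_eq_square del: of_nat_add of_nat_diff of_nat_Suc\<close>)
qed

text \<open>The product is 2 C(2n, n - i) / C(2n, n), and the central binomial coefficient is the
  largest.\<close>

lemma prod_square_ratio_le_2:
  assumes "1 \<le> i" "i \<le> n"
  shows "(\<Prod>j\<in>{1..n} - {i}. real j ^ 2 / \<bar>real i ^ 2 - real j ^ 2\<bar>) \<le> 2"
proof -
  have "(2 * n) choose (n - i) \<le> (2 * n) choose n"
    using binomial_maximum'[of n "n - i"] by simp
  then have "real ((2 * n) choose (n - i)) \<le> real ((2 * n) choose n)" by simp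
  moreover have "2 * n - (n - i) = n + i" using assms by simp
  ultimately have "(fact (2 * n)::real) / (fact (n - i) * fact (n + i)) \<le> fact (2 * n) / (fact n * fact n)"
    using assms by (simp add: binomial_fact mult_2)
  then have "(fact n ^ 2 :: real) \<le> fact (n - i) * fact (n + i)"
    by (simp add: field_simps power2_eq_square)
  then show ?thesis unfolding prod_square_ratio[OF assms] by (simp add: field_simps)
qed

text \<open>Any exponent below \<open>1/2\<close> would do in place of \<open>1/4\<close>.\<close>

definition slow_growth :: "(complex \<Rightarrow> complex) \<Rightarrow> bool" where
  "slow_growth f \<longleftrightarrow> (\<exists>C\<ge>0. \<forall>w. norm (f w) \<le> C * exp (C * norm w powr (1/4)))"

text \<open>The divided difference at 0, \<open>w 1\<close>, ..., \<open>w n\<close> is solved for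
  \<open>h 0\<close>. On the circle each factor \<open>S - norm (w j)\<close> is at least 3 lam j^2,
  which yields the power of 1/3; the values at the other nodes enter with weights of modulus at most
  2.\<close>

lemma interpolation_at_square_nodes:
  fixes h :: "complex \<Rightarrow> complex"
  assumes h: "h holomorphic_on UNIV" and lam: "lam > 0" and n: "n > 0"
    and w: "\<And>j. norm (w j) = lam * real j ^ 2"
    and M: "\<And>z. norm z = 4 * lam * real n ^ 2 \<Longrightarrow> norm (h z) \<le> M"
    and D: "\<And>j. j > 0 \<Longrightarrow> norm (h (w j)) \<le> D / norm (w j)" and D0: "D \<ge> 0"
  shows "norm (h 0) \<le> M * (1/3) ^ n + 2 * D / lam * (\<Sum>i=1..n. 1 / real i ^ 2)"
proof -
  define S where "S = 4 * lam * real n ^ 2"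
  have S: "S > 0" using lam n by (simp add: S_def)
  have "norm (h (of_real S)) \<le> M" using S by (intro M) (simp only: norm_of_real S_def abs_of_pos)
  then have M0: "0 \<le> M" using norm_ge_zero[of "h (of_real S)"] by linarith
  have w0: "w 0 = 0" using w[of 0] by simp
  have inj: "inj w"
  proof (rule injI)
    fix a b assume "w a = w b"
    then have "lam * real a ^ 2 = lam * real b ^ 2" by (simp flip: w)
    then have "real a ^ 2 = real b ^ 2" using lam by simp
    then show "a = b" by simp
  qed
  define A where "A = w ` {0..n}"
  have A: "finite A" by (simp add: A_def)
  have AS: "A \<subseteq> ball 0 S"
  proof -
    have "norm (w j) < S" if "j \<le> n" for j
    proof -
      have "real j ^ 2 \<le> real n ^ 2" using that by (simp add: power_mono)
      then have "lam * real j ^ 2 \<le> lam * real n ^ 2" using lam by simp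
      moreover have "0 < lam * real n ^ 2" using lam n by simp
      ultimately show ?thesis unfolding w S_def by linarith
    qed
    then show ?thesis by (auto simp: A_def)
  qed
  define P where "P = (\<Prod>j=1..n. lam * real j ^ 2)"
  have P0: "P > 0" unfolding P_def using lam by (intro prod_pos) auto
  have injA: "inj_on w B" for B using inj by (simp add: inj_on_def inj_def)
  have s1: "(\<Sum>p\<in>A. h p / (\<Prod>q\<in>A - {p}. p - q)) = (\<Sum>i=0..n. h (w i) / (\<Prod>j\<in>{0..n} - {i}. w i - w j))"
    unfolding A_def
  proof (subst sum.reindex[OF injA], rule sum.cong)
    fix i assume i: "i \<in> {0..n}"
    have "w ` {0..n} - {w i} = w ` ({0..n} - {i})" using inj by (auto simp: inj_def)
    then show "((\<lambda>p. h p / (\<Prod>q\<in>w ` {0..n} - {p}. p - q)) \<circ> w) i = h (w i) / (\<Prod>j\<in>{0..n} - {i}. w i - w j)"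
      by (simp add: prod.reindex[OF injA])
  qed simp
  have s2: "(\<Sum>i=0..n. h (w i) / (\<Prod>j\<in>{0..n} - {i}. w i - w j)) =
      h 0 / (\<Prod>j=1..n. - w j) + (\<Sum>i=1..n. h (w i) / (\<Prod>j\<in>{0..n} - {i}. w i - w j))"
  proof -
    have "{0..n} - {0} = {1..n}" by auto
    then show ?thesis using w0 by (simp add: sum.atLeast_Suc_atMost)
  qed
  have n1: "norm (h 0 / (\<Prod>j=1..n. - w j)) = norm (h 0) / P"
    by (simp add: norm_divide prod_norm[symmetric] w P_def)
  have n2: "norm (h (w i) / (\<Prod>j\<in>{0..n} - {i}. w i - w j)) \<le> 2 * D / (lam * real i ^ 2) / P"
    if i: "i \<in> {1..n}" for i
  proof -
    have e: "{0..n} - {i} = insert 0 ({1..n} - {i})" using i by auto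
    let ?Q = "\<Prod>j\<in>{1..n} - {i}. lam * \<bar>real i ^ 2 - real j ^ 2\<bar>"
    have ne: "real i ^ 2 \<noteq> real j ^ 2" if "j \<noteq> i" for j using that by simp
    have Q0: "?Q > 0" using lam ne by (intro prod_pos) auto
    have "P = lam * real i ^ 2 * (\<Prod>j\<in>{1..n} - {i}. lam * real j ^ 2)"
      unfolding P_def using i by (subst prod.remove[of _ i]) auto
    also have "(\<Prod>j\<in>{1..n} - {i}. lam * real j ^ 2) = (\<Prod>j\<in>{1..n} - {i}. real j ^ 2 / \<bar>real i ^ 2 - real j ^ 2\<bar>) * ?Q"
      unfolding prod.distrib[symmetric] using ne by (intro prod.cong) (auto simp: field_simps)
    also have "\<dots> \<le> 2 * ?Q" using Q0 i by (intro mult_right_mono prod_square_ratio_le_2) auto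
    finally have PQ: "P \<le> lam * real i ^ 2 * 2 * ?Q" using lam by (simp add: mult_left_mono mult.assoc)
    have "norm (\<Prod>j\<in>{0..n} - {i}. w i - w j) = norm (w i) * (\<Prod>j\<in>{1..n} - {i}. norm (w i - w j))"
      unfolding e using w0 by (subst prod.insert) (auto simp: norm_mult prod_norm[symmetric])
    moreover have "?Q \<le> (\<Prod>j\<in>{1..n} - {i}. norm (w i - w j))"
    proof (rule prod_mono)
      fix j
      have "lam * \<bar>real i ^ 2 - real j ^ 2\<bar> = \<bar>norm (w i) - norm (w j)\<bar>"
        unfolding w using lam by (simp add: abs_mult right_diff_distrib[symmetric])
      then show "0 \<le> lam * \<bar>real i ^ 2 - real j ^ 2\<bar> \<and> lam * \<bar>real i ^ 2 - real j ^ 2\<bar> \<le> norm (w i - w j)"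
        using norm_triangle_ineq3[of "w i" "w j"] lam by simp
    qed
    ultimately have "norm (w i) * ?Q \<le> norm (\<Prod>j\<in>{0..n} - {i}. w i - w j)"
      by (simp add: mult_left_mono)
    then have "norm (h (w i) / (\<Prod>j\<in>{0..n} - {i}. w i - w j)) \<le> (D / norm (w i)) / (norm (w i) * ?Q)"
      unfolding norm_divide using D[of i] i Q0 w[of i] lam D0 by (intro frac_le) auto
    also have "norm (w i) * ?Q \<ge> P / 2" using PQ w[of i] by simp
    then have "(D / norm (w i)) / (norm (w i) * ?Q) \<le> (D / norm (w i)) / (P / 2)"
      using P0 D0 by (intro divide_left_mono) (auto intro!: mult_pos_pos)
    finally show ?thesis by (simp add: w field_simps)
  qed
  \<comment> \<open>The node 0 contributes the factor \<open>S\<close>, which cancels the length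
    factor of the contour estimate.\<close>
  have P1: "(\<Prod>p\<in>A. S - norm p) = S * (\<Prod>j=1..n. S - norm (w j))"
  proof -
    have "(\<Prod>p\<in>A. S - norm p) = (\<Prod>j=0..n. S - norm (w j))"
      unfolding A_def by (subst prod.reindex[OF injA]) simp
    then show ?thesis using w0 by (simp add: prod.atLeast_Suc_atMost)
  qed
  have P2: "P * 3 ^ n \<le> (\<Prod>j=1..n. S - norm (w j))"
  proof -
    have "P * 3 ^ n = (\<Prod>j=1..n. lam * real j ^ 2 * 3)"
      by (simp add: P_def prod.distrib)
    also have "\<dots> \<le> (\<Prod>j=1..n. S - norm (w j))"
    proof (rule prod_mono)
      fix j assume "j \<in> {1..n}"
      then have "real j ^ 2 \<le> real n ^ 2" by (simp add: power_mono)
      then have "lam * real j ^ 2 \<le> lam * real n ^ 2" using lam by simp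
      then show "0 \<le> lam * real j ^ 2 * 3 \<and> lam * real j ^ 2 * 3 \<le> S - norm (w j)"
        unfolding w S_def using lam by simp
    qed
    finally show ?thesis .
  qed
  have P3: "0 < P * 3 ^ n" using P0 by simp
  have "norm (h 0) / P = norm ((\<Sum>p\<in>A. h p / (\<Prod>q\<in>A - {p}. p - q)) - (\<Sum>i=1..n. h (w i) / (\<Prod>j\<in>{0..n} - {i}. w i - w j)))"
    unfolding s1 s2 using n1 by simp
  also have "\<dots> \<le> norm (\<Sum>p\<in>A. h p / (\<Prod>q\<in>A - {p}. p - q)) + norm (\<Sum>i=1..n. h (w i) / (\<Prod>j\<in>{0..n} - {i}. w i - w j))"
    by (rule norm_triangle_ineq4)
  also have "\<dots> \<le> M / (P * 3 ^ n) + (\<Sum>i=1..n. 2 * D / (lam * real i ^ 2) / P)"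
  proof (rule add_mono)
    have "norm (\<Sum>p\<in>A. h p / (\<Prod>q\<in>A - {p}. p - q)) \<le> S * M / (\<Prod>p\<in>A. S - norm p)"
      using M unfolding S_def[symmetric] by (intro norm_divided_difference_le h A AS S) auto
    also have "\<dots> = M / (\<Prod>j=1..n. S - norm (w j))" unfolding P1 using S by simp
    also have "\<dots> \<le> M / (P * 3 ^ n)" by (rule frac_le[OF M0 order_refl P3 P2])
    finally show "norm (\<Sum>p\<in>A. h p / (\<Prod>q\<in>A - {p}. p - q)) \<le> M / (P * 3 ^ n)" .
    show "norm (\<Sum>i=1..n. h (w i) / (\<Prod>j\<in>{0..n} - {i}. w i - w j)) \<le> (\<Sum>i=1..n. 2 * D / (lam * real i ^ 2) / P)"
      by (rule order_trans[OF norm_sum sum_mono]) (rule n2)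
  qed
  also have "M / (P * 3 ^ n) = M * (1/3) ^ n / P" by (simp add: power_divide)
  also have "(\<Sum>i=1..n. 2 * D / (lam * real i ^ 2) / P) = (2 * D / lam * (\<Sum>i=1..n. 1 / real i ^ 2)) / P"
    unfolding sum_distrib_left sum_divide_distrib by (intro sum.cong) simp_all
  also have "M * (1/3) ^ n / P + (2 * D / lam * (\<Sum>i=1..n. 1 / real i ^ 2)) / P =
      (M * (1/3) ^ n + 2 * D / lam * (\<Sum>i=1..n. 1 / real i ^ 2)) / P"
    by (rule add_divide_distrib[symmetric])
  finally show ?thesis using P0 by (simp add: divide_le_cancel)
qed

text \<open>The local cofactor near \<open>a\<close> agrees with the quotient away from
  \<open>a\<close>, so the two glue to an entire function.\<close>

lemma factor_out_zero:
  assumes f: "f holomorphic_on UNIV" and nc: "\<not> f constant_on UNIV" and a: "f a = 0"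
  obtains h n where "h holomorphic_on UNIV" "h a \<noteq> 0" "n > 0" "\<And>w. f w = (w - a) ^ n * h w"
proof (rule holomorphic_factor_zero_nonconstant[OF f open_UNIV connected_UNIV UNIV_I a nc])
  fix g r n
  assume n: "0 < (n::nat)" and r: "0 < r" and g: "g holomorphic_on ball a r"
    and fg: "\<And>w. w \<in> ball a r \<Longrightarrow> f w = (w - a) ^ n * g w" and gnz: "\<And>w. w \<in> ball a r \<Longrightarrow> g w \<noteq> 0"
  define h where "h = (\<lambda>w. if w \<in> ball a r then g w else f w / (w - a) ^ n)"
  have "h holomorphic_on ball a r"
    by (rule holomorphic_transform[OF g]) (simp add: h_def)
  moreover have "h holomorphic_on - {a}"
  proof (rule holomorphic_transform)
    show "(\<lambda>w. f w / (w - a) ^ n) holomorphic_on - {a}"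
      by (intro holomorphic_intros holomorphic_on_subset[OF f]) auto
  qed (auto simp: h_def fg)
  ultimately have "h holomorphic_on ball a r \<union> - {a}"
    by (intro holomorphic_on_Un) auto
  moreover have "ball a r \<union> - {a} = UNIV" using r by auto
  moreover have "f w = (w - a) ^ n * h w" for w
    using fg[of w] a r n by (cases "w = a") (auto simp: h_def)
  moreover have "h a \<noteq> 0" using gnz[of a] r by (simp add: h_def)
  ultimately show ?thesis using n by (intro that[of h n]) auto
qed

text \<open>If the conclusion fails, the interpolation nodes \<open>w\<^sub>j\<close> with \<open>|w\<^sub>j| = \<lambda> j\<^sup>2\<close> can be chosen
  with \<open>f\<close> bounded on them; the quotient \<open>(f - f 0) / w\<^sup>q\<close> is then small at the nodes, hence zero
  at the origin when \<open>\<lambda> \<rightarrow> \<infinity>\<close>.\<close>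

lemma slow_growth_circle:
  assumes f: "f holomorphic_on UNIV" and slow: "slow_growth f" and nc: "\<not> f constant_on UNIV"
  shows "\<exists>R>R0. \<forall>w. norm w = R \<longrightarrow> norm (f w) > B"
proof (rule ccontr)
  assume "\<not> ?thesis"
  then have ex: "\<exists>w. norm w = R \<and> norm (f w) \<le> B" if "R > R0" for R
    using that by (meson not_less)
  obtain h q where h: "h holomorphic_on UNIV" and h0: "h 0 \<noteq> 0" and q: "q > 0"
    and fh: "\<And>w. f w - f 0 = w ^ q * h w"
  proof -
    have "(\<lambda>w. f w - f 0) holomorphic_on UNIV" using f by (intro holomorphic_intros)
    moreover have "\<not> (\<lambda>w. f w - f 0) constant_on UNIV"
      using nc by (auto simp: constant_on_def algebra_simps)
    ultimately show thesis using factor_out_zero[of "\<lambda>w. f w - f 0" 0] that by auto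
  qed
  obtain C where C0: "C \<ge> 0" and C: "\<And>w. norm (f w) \<le> C * exp (C * norm w powr (1/4))"
    using slow by (auto simp: slow_growth_def)
  \<comment> \<open>\<open>D\<close> bounds f - f 0 at the nodes. Division by w^q with q > 0
    improves this to D / norm w; the decay makes the sum over the nodes converge and leaves a factor
    1 / lam.\<close>
  define D where "D = \<bar>B\<bar> + norm (f 0)"
  have small: "norm (h 0) \<le> 2 * D / lam * (\<Sum>i. 1 / real (Suc i) ^ 2)" if lam: "lam > max 1 R0" for lam
  proof -
    have "\<exists>w. norm w = lam * real j ^ 2 \<and> (j > 0 \<longrightarrow> norm (f w) \<le> B)" for j
    proof (cases "j = 0")
      case False
      then have "1 \<le> real j ^ 2" by (simp add: one_le_power)
      then have "lam * 1 \<le> lam * real j ^ 2" using lam by (intro mult_left_mono) auto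
      then have "R0 < lam * real j ^ 2" using lam unfolding max_less_iff_conj by linarith
      then show ?thesis using ex[of "lam * real j ^ 2"] by auto
    qed auto
    then obtain w where w: "\<And>j. norm (w j) = lam * real j ^ 2" and wB: "\<And>j. j > 0 \<Longrightarrow> norm (f (w j)) \<le> B"
      by metis
    have hle: "norm (h z) \<le> (norm (f z) + norm (f 0)) / norm z" if z: "norm z \<ge> 1" for z
    proof -
      have "norm z * norm (h z) \<le> norm z ^ q * norm (h z)"
        using z q by (intro mult_right_mono self_le_power) auto
      also have "\<dots> = norm (f z - f 0)" by (simp add: fh norm_mult norm_power)
      also have "\<dots> \<le> norm (f z) + norm (f 0)" by (rule norm_triangle_ineq4)
      finally show ?thesis using z by (subst pos_le_divide_eq) (auto simp: mult.commute)
    qed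
    have big: "norm (w j) \<ge> 1" if "j > 0" for j
    proof -
      have "1 * 1 \<le> lam * real j ^ 2" using lam that by (intro mult_mono) (auto simp: one_le_power)
      then show ?thesis by (simp add: w)
    qed
    have D: "norm (h (w j)) \<le> D / norm (w j)" if "j > 0" for j
      using wB[OF that] by (intro order_trans[OF hle[OF big[OF that]]] divide_right_mono) (auto simp: D_def)
    define M where "M = (\<lambda>n::nat. 2 * C * exp (C * (4 * lam * real n ^ 2) powr (1/4)))"
    have bd: "norm (h 0) \<le> M n * (1/3) ^ n + 2 * D / lam * (\<Sum>i. 1 / real (Suc i) ^ 2)" if n: "n > 0" for n
    proof -
      have "norm (h 0) \<le> M n * (1/3) ^ n + 2 * D / lam * (\<Sum>i=1..n. 1 / real i ^ 2)"
      proof (rule interpolation_at_square_nodes[OF h _ n w _ D])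
        fix z :: complex assume z: "norm z = 4 * lam * real n ^ 2"
        have "1 * 1 \<le> lam * real n ^ 2" using lam n by (intro mult_mono) (auto simp: one_le_power)
        then have z1: "norm z \<ge> 1" using z by simp
        have "norm (h z) \<le> (norm (f z) + norm (f 0)) / norm z" by (rule hle[OF z1])
        also have "\<dots> \<le> norm (f z) + norm (f 0)"
          using frac_le[of "norm (f z) + norm (f 0)" "norm (f z) + norm (f 0)" 1 "norm z"] z1 by simp
        also have "norm (f 0) \<le> C * exp (C * norm z powr (1/4))"
        proof (rule order_trans)
          show "norm (f 0) \<le> C * 1" using C[of 0] by simp
          show "C * 1 \<le> C * exp (C * norm z powr (1/4))"
            using C0 by (intro mult_left_mono) auto
        qed
        finally show "norm (h z) \<le> M n" using C[of z] unfolding M_def z by simp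
      qed (use lam in \<open>auto simp: D_def\<close>)
      moreover have "(\<Sum>i=1..n. 1 / real i ^ 2) \<le> (\<Sum>i. 1 / real (Suc i) ^ 2)"
      proof -
        have "summable (\<lambda>i. 1 / real (Suc i) ^ 2)"
          using inverse_power_summable[of 2, where 'a=real]
          by (subst summable_Suc_iff[of "\<lambda>n. 1 / real n ^ 2"]) (simp add: inverse_eq_divide)
        then have "(\<Sum>i<n. 1 / real (Suc i) ^ 2) \<le> (\<Sum>i. 1 / real (Suc i) ^ 2)"
          by (rule sum_le_suminf) auto
        then show ?thesis by (simp add: sum.atLeast1_atMost_eq)
      qed
      moreover have "2 * D / lam \<ge> 0" using lam by (simp add: D_def)
      ultimately show ?thesis by (meson add_left_mono mult_left_mono order_trans)
    qed
    \<comment> \<open>The exponent 1/4 turns radius 4 lam n^2 into exp (K sqrt n), which (1/3)^n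
      beats. As \<open>K\<close> depends on lam, the limit in n is taken with lam fixed, and the
      limit in lam afterwards.\<close>
    define K where "K = C * (4 * lam) powr (1/4)"
    have "(real n ^ 2) powr (1/4) = real n powr (1/2)" for n
      by (cases "n = 0") (simp_all add: powr_powr flip: powr_numeral)
    then have "(4 * lam * real n ^ 2) powr (1/4) = (4 * lam) powr (1/4) * real n powr (1/2)" for n
      using lam by (subst powr_mult) auto
    then have Mn: "M n * (1/3) ^ n = 2 * C * exp (K * real n powr (1/2)) * (1/3) ^ n" for n
      unfolding M_def K_def by (simp only: mult.assoc)
    have "K \<ge> 0" using C0 by (simp add: K_def)
    have "(\<lambda>n. 2 * C * exp (K * real n powr (1/2)) * (1/3) ^ n) \<longlonglongrightarrow> 0"
    proof (cases "K = 0")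
      case False
      then have "K > 0" using \<open>K \<ge> 0\<close> by simp
      then show ?thesis by real_asymp
    qed (simp, real_asymp)
    then have "(\<lambda>n. M n * (1/3) ^ n) \<longlonglongrightarrow> 0" unfolding Mn .
    then have "(\<lambda>n. M n * (1/3) ^ n + 2 * D / lam * (\<Sum>i. 1 / real (Suc i) ^ 2)) \<longlonglongrightarrow> 0 + 2 * D / lam * (\<Sum>i. 1 / real (Suc i) ^ 2)"
      by (intro tendsto_intros)
    moreover have "\<forall>\<^sub>F n in sequentially. norm (h 0) \<le> M n * (1/3) ^ n + 2 * D / lam * (\<Sum>i. 1 / real (Suc i) ^ 2)"
      using eventually_gt_at_top[of "0::nat"] by eventually_elim (rule bd)
    ultimately have "norm (h 0) \<le> 0 + 2 * D / lam * (\<Sum>i. 1 / real (Suc i) ^ 2)"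
      by (rule tendsto_lowerbound) simp
    then show ?thesis by simp
  qed
  have "((\<lambda>lam. 2 * D / lam * T) \<longlongrightarrow> 0) at_top" for T :: real
    by real_asymp
  moreover have "\<forall>\<^sub>F lam in at_top. norm (h 0) \<le> 2 * D / lam * (\<Sum>i. 1 / real (Suc i) ^ 2)"
    using eventually_gt_at_top[of "max 1 R0"] by eventually_elim (rule small)
  ultimately have "norm (h 0) \<le> 0"
    by (rule tendsto_lowerbound) simp
  then show False using h0 by simp
qed


section \<open>Derivatives and zeros of functions of slow growth\<close>

lemma entire_bounded_on_cball:
  fixes f :: "complex \<Rightarrow> complex"
  assumes f: "f holomorphic_on UNIV"
  obtains B where "\<And>w. norm w \<le> R \<Longrightarrow> norm (f w) \<le> B"
proof -
  have "compact (f ` cball 0 R)"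
    by (intro compact_continuous_image holomorphic_on_imp_continuous_on holomorphic_on_subset[OF f]) auto
  then have "bounded (f ` cball 0 R)" by (rule compact_imp_bounded)
  then obtain B where B: "\<forall>x\<in>f ` cball 0 R. norm x \<le> B" unfolding bounded_iff ..
  show thesis
  proof (rule that[of B])
    fix w :: complex assume "norm w \<le> R"
    then have "f w \<in> f ` cball 0 R" by (intro imageI) simp
    with B show "norm (f w) \<le> B" by (rule bspec)
  qed
qed

lemma slow_growthI:
  assumes f: "f holomorphic_on UNIV"
    and le: "\<And>w. R0 \<le> norm w \<Longrightarrow> norm (f w) \<le> K * exp (C * norm w powr (1/4))"
  shows "slow_growth f"
proof -
  obtain B where B: "\<And>w. norm w \<le> R0 \<Longrightarrow> norm (f w) \<le> B"
    using entire_bounded_on_cball[OF f] by blast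
  define D where "D = \<bar>K\<bar> + \<bar>C\<bar> + \<bar>B\<bar>"
  have "norm (f w) \<le> D * exp (D * norm w powr (1/4))" for w
  proof (cases "R0 \<le> norm w")
    case True
    have "norm (f w) \<le> K * exp (C * norm w powr (1/4))" by (rule le[OF True])
    also have "\<dots> \<le> D * exp (D * norm w powr (1/4))"
    proof (rule mult_mono)
      have "C * norm w powr (1/4) \<le> D * norm w powr (1/4)"
        by (intro mult_right_mono) (auto simp: D_def)
      then show "exp (C * norm w powr (1/4)) \<le> exp (D * norm w powr (1/4))" by simp
    qed (auto simp: D_def)
    finally show ?thesis .
  next
    case False
    have "norm (f w) \<le> D * 1" using B[of w] False by (simp add: D_def)
    also have "\<dots> \<le> D * exp (D * norm w powr (1/4))"
      by (intro mult_left_mono) (auto simp: D_def)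
    finally show ?thesis .
  qed
  moreover have "D \<ge> 0" by (simp add: D_def)
  ultimately show ?thesis unfolding slow_growth_def by blast
qed

lemma powr_quarter_add_1_le:
  assumes "a \<ge> 0"
  shows "(a + 1) powr (1/4) \<le> a powr (1/4) + (1::real)"
proof -
  define t where "t = a powr (1/4)"
  have t: "t \<ge> 0" by (simp add: t_def)
  have "t ^ 4 = a" using assms unfolding t_def
    by (cases "a = 0") (simp_all add: powr_powr flip: powr_numeral)
  then have "a + 1 \<le> (t + 1) ^ 4"
    using t by (simp add: power4_eq_xxxx algebra_simps)
  then have "(a + 1) powr (1/4) \<le> ((t + 1) ^ 4) powr (1/4)"
    using assms by (intro powr_mono2) auto
  also have "\<dots> = t + 1" using t by (simp add: powr_powr flip: powr_numeral)
  finally show ?thesis by (simp add: t_def)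
qed

lemma slow_growth_deriv:
  assumes f: "f holomorphic_on UNIV" and slow: "slow_growth f"
  shows "slow_growth (deriv f)"
proof -
  obtain C where C0: "C \<ge> 0" and C: "\<And>w. norm (f w) \<le> C * exp (C * norm w powr (1/4))"
    using slow by (auto simp: slow_growth_def)
  show ?thesis
  proof (rule slow_growthI)
    show "deriv f holomorphic_on UNIV" using f by (intro holomorphic_deriv) auto
    fix w :: complex
    have "norm ((deriv ^^ 1) f w) \<le> fact 1 * (C * exp (C * (norm w powr (1/4) + 1))) / 1 ^ 1"
    proof (rule Cauchy_inequality)
      fix x assume "norm (w - x) = 1"
      then have "norm x \<le> norm w + 1" using norm_triangle_ineq2[of x w] by (simp add: norm_minus_commute)
      then have "norm x powr (1/4) \<le> (norm w + 1) powr (1/4)" by (intro powr_mono2) auto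
      also have "\<dots> \<le> norm w powr (1/4) + 1" by (rule powr_quarter_add_1_le) simp
      finally have "C * exp (C * norm x powr (1/4)) \<le> C * exp (C * (norm w powr (1/4) + 1))"
        using C0 by (intro mult_left_mono) (auto intro: mult_left_mono)
      then show "norm (f x) \<le> C * exp (C * (norm w powr (1/4) + 1))"
        by (rule order_trans[OF C])
    qed (auto intro!: holomorphic_on_imp_continuous_on holomorphic_on_subset[OF f])
    then show "norm (deriv f w) \<le> (C * exp C) * exp (C * norm w powr (1/4))"
      by (simp add: distrib_left exp_add mult_ac)
  qed
qed

text \<open>Otherwise 1 / f would be entire and, on some circle, smaller than half its modulus at
  the centre, against the maximum principle.\<close>

lemma slow_growth_nonvanishing_constant:
  assumes f: "f holomorphic_on UNIV" and slow: "slow_growth f" and nz: "\<And>z. f z \<noteq> 0"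
  shows "f constant_on UNIV"
proof (rule ccontr)
  assume "\<not> ?thesis"
  then obtain R where R: "R > 0" and big: "\<And>w. norm w = R \<Longrightarrow> norm (f w) > 2 * norm (f 0)"
    using slow_growth_circle[OF f slow, of 0 "2 * norm (f 0)"] by auto
  have "norm (1 / f 0) \<le> 1 / (2 * norm (f 0))"
  proof (rule maximum_modulus_frontier[where S = "ball 0 R" and f = "\<lambda>z. 1 / f z"])
    show "(\<lambda>z. 1 / f z) holomorphic_on interior (ball 0 R)"
      using nz by (intro holomorphic_intros holomorphic_on_subset[OF f]) auto
    show "continuous_on (closure (ball 0 R)) (\<lambda>z. 1 / f z)"
      using nz by (intro continuous_intros holomorphic_on_imp_continuous_on[OF holomorphic_on_subset[OF f]]) auto
    fix z assume "z \<in> frontier (ball (0::complex) R)"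
    then have "norm z = R" using R by simp
    from big[OF this] show "norm (1 / f z) \<le> 1 / (2 * norm (f 0))"
      using nz[of 0] by (auto simp: norm_divide intro!: frac_le)
  qed (use R in auto)
  then show False using nz[of 0] by (simp add: norm_divide field_simps)
qed

text \<open>A substitute for Hadamard factorization: dividing out the zeros one by one, with
  multiplicity, preserves slow growth and ends with a nonvanishing function, hence a
  constant.\<close>

lemma slow_growth_finite_zeros_polynomial:
  assumes "finite {z. f z = 0}" "f holomorphic_on UNIV" "slow_growth f"
  shows "\<exists>p. \<forall>z. f z = poly p z"
  using assms
proof (induction "card {z. f z = 0}" arbitrary: f rule: less_induct)
  case (less f)
  note fin = less.prems(1) and f = less.prems(2) and slow = less.prems(3)
  show ?case
  proof (cases "f constant_on UNIV")
    case True
    then obtain c where "\<And>z. f z = c" by (auto simp: constant_on_def)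
    then have "\<forall>z. f z = poly [:c:] z" by simp
    then show ?thesis by blast
  next
    case False
    then obtain a where a: "f a = 0" using slow_growth_nonvanishing_constant[OF f slow] by blast
    obtain h n where h: "h holomorphic_on UNIV" and ha: "h a \<noteq> 0" and n: "n > 0"
      and fh: "\<And>w. f w = (w - a) ^ n * h w"
      using factor_out_zero[OF f False a] by blast
    have Z: "{z. h z = 0} = {z. f z = 0} - {a}" using ha n by (auto simp: fh)
    obtain C where C: "\<And>w. norm (f w) \<le> C * exp (C * norm w powr (1/4))"
      using slow by (auto simp: slow_growth_def)
    have "slow_growth h"
    proof (rule slow_growthI[OF h])
      fix w :: complex assume "norm a + 1 \<le> norm w"
      then have "1 \<le> norm (w - a)" using norm_triangle_ineq2[of w a] by simp
      then have "1 * norm (h w) \<le> norm (w - a) ^ n * norm (h w)"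
        by (intro mult_right_mono one_le_power) auto
      also have "\<dots> = norm (f w)" by (simp add: fh norm_mult norm_power)
      finally show "norm (h w) \<le> C * exp (C * norm w powr (1/4))" using C[of w] by simp
    qed
    moreover have "card {z. h z = 0} < card {z. f z = 0}"
      unfolding Z by (rule card_Diff1_less[OF fin]) (simp add: a)
    moreover have "finite {z. h z = 0}"
      unfolding Z using fin by simp
    ultimately have "\<exists>p. \<forall>z. h z = poly p z" by (intro less.hyps h)
    then obtain p where "\<forall>z. h z = poly p z" by blast
    then have "\<forall>z. f z = poly ([:-a, 1:] ^ n * p) z" by (simp add: fh)
    then show ?thesis by blast
  qed
qed

section \<open>Polya's theorem on the growth of a left factor\<close>

text \<open>Some Taylor coefficient of index above N is nonzero, and Cauchy's estimate for it would
  fail on a large circle where \<open>g\<close> stays below K s^N.\<close>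

lemma entire_not_polynomial_growth:
  fixes g :: "complex \<Rightarrow> complex"
  assumes g: "g holomorphic_on UNIV" and np: "\<not> (\<exists>p. \<forall>z. g z = poly p z)"
  shows "\<exists>s0>0. \<forall>s\<ge>s0. \<exists>z. norm z = s \<and> norm (g z) > K * s ^ N"
proof -
  have "\<exists>n>N. (deriv ^^ n) g 0 \<noteq> 0"
  proof (rule ccontr)
    assume "\<not> ?thesis"
    then have zero: "\<And>n. n > N \<Longrightarrow> (deriv ^^ n) g 0 = 0" by blast
    have "g z = poly (\<Sum>n\<le>N. monom ((deriv ^^ n) g 0 / fact n) n) z" for z
    proof -
      have "(\<lambda>n. (deriv ^^ n) g 0 / fact n * (z - 0) ^ n) sums g z"
        by (rule holomorphic_power_series[of g 0 "norm z + 1"]) (auto intro: holomorphic_on_subset[OF g])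
      moreover have "(\<lambda>n. (deriv ^^ n) g 0 / fact n * (z - 0) ^ n) sums
          (\<Sum>n\<le>N. (deriv ^^ n) g 0 / fact n * (z - 0) ^ n)"
        by (rule sums_finite) (auto simp: zero)
      ultimately have "g z = (\<Sum>n\<le>N. (deriv ^^ n) g 0 / fact n * (z - 0) ^ n)"
        by (rule sums_unique2)
      then show ?thesis by (simp add: poly_sum poly_monom)
    qed
    then show False using np by blast
  qed
  then obtain n where n: "n > N" and d: "(deriv ^^ n) g 0 \<noteq> 0" by blast
  define s0 where "s0 = fact n * \<bar>K\<bar> / norm ((deriv ^^ n) g 0) + 1"
  have s0: "s0 \<ge> 1" by (simp add: s0_def)
  have "\<exists>z. norm z = s \<and> norm (g z) > K * s ^ N" if s: "s \<ge> s0" for s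
  proof (rule ccontr)
    assume "\<not> ?thesis"
    then have le: "norm (g z) \<le> K * s ^ N" if "norm z = s" for z using that not_less by blast
    have s1: "s \<ge> 1" using s s0 by simp
    have "norm ((deriv ^^ n) g 0) \<le> fact n * (K * s ^ N) / s ^ n"
      by (rule Cauchy_inequality)
         (use s1 le in \<open>auto intro!: holomorphic_on_imp_continuous_on holomorphic_on_subset[OF g]\<close>)
    then have "norm ((deriv ^^ n) g 0) * s ^ n \<le> fact n * (K * s ^ N)"
      using s1 by (simp add: pos_le_divide_eq)
    moreover have "s ^ N * s \<le> s ^ n"
      using power_increasing[of "Suc N" n s] n s1 by (simp add: mult.commute)
    ultimately have "norm ((deriv ^^ n) g 0) * (s ^ N * s) \<le> fact n * (K * s ^ N)"
      by (meson mult_left_mono norm_ge_zero order_trans)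
    then have "norm ((deriv ^^ n) g 0) * s * s ^ N \<le> fact n * K * s ^ N" by (simp add: mult_ac)
    then have "norm ((deriv ^^ n) g 0) * s \<le> fact n * K" using s1 by (subst (asm) mult_le_cancel_right_pos) auto
    also have "\<dots> \<le> fact n * \<bar>K\<bar>" by (intro mult_left_mono) auto
    finally have "s \<le> fact n * \<bar>K\<bar> / norm ((deriv ^^ n) g 0)" using d by (simp add: pos_le_divide_eq mult.commute)
    then show False using s by (simp add: s0_def)
  qed
  then show ?thesis using s0 by (intro exI[of _ s0]) auto
qed

text \<open>Schottky's bound exp (pi exp (pi (2 + 2 r + 12 t / (1 - t)))) at r = 2, t = 1/2: the 18
  is 2 + 4 + 12.\<close>

definition schottky_const :: real where
  "schottky_const = exp (pi * exp (pi * 18))"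

text \<open>A weak form of Bohr's theorem: by Schottky, a function omitting a point on each of the circles
  of radius \<open>R\<close> and \<open>2R\<close> would be bounded by a multiple of \<open>R\<close> on the disc of half the radius.\<close>

lemma image_contains_circle:
  fixes g :: "complex \<Rightarrow> complex"
  assumes g: "g holomorphic_on UNIV" and s: "s > 0" and R: "R > 0" "norm (g 0) \<le> R"
    and big: "norm z \<le> s" "norm (g z) > (3 * schottky_const + 1) * R"
  obtains R' where "R \<le> R'" "\<And>w. norm w = R' \<Longrightarrow> \<exists>z. norm z \<le> 2 * s \<and> g z = w"
proof (rule ccontr)
  assume no: "\<not> thesis"
  have "\<exists>w. norm w = R \<and> (\<forall>z. norm z \<le> 2 * s \<longrightarrow> g z \<noteq> w)" using that[of R] no by auto
  then obtain a where a: "norm a = R" "\<And>z. norm z \<le> 2 * s \<Longrightarrow> g z \<noteq> a" by blast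
  have "\<exists>w. norm w = 2 * R \<and> (\<forall>z. norm z \<le> 2 * s \<longrightarrow> g z \<noteq> w)" using that[of "2 * R"] no R by auto
  then obtain b where b: "norm b = 2 * R" "\<And>z. norm z \<le> 2 * s \<Longrightarrow> g z \<noteq> b" by blast
  have ba: "R \<le> norm (b - a)" using norm_triangle_ineq2[of b a] a b by simp
  have ba3: "norm (b - a) \<le> 3 * R" using norm_triangle_ineq4[of b a] a b by simp
  \<comment> \<open>The disc of radius 2 s becomes the unit disc and the omitted values a, b become
    0 and 1. The radii R and 2 R keep \<open>norm (b - a)\<close> between R and 3 R, so
    \<open>norm (\<phi> 0)\<close> is at most 2.\<close>
  define \<phi> where "\<phi> = (\<lambda>x. (g (of_real (2 * s) * x) - a) / (b - a))"
  have ba0: "b - a \<noteq> 0" using ba R by auto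
  have "norm (\<phi> (z / of_real (2 * s))) \<le> exp (pi * exp (pi * (2 + 2 * 2 + 12 * (1/2) / (1 - 1/2))))"
  proof (rule Schottky[where f = \<phi> and r = 2 and t = "1/2"])
    show "\<phi> holomorphic_on cball 0 1" unfolding \<phi>_def
      using holomorphic_on_compose_gen[of "\<lambda>x. of_real (2 * s) * x" "cball 0 1" g UNIV] g ba0
      by (intro holomorphic_intros) (auto simp: o_def)
    have "norm (g 0 - a) \<le> 2 * R" using norm_triangle_ineq4[of "g 0" a] a R by simp
    also have "\<dots> \<le> 2 * norm (b - a)" using ba by simp
    finally show "norm (\<phi> 0) \<le> 2" using ba0 by (simp add: \<phi>_def norm_divide divide_le_eq)
    show "\<not> (\<phi> x = 0 \<or> \<phi> x = 1)" if "x \<in> cball 0 1" for x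
    proof -
      have "norm (of_real (2 * s) * x) \<le> 2 * s" using that s by (simp add: norm_mult)
      then show ?thesis using a(2) b(2) ba0 by (auto simp: \<phi>_def)
    qed
    show "norm (z / of_real (2 * s)) \<le> 1/2" using big s by (simp add: norm_divide divide_le_eq)
  qed auto
  then have "norm (\<phi> (z / of_real (2 * s))) \<le> schottky_const" by (simp add: schottky_const_def)
  moreover have "\<phi> (z / of_real (2 * s)) = (g z - a) / (b - a)" using s by (simp add: \<phi>_def)
  ultimately have "norm (g z - a) \<le> schottky_const * norm (b - a)"
    using ba0 by (simp add: norm_divide divide_le_eq)
  also have "\<dots> \<le> schottky_const * (3 * R)"
    using ba3 by (intro mult_left_mono) (auto simp: schottky_const_def)
  finally have "norm (g z) \<le> schottky_const * (3 * R) + R"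
    using norm_triangle_ineq2[of "g z" a] a by simp
  then show False using big by (simp add: algebra_simps)
qed

text \<open>With s^N = norm w, \<open>g\<close> outgrows s^N and so maps the disc of radius 2 s over
  a circle of radius at least norm w. There \<open>f\<close> obeys the growth bound of the
  composition at radius 2 s, and the maximum principle carries it inwards to w.\<close>

lemma polya_slow_growth:
  fixes f g :: "complex \<Rightarrow> complex"
  assumes f: "f holomorphic_on UNIV" and g: "g holomorphic_on UNIV"
    and np: "\<not> (\<exists>p. \<forall>z. g z = poly p z)"
    and growth: "\<And>z. norm (f (g z)) \<le> K * exp (norm z powr \<rho>)" and \<rho>: "\<rho> \<ge> 1"
  shows "slow_growth f"
proof -
  \<comment> \<open>N \<ge> 4 \<rho> makes \<rho> / N at most 1/4, the exponent in
    \<open>slow_growth\<close>.\<close>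
  define N where "N = nat \<lceil>4 * \<rho>\<rceil>"
  have N: "real N \<ge> 4 * \<rho>" unfolding N_def by (rule real_nat_ceiling_ge)
  have N0: "N > 0" using N \<rho> by (intro Nat.gr0I) auto
  obtain s0 where s0: "s0 > 0"
    and big: "\<And>s. s \<ge> s0 \<Longrightarrow> \<exists>z. norm z = s \<and> norm (g z) > (3 * schottky_const + 1) * s ^ N"
    using entire_not_polynomial_growth[OF g np] by blast
  have K0: "K \<ge> 0"
  proof -
    have "0 \<le> K * exp (norm (0::complex) powr \<rho>)" by (rule order_trans[OF norm_ge_zero growth])
    then show ?thesis by (simp add: zero_le_mult_iff)
  qed
  show ?thesis
  proof (rule slow_growthI[OF f])
    fix w :: complex assume w: "1 + norm (g 0) + s0 ^ N \<le> norm w"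
    define R where "R = norm w"
    have "s0 ^ N > 0" using s0 by simp
    then have R1: "R \<ge> 1" and Rg: "norm (g 0) \<le> R" and Rs: "s0 ^ N \<le> R"
      using w norm_ge_zero[of "g 0"] unfolding R_def by linarith+
    define s where "s = R powr (1 / real N)"
    have sN: "s ^ N = R" using R1 N0 by (simp add: s_def powr_powr flip: powr_realpow)
    have sp: "s > 0" using R1 by (simp add: s_def)
    have "s0 \<le> s"
    proof (rule ccontr)
      assume "\<not> s0 \<le> s"
      then have "s ^ N < s0 ^ N" using sp N0 by (intro power_strict_mono) auto
      then show False using Rs sN by simp
    qed
    from big[OF this] obtain z where z: "norm z = s" "norm (g z) > (3 * schottky_const + 1) * R"
      unfolding sN by blast
    obtain R' where R': "R \<le> R'" and circ: "\<And>w. norm w = R' \<Longrightarrow> \<exists>z. norm z \<le> 2 * s \<and> g z = w"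
      using image_contains_circle[OF g sp _ Rg _ z(2)] z(1) R1 by auto
    have bd: "norm (f u) \<le> K * exp ((2 * s) powr \<rho>)" if u: "norm u = R'" for u
    proof -
      obtain x where x: "norm x \<le> 2 * s" "g x = u" using circ[OF u] by blast
      have "norm (f u) \<le> K * exp (norm x powr \<rho>)" using growth[of x] x by simp
      also have "norm x powr \<rho> \<le> (2 * s) powr \<rho>" using x \<rho> by (intro powr_mono2) auto
      then have "K * exp (norm x powr \<rho>) \<le> K * exp ((2 * s) powr \<rho>)"
        using K0 by (intro mult_left_mono) auto
      finally show ?thesis .
    qed
    have "norm (f w) \<le> K * exp ((2 * s) powr \<rho>)"
    proof (rule maximum_modulus_frontier[where S = "cball 0 R'" and f = f])
      fix u assume "u \<in> frontier (cball (0::complex) R')"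
      then show "norm (f u) \<le> K * exp ((2 * s) powr \<rho>)" using bd by (simp add: frontier_cball)
    qed (use R' in \<open>auto simp: R_def intro!: holomorphic_on_imp_continuous_on holomorphic_on_subset[OF f]\<close>)
    also have "(2 * s) powr \<rho> = 2 powr \<rho> * R powr (\<rho> / real N)"
      using R1 by (simp add: s_def powr_mult powr_powr)
    also have "R powr (\<rho> / real N) \<le> R powr (1/4)"
      using R1 N N0 by (intro powr_mono) (auto simp: field_simps)
    then have "K * exp (2 powr \<rho> * R powr (\<rho> / real N)) \<le> K * exp (2 powr \<rho> * R powr (1/4))"
      using K0 by (intro mult_left_mono) auto
    finally show "norm (f w) \<le> K * exp (2 powr \<rho> * norm w powr (1/4))" by (simp add: R_def)
  qed
qed

section \<open>Periodicity of the right factor\<close>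

lemma holomorphic_compose_entire:
  assumes "g holomorphic_on UNIV" "h holomorphic_on A"
  shows "(\<lambda>z. g (h z)) holomorphic_on A"
  using holomorphic_on_compose_gen[OF assms(2,1)] by (simp add: o_def)

lemma entire_deriv_nonzero:
  assumes F: "F holomorphic_on UNIV" and nc: "\<not> F constant_on UNIV"
  obtains z where "deriv F z \<noteq> 0"
proof (rule ccontr)
  assume no: "\<not> thesis"
  have "(F has_field_derivative 0) (at z)" for z
  proof -
    have "deriv F z = 0" using no that by blast
    then show ?thesis using holomorphic_derivI[OF F open_UNIV UNIV_I, of z] by simp
  qed
  then have "\<exists>c. \<forall>x\<in>UNIV. F x = c"
    by (intro has_field_derivative_zero_constant) (auto intro: has_field_derivative_at_within)
  then show False using nc by (auto simp: constant_on_def)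
qed

lemma periodic_nat:
  fixes F :: "complex \<Rightarrow> 'a"
  assumes "\<And>z. F (z + p) = F z"
  shows "F (z + of_nat k * p) = F z"
proof (induction k)
  case (Suc k)
  have "F (z + of_nat (Suc k) * p) = F ((z + of_nat k * p) + p)" by (simp add: algebra_simps)
  then show ?case using assms Suc by simp
qed simp

lemma periodic_int:
  fixes F :: "complex \<Rightarrow> 'a"
  assumes "\<And>z. F (z + p) = F z"
  shows "F (z + of_int k * p) = F z"
proof (cases k)
  case (nonneg n)
  then show ?thesis using periodic_nat[of F p, OF assms] by simp
next
  case (neg n)
  have "F (z + of_int k * p) = F ((z + of_int k * p) + of_nat (Suc n) * p)"
    by (rule periodic_nat[of F p, OF assms, symmetric])
  also have "(z + of_int k * p) + of_nat (Suc n) * p = z" by (simp add: neg algebra_simps)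
  finally show ?thesis .
qed

lemma shift_into_strip:
  fixes z :: complex
  obtains k :: int where "\<bar>Re (z + of_int k * of_real (2 * pi))\<bar> \<le> 2 * pi"
proof -
  define k where "k = \<lfloor>Re z / (2 * pi)\<rfloor>"
  have "of_int k \<le> Re z / (2 * pi)" "Re z / (2 * pi) < of_int k + 1"
    unfolding k_def by linarith+
  then have "of_int k * (2 * pi) \<le> Re z" "Re z < (of_int k + 1) * (2 * pi)"
    by (simp_all add: field_simps)
  then have "\<bar>Re (z + of_int (- k) * of_real (2 * pi))\<bar> \<le> 2 * pi" by (simp add: algebra_simps)
  then show thesis by (rule that)
qed

text \<open>The translates \<open>g (z + 2\<pi>k)\<close> are branches of \<open>f\<^sup>-\<^sup>1 \<circ> F\<close>. They stay bounded on a horizontal line,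
  because \<open>F\<close> does while \<open>f\<close> is large on arbitrarily large circles, so two of them coincide.\<close>

lemma right_factor_periodic:
  fixes f g :: "complex \<Rightarrow> complex"
  assumes f: "f holomorphic_on UNIV" and g: "g holomorphic_on UNIV"
    and per: "\<And>z. f (g (z + of_real (2 * pi))) = f (g z)"
    and nc: "\<not> (\<lambda>z. f (g z)) constant_on UNIV"
    and circ: "\<And>B R0. \<exists>R>R0. \<forall>w. norm w = R \<longrightarrow> norm (f w) > B"
  obtains m :: nat where "m > 0" "\<And>z. g (z + of_nat m * of_real (2 * pi)) = g z"
proof -
  define F where "F = (\<lambda>z. f (g z))"
  have F: "F holomorphic_on UNIV"
    unfolding F_def by (intro holomorphic_compose_entire[OF f] g)
  have Fper: "F (z + of_real (2 * pi)) = F z" for z using per by (simp add: F_def)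
  \<comment> \<open>A base point with F' \<noteq> 0 forces f' \<noteq> 0 at the value of
    \<open>g\<close> in each of its translates, where local injectivity of \<open>f\<close> is
    wanted.\<close>
  obtain z0 where z0: "deriv F z0 \<noteq> 0" using entire_deriv_nonzero[OF F] nc unfolding F_def by blast
  define L where "L = {z. Im z = Im z0}"
  have cL: "connected L"
    unfolding L_def by (intro convex_connected) (auto simp: convex_def simp flip: distrib_right)
  have "\<exists>B. \<forall>z\<in>L. norm (F z) \<le> B"
  proof -
    obtain B where B: "\<And>w. norm w \<le> 2 * pi + norm z0 \<Longrightarrow> norm (F w) \<le> B"
      using entire_bounded_on_cball[OF F] by blast
    have "norm (F z) \<le> B" if z: "z \<in> L" for z
    proof -
      obtain k :: int where k: "\<bar>Re (z + of_int k * of_real (2 * pi))\<bar> \<le> 2 * pi" by (rule shift_into_strip)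
      define z' where "z' = z + of_int k * of_real (2 * pi)"
      have "\<bar>Re z'\<bar> \<le> 2 * pi" using k by (simp only: z'_def)
      moreover have "\<bar>Im z'\<bar> \<le> norm z0" using z abs_Im_le_cmod[of z0] by (simp add: z'_def L_def)
      ultimately have "norm z' \<le> 2 * pi + norm z0" using cmod_le[of z'] by linarith
      then have "norm (F z') \<le> B" by (rule B)
      then show ?thesis unfolding z'_def by (simp only: periodic_int[of F "of_real (2 * pi)", OF Fper])
    qed
    then show ?thesis by blast
  qed
  then obtain B where B: "\<And>z. z \<in> L \<Longrightarrow> norm (F z) \<le> B" by blast
  obtain R where R: "R > norm (g z0)" and RB: "\<And>w. norm w = R \<Longrightarrow> norm (f w) > B" using circ by blast
  have gR: "norm (g z) \<le> R" if z: "z \<in> L" for z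
  proof (rule ccontr)
    assume "\<not> norm (g z) \<le> R"
    then have Rz: "R \<le> norm (g z)" by simp
    \<comment> \<open>\<open>norm (g z)\<close> starts below R and varies continuously along the
      line; to pass R it would have to equal R, where \<open>f\<close> exceeds the bound B of
      F.\<close>
    have "connected ((\<lambda>z. norm (g z)) ` L)"
      by (intro connected_continuous_image cL continuous_intros
          holomorphic_on_imp_continuous_on holomorphic_on_subset[OF g]) auto
    moreover have "norm (g z0) \<in> (\<lambda>z. norm (g z)) ` L" by (intro imageI) (simp add: L_def)
    moreover have "norm (g z) \<in> (\<lambda>z. norm (g z)) ` L" using z by (intro imageI)
    ultimately have "R \<in> (\<lambda>z. norm (g z)) ` L"
      using connectedD_interval less_imp_le[OF R] Rz by metis
    then obtain z1 where "z1 \<in> L" "R = norm (g z1)" by (rule imageE)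
    then show False using B[of z1] RB[of "g z1"] by (simp only: F_def) simp
  qed
  define t where "t = (\<lambda>k::nat. z0 + of_nat k * of_real (2 * pi))"
  have tL: "t k \<in> L" for k by (simp add: t_def L_def)
  have Ft: "F (t k) = F z0" for k unfolding t_def by (rule periodic_nat[of F "of_real (2 * pi)", OF Fper])
  have fnc: "\<not> (\<lambda>u. f u - F z0) constant_on UNIV"
  proof
    assume "(\<lambda>u. f u - F z0) constant_on UNIV"
    then obtain c where c: "\<And>u. f u - F z0 = c" unfolding constant_on_def by blast
    then have "f u = c + F z0" for u by (simp add: algebra_simps)
    then show False using nc by (simp add: constant_on_def)
  qed
  have "finite {u \<in> cball 0 R. f u - F z0 = 0}"
    using f fnc by (intro holomorphic_compact_finite_zeros[where S = UNIV] holomorphic_intros) auto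
  moreover have "range (\<lambda>k. g (t k)) \<subseteq> {u \<in> cball 0 R. f u - F z0 = 0}"
    using gR tL Ft by (auto simp: F_def)
  ultimately have "finite (range (\<lambda>k. g (t k)))" by (rule rev_finite_subset)
  then have "\<not> inj (\<lambda>k. g (t k))" using finite_imageD infinite_UNIV_nat by blast
  then obtain k0 l0 where "k0 \<noteq> l0" "g (t k0) = g (t l0)" by (auto simp: inj_def)
  then obtain k l where kl: "k < l" "g (t k) = g (t l)" by (metis linorder_neqE_nat)
  define u where "u = g (t k)"
  have du: "deriv f u \<noteq> 0"
  proof
    assume "deriv f u = 0"
    then have "(f has_field_derivative 0) (at (g (t k)))"
      using holomorphic_derivI[OF f open_UNIV UNIV_I, of u] by (simp add: u_def)
    moreover have "(g has_field_derivative deriv g (t k)) (at (t k))"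
      using holomorphic_derivI[OF g open_UNIV UNIV_I] by blast
    ultimately have "(F has_field_derivative 0 * deriv g (t k)) (at (t k))"
      unfolding F_def by (rule DERIV_chain2)
    then have "((\<lambda>z. F (z + of_nat k * of_real (2 * pi))) has_field_derivative 0) (at z0)"
      unfolding t_def by (subst DERIV_shift[symmetric]) simp
    then have "(F has_field_derivative 0) (at z0)"
      by (simp only: periodic_nat[of F "of_real (2 * pi)", OF Fper])
    then show False using z0 DERIV_imp_deriv by blast
  qed
  obtain r where r: "r > 0" "inj_on f (ball u r)"
    using has_complex_derivative_locally_injective[OF f UNIV_I open_UNIV du] by blast
  let ?gk = "\<lambda>j z. g (z + of_nat j * of_real (2 * pi))"
  have gj: "?gk j holomorphic_on UNIV" for j
    by (intro holomorphic_compose_entire[OF g] holomorphic_intros)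
  have op: "open (?gk j -` ball u r)" for j
    using gj[of j] by (intro open_vimage holomorphic_on_imp_continuous_on) auto
  \<comment> \<open>Near z0 both translates stay in a disc on which \<open>f\<close> is injective,
    and \<open>f\<close> has the same value on them. The identity theorem extends their equality to
    the plane.\<close>
  define S where "S = ?gk k -` ball u r \<inter> ?gk l -` ball u r"
  have "?gk k z = ?gk l z" if "z \<in> UNIV" for z
  proof (rule analytic_continuation_open[of S UNIV "?gk k" "?gk l"])
    show "open S" unfolding S_def by (intro open_Int op)
    have "z0 \<in> S" using r kl by (simp add: S_def u_def t_def)
    then show "S \<noteq> {}" by blast
    fix x assume "x \<in> S"
    then have "?gk k x \<in> ball u r" "?gk l x \<in> ball u r" by (simp_all add: S_def)
    moreover have "F (x + of_nat k * of_real (2 * pi)) = F (x + of_nat l * of_real (2 * pi))"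
      by (simp only: periodic_nat[of F "of_real (2 * pi)", OF Fper])
    then have "f (?gk k x) = f (?gk l x)" by (simp only: F_def)
    ultimately show "?gk k x = ?gk l x" using r(2) by (auto dest: inj_onD)
  qed (use gj in auto)
  then have eq: "?gk k z = ?gk l z" for z by blast
  have "g (z + of_nat (l - k) * of_real (2 * pi)) = g z" for z
  proof -
    have "of_nat l = (of_nat k + of_nat (l - k) :: complex)" using kl by (simp flip: of_nat_add)
    then have "z + of_nat (l - k) * of_real (2 * pi) = (z - of_nat k * of_real (2 * pi)) + of_nat l * of_real (2 * pi)"
      by (simp add: algebra_simps)
    then have "g (z + of_nat (l - k) * of_real (2 * pi)) = ?gk k (z - of_nat k * of_real (2 * pi))"
      by (simp only: eq)
    then show ?thesis by (simp only: diff_add_cancel)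
  qed
  then show thesis using kl by (intro that[of "l - k"]) auto
qed

text \<open>The principal logarithm defines \<open>\<gamma>\<close>. Its jump across the negative
  axis corresponds to a full period of \<open>g\<close>, so the branch
  \<open>Ln (- x) + \<i> * of_real pi\<close> gives the same function and proves holomorphy
  there.\<close>

lemma periodic_factor_exp:
  fixes g :: "complex \<Rightarrow> complex"
  assumes g: "g holomorphic_on UNIV" and m: "m > 0"
    and per: "\<And>z. g (z + of_nat m * of_real (2 * pi)) = g z"
  obtains \<gamma> where "\<gamma> holomorphic_on - {0}" "\<And>z. g z = \<gamma> (exp (\<i> * z / of_nat m))"
proof -
  define \<gamma> where "\<gamma> = (\<lambda>x. g (- \<i> * of_nat m * Ln x))"
  have eq: "g z1 = g z2" if "exp (\<i> * z1 / of_nat m) = exp (\<i> * z2 / of_nat m)" for z1 z2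
  proof -
    obtain n where "\<i> * z1 / of_nat m = \<i> * z2 / of_nat m + complex_of_real (of_int (2 * n) * pi) * \<i>"
      using \<open>exp _ = exp _\<close> unfolding exp_eq by blast
    then have "\<i> * z1 = \<i> * (z2 + of_int n * (of_nat m * of_real (2 * pi)))"
      using m by (simp add: field_simps)
    then have "z1 = z2 + of_int n * (of_nat m * of_real (2 * pi))" by simp
    then show ?thesis using periodic_int[of g "of_nat m * of_real (2 * pi)", OF per] by simp
  qed
  have E: "exp (\<i> * (- \<i> * of_nat m * w) / of_nat m) = exp w" for w
    using m by simp
  have gz: "g z = \<gamma> (exp (\<i> * z / of_nat m))" for z
    unfolding \<gamma>_def by (rule eq) (simp only: E exp_Ln exp_not_eq_zero not_False_eq_True)
  have gE: "g (- \<i> * of_nat m * w) = \<gamma> (exp w)" for w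
    using gz[of "- \<i> * of_nat m * w"] unfolding E .
  have h1: "\<gamma> holomorphic_on - \<real>\<^sub>\<le>\<^sub>0"
  proof -
    have "g \<circ> (\<lambda>x. - \<i> * of_nat m * Ln x) holomorphic_on - \<real>\<^sub>\<le>\<^sub>0"
      by (intro holomorphic_on_compose_gen[OF _ g] holomorphic_intros) auto
    then show ?thesis by (simp add: \<gamma>_def o_def)
  qed
  have h2: "\<gamma> holomorphic_on - \<real>\<^sub>\<ge>\<^sub>0"
  proof (rule holomorphic_transform)
    have "g \<circ> (\<lambda>x. - \<i> * of_nat m * (Ln (- x) + \<i> * of_real pi)) holomorphic_on - \<real>\<^sub>\<ge>\<^sub>0"
      by (intro holomorphic_on_compose_gen[OF _ g] holomorphic_intros)
         (auto simp: complex_nonpos_Reals_iff complex_nonneg_Reals_iff)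
    then show "(\<lambda>x. g (- \<i> * of_nat m * (Ln (- x) + \<i> * of_real pi))) holomorphic_on - \<real>\<^sub>\<ge>\<^sub>0"
      by (simp add: o_def)
    fix x :: complex assume x: "x \<in> - \<real>\<^sub>\<ge>\<^sub>0"
    then have "x \<noteq> 0" by auto
    then have "exp (Ln (- x) + \<i> * of_real pi) = x" by (simp add: exp_add exp_Euler cis_conv_exp[symmetric])
    then show "g (- \<i> * of_nat m * (Ln (- x) + \<i> * of_real pi)) = \<gamma> x" unfolding gE by simp
  qed
  have "\<gamma> holomorphic_on (- \<real>\<^sub>\<le>\<^sub>0) \<union> (- \<real>\<^sub>\<ge>\<^sub>0)"
    by (intro holomorphic_on_Un h1 h2 open_Compl closed_nonpos_Reals_complex closed_nonneg_Reals_complex)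
  moreover have "(- \<real>\<^sub>\<le>\<^sub>0) \<union> (- \<real>\<^sub>\<ge>\<^sub>0) = - {0::complex}"
    by (auto simp: complex_nonpos_Reals_iff complex_nonneg_Reals_iff complex_eq_iff)
  ultimately show thesis using gz by (intro that[of \<gamma>]) auto
qed


section \<open>Behaviour at the ends of the cylinder\<close>

text \<open>The two alternatives are a finite limit and a pole at infinity.\<close>

lemma picard_end:
  fixes \<gamma> :: "complex \<Rightarrow> complex"
  assumes \<gamma>: "\<gamma> holomorphic_on - {0}" and ab: "a \<noteq> b"
    and fin: "finite {x. x \<noteq> 0 \<and> \<gamma> x = a}" "finite {x. x \<noteq> 0 \<and> \<gamma> x = b}"
  shows "(\<exists>B R. \<forall>x. R \<le> norm x \<longrightarrow> norm (\<gamma> x) \<le> B) \<or>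
         (\<exists>C N R. \<forall>x. R \<le> norm x \<longrightarrow> norm (\<gamma> x) \<le> C * norm x ^ N) \<and>
         (\<forall>\<rho>. \<exists>R. \<forall>w. R < norm w \<longrightarrow> (\<exists>x. \<rho> < norm x \<and> \<gamma> x = w))"
proof -
  have "bounded ({x. x \<noteq> 0 \<and> \<gamma> x = a} \<union> {x. x \<noteq> 0 \<and> \<gamma> x = b})"
    using fin by (intro finite_imp_bounded) auto
  then obtain R0 where R0: "R0 > 0" "\<And>x. x \<noteq> 0 \<Longrightarrow> \<gamma> x = a \<or> \<gamma> x = b \<Longrightarrow> norm x \<le> R0"
    unfolding bounded_pos by blast
  \<comment> \<open>All solutions of \<gamma> x = a or \<gamma> x = b have modulus at most
    \<open>R0\<close>, so \<open>d\<close> omits 0 and b - a near 0 and great Picard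
    applies.\<close>
  define d where "d = (\<lambda>u. \<gamma> (1 / u) - a)"
  define e where "e = 1 / R0"
  have e: "e > 0" using R0 by (simp add: e_def)
  have small: "norm (1 / u) > R0" if "u \<in> ball 0 e - {0}" for u :: complex
    using that R0(1) by (simp add: e_def norm_divide field_simps)
  have d: "d holomorphic_on ball 0 e - {0}"
  proof -
    have "\<gamma> \<circ> (\<lambda>u. 1 / u) holomorphic_on ball 0 e - {0}"
      by (intro holomorphic_on_compose_gen[OF _ \<gamma>] holomorphic_intros) auto
    then show ?thesis unfolding d_def o_def by (intro holomorphic_intros)
  qed
  have d0: "d u \<noteq> 0 \<and> d u \<noteq> b - a" if "u \<in> ball 0 e - {0}" for u
    using R0(2)[of "1 / u"] small[OF that] that by (auto simp: d_def)
  have gd: "\<gamma> x = d (1 / x) + a" for x by (simp add: d_def)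
  obtain l where "(d \<longlongrightarrow> l) (at 0) \<or> ((inverse \<circ> d) \<longlongrightarrow> l) (at 0)"
    using great_Picard[of "ball 0 e" 0 0 "b - a" d] d d0 e ab by auto
  moreover have bdd: "\<exists>B R. \<forall>x. R \<le> norm x \<longrightarrow> norm (\<gamma> x) \<le> B" if lim: "(d \<longlongrightarrow> l) (at 0)" for l
  proof -
    have "\<forall>\<^sub>F u in at 0. norm (d u - l) < 1" using tendstoD[OF lim, of 1] by (simp add: dist_norm)
    then obtain r where r: "r > 0" "\<And>u. u \<noteq> 0 \<Longrightarrow> norm u < r \<Longrightarrow> norm (d u - l) < 1"
      unfolding eventually_at by (auto simp: dist_norm)
    have "norm (\<gamma> x) \<le> norm l + 1 + norm a" if x: "2 / r \<le> norm x" for x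
    proof -
      have "norm x > 0" using x r by (intro less_le_trans[OF _ x]) simp
      moreover from this have "norm (1 / x) < r" using x r by (simp add: norm_divide field_simps)
      ultimately have "norm (d (1 / x) - l) < 1" by (intro r(2)) auto
      then have "norm (d (1 / x)) \<le> norm l + 1" using norm_triangle_ineq2[of "d (1 / x)" l] by simp
      then show ?thesis unfolding gd[of x] using norm_triangle_ineq[of "d (1 / x)" a] by simp
    qed
    then show ?thesis by blast
  qed
  moreover have ?thesis if lim: "((inverse \<circ> d) \<longlongrightarrow> l) (at 0)" for l
  proof (cases "l = 0")
    case False
    then have "((\<lambda>u. inverse ((inverse \<circ> d) u)) \<longlongrightarrow> inverse l) (at 0)" by (intro tendsto_inverse lim)
    then have "(d \<longlongrightarrow> inverse l) (at 0)" by simp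
    then show ?thesis using bdd by blast
  next
    case True
    \<comment> \<open>Here 1 / d extends by 0 to a nonconstant holomorphic \<open>q\<close>. The
      order of its zero bounds \<open>\<gamma>\<close> by a power, and the open mapping theorem
      makes \<open>\<gamma>\<close> attain all large values far out.\<close>
    define q where "q = (\<lambda>u. if u = 0 then 0 else inverse (d u))"
    have q: "q holomorphic_on ball 0 e"
    proof (rule no_isolated_singularity'[of "{0}"])
      have "((\<lambda>u. inverse (d u)) \<longlongrightarrow> 0) (at 0)" using lim True by (simp add: o_def)
      then have "(q \<longlongrightarrow> 0) (at 0)"
        by (rule Lim_transform_eventually) (auto simp: eventually_at_filter q_def)
      then show "(q \<longlongrightarrow> q z) (at z within ball 0 e)" if "z \<in> {0}" for z
        using that by (auto simp: q_def intro: tendsto_within_subset)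
      show "q holomorphic_on ball 0 e - {0}"
      proof (rule holomorphic_transform)
        show "(\<lambda>u. inverse (d u)) holomorphic_on ball 0 e - {0}"
          using d0 by (intro holomorphic_intros d) blast
      qed (auto simp: q_def)
    qed auto
    have qnz: "q u \<noteq> 0" if "u \<in> ball 0 e - {0}" for u
      using d0[OF that] that by (simp add: q_def)
    have nc: "\<not> q constant_on ball 0 e"
    proof
      assume "q constant_on ball 0 e"
      then obtain c where c: "\<And>u. u \<in> ball 0 e \<Longrightarrow> q u = c" unfolding constant_on_def by blast
      have "q (of_real (e / 2)) = q 0" using c[of "of_real (e / 2)"] c[of 0] e by simp
      then show False using qnz[of "of_real (e / 2)"] e by (simp add: q_def)
    qed
    have gq: "\<gamma> x = inverse (q (1 / x)) + a" if "x \<noteq> 0" for x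
      using that by (simp add: gd[of x] q_def)
    have "\<exists>C N R. \<forall>x. R \<le> norm x \<longrightarrow> norm (\<gamma> x) \<le> C * norm x ^ N"
    proof -
      obtain k n r where k: "0 < k" and r: "0 < r" "ball 0 r \<subseteq> ball (0::complex) e"
        and kn: "\<And>w. w \<in> ball 0 r \<Longrightarrow> k * norm (w - 0) ^ n \<le> norm (q w - q 0)"
      proof -
        have ne: "q (of_real (e / 2)) \<noteq> q 0" using qnz[of "of_real (e / 2)"] e by (simp add: q_def)
        have mem: "0 \<in> ball 0 e" "of_real (e / 2) \<in> ball (0::complex) e" using e by auto
        show thesis
          by (rule holomorphic_lower_bound_difference[OF q open_ball connected_ball mem ne]) (rule that)
      qed
      have "norm (\<gamma> x) \<le> (1 / k + norm a) * norm x ^ n" if x: "max 1 (2 / r) \<le> norm x" for x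
      proof -
        have x0: "norm x \<ge> 1" "norm x \<ge> 2 / r" using x by auto
        have xz: "x \<noteq> 0" using x0 by auto
        have "norm (1 / x) < r" using x0 xz r by (simp add: norm_divide field_simps)
        then have "k * norm (1 / x) ^ n \<le> norm (q (1 / x))" using kn[of "1 / x"] by (simp add: q_def)
        then have "inverse (norm (q (1 / x))) \<le> inverse (k * norm (1 / x) ^ n)"
          using k xz by (intro le_imp_inverse_le) auto
        also have "\<dots> = 1 / k * norm x ^ n" by (simp add: norm_divide power_divide field_simps)
        finally have "norm (inverse (q (1 / x))) \<le> 1 / k * norm x ^ n" by (simp add: norm_inverse)
        moreover have "norm a * 1 \<le> norm a * norm x ^ n"
          using x0 by (intro mult_left_mono one_le_power) auto
        ultimately show ?thesis unfolding gq[OF xz] distrib_right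
          using norm_triangle_ineq[of "inverse (q (1 / x))" a] by linarith
      qed
      then show ?thesis by blast
    qed
    moreover have "\<exists>R. \<forall>w. R < norm w \<longrightarrow> (\<exists>x. \<rho> < norm x \<and> \<gamma> x = w)" for \<rho>
    proof -
      define s where "s = min e (1 / (\<bar>\<rho>\<bar> + 1))"
      have s: "s > 0" "s \<le> e" "s \<le> 1 / (\<bar>\<rho>\<bar> + 1)" using e by (auto simp: s_def)
      have "open (q ` ball 0 s)"
        by (rule open_mapping_thm[OF q]) (use s nc in auto)
      moreover have "0 \<in> q ` ball 0 s" using s by (intro image_eqI[of _ _ 0]) (auto simp: q_def)
      ultimately obtain \<eta> where \<eta>: "\<eta> > 0" "ball 0 \<eta> \<subseteq> q ` ball 0 s"
        by (meson openE)
      have "\<exists>x. \<rho> < norm x \<and> \<gamma> x = w" if w: "1 / \<eta> + norm a < norm w" for w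
      proof -
        have "1 / \<eta> < norm (w - a)" using w norm_triangle_ineq2[of w a] by simp
        moreover have "0 < 1 / \<eta>" using \<eta> by simp
        ultimately have pos: "0 < norm (w - a)" and "1 < norm (w - a) * \<eta>"
          using \<eta> by (linarith, simp add: pos_divide_less_eq)
        then have "1 / norm (w - a) < \<eta>" by (simp add: pos_divide_less_eq mult.commute)
        then have wa: "inverse (w - a) \<in> ball 0 \<eta>" "w - a \<noteq> 0"
          using pos by (simp_all add: norm_inverse inverse_eq_divide norm_divide)
        obtain u where u: "inverse (w - a) = q u" "u \<in> ball 0 s" using \<eta>(2) wa(1) by blast
        have u0: "u \<noteq> 0" using u(1) wa(2) by (auto simp: q_def)
        have "\<gamma> (1 / u) = inverse (q u) + a" using gq[of "1 / u"] u0 by simp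
        also have "\<dots> = w" using u(1)[symmetric] by simp
        finally have "\<gamma> (1 / u) = w" .
        moreover have "\<rho> < norm (1 / u)"
        proof -
          have "norm u < 1 / (\<bar>\<rho>\<bar> + 1)" using u(2) s(3) by simp
          then have "\<bar>\<rho>\<bar> + 1 < 1 / norm u" using u0 by (simp add: field_simps)
          then show ?thesis by (simp add: norm_divide)
        qed
        ultimately show ?thesis by blast
      qed
      then show ?thesis by blast
    qed
    ultimately show ?thesis by blast
  qed
  ultimately show ?thesis by blast
qed

section \<open>Factorizations of periodic functions with generic critical points\<close>

lemma period_orbit_shift: "period_orbit (z + of_int k * of_real (2 * pi)) = period_orbit z"
proof (intro equalityI subsetI)
  fix x assume "x \<in> period_orbit (z + of_int k * of_real (2 * pi))"
  then obtain n :: int where "x = z + of_int k * of_real (2 * pi) + of_int n * 2 * of_real pi"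
    by (auto simp: period_orbit_def)
  then have "x = z + of_int (k + n) * 2 * of_real pi" by (simp add: algebra_simps)
  then show "x \<in> period_orbit z" unfolding period_orbit_def by blast
next
  fix x assume "x \<in> period_orbit z"
  then obtain n :: int where "x = z + of_int n * 2 * of_real pi" by (auto simp: period_orbit_def)
  then have "x = z + of_int k * of_real (2 * pi) + of_int (n - k) * 2 * of_real pi"
    by (simp add: algebra_simps)
  then show "x \<in> period_orbit (z + of_int k * of_real (2 * pi))" unfolding period_orbit_def by blast
qed

text \<open>Vieta's formula for the sum of the roots; the leading coefficient is carried along for
  the induction.\<close>

lemma coeff_prod_linear_factors:
  fixes root :: "nat \<Rightarrow> complex"
  shows "coeff (\<Prod>i<d. [:- root i, 1:]) d = 1 \<and> coeff (\<Prod>i<Suc d. [:- root i, 1:]) d = - (\<Sum>i<Suc d. root i)"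
proof (induction d)
  case (Suc d)
  have r: "(\<Prod>i<Suc n. [:- root i, 1:]) = pCons 0 (\<Prod>i<n. [:- root i, 1:]) - smult (root n) (\<Prod>i<n. [:- root i, 1:])" for n
    by (simp add: mult.commute)
  have deg: "degree (\<Prod>i<n. [:- root i, 1:]) = n" for n
    by (subst degree_prod_sum_eq) auto
  have 1: "coeff (\<Prod>i<Suc d. [:- root i, 1:]) (Suc d) = 1"
  proof -
    have "coeff (\<Prod>i<d. [:- root i, 1:]) (Suc d) = 0" by (rule coeff_eq_0) (simp add: deg)
    then show ?thesis unfolding r using Suc by simp
  qed
  have "coeff (\<Prod>i<Suc (Suc d). [:- root i, 1:]) (Suc d) = - (\<Sum>i<Suc (Suc d). root i)"
    using Suc 1 by (subst r) (simp del: prod.lessThan_Suc)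
  with 1 show ?case by blast
qed simp

lemma poly_growth:
  fixes p :: "complex poly"
  shows "\<exists>A n. \<forall>u. norm (poly p u) \<le> A * (1 + norm u) ^ n"
proof (induction p)
  case 0
  show ?case by (rule exI[of _ 0]) simp
next
  case (pCons a p)
  then obtain A n where A: "\<And>u. norm (poly p u) \<le> A * (1 + norm u) ^ n" by blast
  have "norm (poly (pCons a p) u) \<le> (norm a + A) * (1 + norm u) ^ Suc n" for u
  proof -
    have A0: "A \<ge> 0" using order_trans[OF norm_ge_zero A[of 0]] by simp
    have "norm (poly (pCons a p) u) \<le> norm a + norm u * norm (poly p u)"
      using norm_triangle_ineq[of a "u * poly p u"] by (simp add: norm_mult)
    also have "norm a * 1 \<le> norm a * (1 + norm u) ^ Suc n"
      by (intro mult_left_mono one_le_power) auto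
    then have "norm a \<le> norm a * (1 + norm u) ^ Suc n" by simp
    moreover have "norm u * norm (poly p u) \<le> (1 + norm u) * (A * (1 + norm u) ^ n)"
      using A[of u] A0 by (intro mult_mono) auto
    ultimately show ?thesis by (simp add: algebra_simps)
  qed
  then show ?case by blast
qed

text \<open>Takes the place of \<open>slow_growth_circle\<close> when the left factor is a
  polynomial.\<close>

lemma poly_large_on_circles:
  fixes p :: "complex poly"
  assumes "degree p > 0"
  shows "\<exists>R>R0. \<forall>w. norm w = R \<longrightarrow> norm (poly p w) > B"
proof -
  obtain a q where p: "p = pCons a q" by (cases p)
  then have "q \<noteq> 0" using assms by auto
  from poly_infinity[OF this, of "B + 1" a] obtain r where
    r: "\<And>z. r \<le> norm z \<Longrightarrow> B + 1 \<le> norm (poly p z)" unfolding p by blast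
  have "norm (poly p w) > B" if "norm w = max r (R0 + 1)" for w
    using r[of w] that by simp
  then show ?thesis by (intro exI[of _ "max r (R0 + 1)"]) auto
qed

text \<open>What the primality proof extracts from \<open>Hfun H a\<close>. \<open>upper\<close>
  says that F, viewed as a function of exp (iz), is not bounded by a power at one end of the
  cylinder. \<open>crit_orbit\<close> sharpens (iii) from one cosine to one orbit.\<close>

locale generic_periodic =
  fixes F :: "complex \<Rightarrow> complex"
  assumes hol: "F holomorphic_on UNIV"
    and per: "\<And>z. F (z + of_real (2 * pi)) = F z"
    and anti: "\<And>z. F (of_real pi - z) = - F z"
    and growth: "\<exists>K \<rho>. \<rho> \<ge> 1 \<and> (\<forall>z. norm (F z) \<le> K * exp (norm z powr \<rho>))"
    and upper: "\<And>C N Y. \<not> (\<forall>z. Y \<le> Im z \<longrightarrow> norm (F z) \<le> C * exp (real N * Im z))"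
    and crit_simple: "\<And>z. deriv F z = 0 \<Longrightarrow> deriv (deriv F) z \<noteq> 0"
    and crit_orbit: "\<And>z1 z2. \<lbrakk>deriv F z1 = 0; deriv F z2 = 0; F z1 = F z2\<rbrakk>
        \<Longrightarrow> \<exists>k::int. z2 = z1 + of_int k * of_real (2 * pi)"
    and crit_inf: "infinite (period_orbit ` {z. deriv F z = 0})"
begin

lemma lower: "\<not> (\<forall>z. Im z \<le> - Y \<longrightarrow> norm (F z) \<le> C * exp (real N * - Im z))"
proof
  assume a: "\<forall>z. Im z \<le> - Y \<longrightarrow> norm (F z) \<le> C * exp (real N * - Im z)"
  have "norm (F z) \<le> C * exp (real N * Im z)" if "Y \<le> Im z" for z
    using a[rule_format, of "of_real pi - z"] that anti[of z] by simp
  then show False using upper[of Y C N] by blast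
qed

lemma not_constant: "\<not> F constant_on UNIV"
proof
  assume "F constant_on UNIV"
  then obtain c where "\<And>z. F z = c" unfolding constant_on_def by blast
  then have "F = (\<lambda>_. c)" by blast
  then show False using crit_simple[of 0] by simp
qed

text \<open>Since exp (iz/m) has modulus exp (- Im z / m), a power bound near infinity in x is a
  bound as Im z tends to minus infinity, against \<open>lower\<close>.\<close>

lemma no_growth_lower_end:
  assumes F: "\<And>z. F z = \<phi> (exp (\<i> * z / of_nat m))" and m: "m > 0"
  shows "\<not> (\<forall>x. R \<le> norm x \<longrightarrow> norm (\<phi> x) \<le> C * norm x ^ N)"
proof
  assume a: "\<forall>x. R \<le> norm x \<longrightarrow> norm (\<phi> x) \<le> C * norm x ^ N"
  \<comment> \<open>\<open>max R 1\<close> makes \<open>Y\<close> nonnegative, hence - Im z \<ge> 0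
    below - Y, and dropping the division by m only enlarges the exponent.\<close>
  define Y where "Y = real m * ln (max R 1)"
  have "norm (F z) \<le> \<bar>C\<bar> * exp (real N * - Im z)" if z: "Im z \<le> - Y" for z
  proof -
    define x where "x = exp (\<i> * z / of_nat m)"
    have nx: "norm x = exp (- Im z / real m)" by (simp add: x_def Im_divide_of_nat)
    have Y0: "Y \<ge> 0" by (simp add: Y_def)
    have "ln (max R 1) \<le> - Im z / real m" using z m by (simp add: Y_def field_simps)
    then have "exp (ln (max R 1)) \<le> norm x" unfolding nx by (simp only: exp_le_cancel_iff)
    then have "R \<le> norm x" by simp
    moreover have "F z = \<phi> x" by (simp only: x_def F)
    ultimately have "norm (F z) \<le> C * norm x ^ N" using a by simp
    also have "\<dots> \<le> \<bar>C\<bar> * norm x ^ N" by (intro mult_right_mono) auto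
    also have "norm x ^ N = exp (real N * (- Im z / real m))" by (simp only: nx exp_of_nat_mult)
    also have "\<bar>C\<bar> * \<dots> \<le> \<bar>C\<bar> * exp (real N * - Im z)"
    proof -
      have "- Im z / real m \<le> - Im z / 1" using z Y0 m by (intro divide_left_mono) auto
      then have "real N * (- Im z / real m) \<le> real N * - Im z" by (intro mult_left_mono) auto
      then show ?thesis by (intro mult_left_mono) auto
    qed
    finally show ?thesis .
  qed
  then show False using lower[of Y "\<bar>C\<bar>" N] by blast
qed

text \<open>The reflection z to pi - z inverts exp (iz/m) up to a unimodular constant and so reduces
  this end to the lower one.\<close>

lemma no_growth_upper_end:
  assumes F: "\<And>z. F z = \<phi> (exp (\<i> * z / of_nat m))" and m: "m > 0"
  shows "\<not> (\<forall>x. R \<le> norm x \<longrightarrow> norm (\<phi> (1 / x)) \<le> C * norm x ^ N)"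
proof
  assume a: "\<forall>x. R \<le> norm x \<longrightarrow> norm (\<phi> (1 / x)) \<le> C * norm x ^ N"
  define \<psi> where "\<psi> = (\<lambda>x. - \<phi> (exp (\<i> * of_real pi / of_nat m) / x))"
  have "F z = \<psi> (exp (\<i> * z / of_nat m))" for z
  proof -
    have "F z = - F (of_real pi - z)" by (simp add: anti)
    also have "F (of_real pi - z) = \<phi> (exp (\<i> * of_real pi / of_nat m) / exp (\<i> * z / of_nat m))"
      unfolding F by (simp add: exp_diff[symmetric] diff_divide_distrib right_diff_distrib)
    finally show ?thesis by (simp add: \<psi>_def)
  qed
  moreover have "norm (\<psi> x) \<le> C * norm x ^ N" if "R \<le> norm x" for x
  proof -
    have n1: "norm (exp (\<i> * of_real pi / of_nat m)) = 1" by (simp add: Im_divide_of_nat)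
    have "norm (x / exp (\<i> * of_real pi / of_nat m)) = norm x" by (simp only: norm_divide n1 div_by_1)
    then have "norm (\<phi> (1 / (x / exp (\<i> * of_real pi / of_nat m)))) \<le> C * norm x ^ N"
      using a[rule_format, of "x / exp (\<i> * of_real pi / of_nat m)"] that by simp
    then show ?thesis by (simp add: \<psi>_def)
  qed
  ultimately show False using no_growth_lower_end[of \<psi> m R C N] m by blast
qed

text \<open>By the chain rule the disjunctions make F' vanish. In particular, the points that
  \<open>g\<close> sends to one zero of f' are critical for F on one level, so they lie in a single
  orbit.\<close>

lemma critical_fibre:
  assumes f: "f holomorphic_on UNIV" and g: "g holomorphic_on UNIV" and F: "\<And>z. F z = f (g z)"
    and z: "deriv f (g z1) = 0 \<or> deriv g z1 = 0" "deriv f (g z2) = 0 \<or> deriv g z2 = 0" "f (g z1) = f (g z2)"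
  shows "\<exists>k::int. z2 = z1 + of_int k * of_real (2 * pi)"
proof -
  have "deriv F z = deriv f (g z) * deriv g z" for z
  proof -
    have "(F has_field_derivative deriv f (g z) * deriv g z) (at z)"
      unfolding F[abs_def]
      by (rule DERIV_chain2) (auto intro: holomorphic_derivI[OF f] holomorphic_derivI[OF g])
    then show ?thesis by (rule DERIV_imp_deriv)
  qed
  then show ?thesis using z F by (intro crit_orbit) auto
qed

text \<open>A shift of z by 2 pi k multiplies exp (iz/m) by an m-th root of unity, so all preimages
  of \<open>w\<close> under \<open>\<gamma>\<close> have the same m-th power.\<close>

lemma fibre_exp:
  assumes g: "\<And>z. g z = \<gamma> (exp (\<i> * z / of_nat m))" and m: "m > 0"
    and one: "\<And>z1 z2. \<lbrakk>g z1 = w; g z2 = w\<rbrakk> \<Longrightarrow> \<exists>k::int. z2 = z1 + of_int k * of_real (2 * pi)"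
  shows "finite {x. x \<noteq> 0 \<and> \<gamma> x = w}"
    and "\<lbrakk>x \<noteq> 0; \<gamma> x = w; y \<noteq> 0; \<gamma> y = w\<rbrakk> \<Longrightarrow> norm x = norm y"
proof -
  have pw: "x ^ m = y ^ m" if "x \<noteq> 0" "\<gamma> x = w" "y \<noteq> 0" "\<gamma> y = w" for x y
  proof -
    define z where "z = (\<lambda>x. - \<i> * of_nat m * Ln x)"
    have zx: "exp (\<i> * z x / of_nat m) = x" if "x \<noteq> 0" for x
      using that m by (simp add: z_def)
    have "g (z x) = w" "g (z y) = w" using zx that by (simp_all add: g)
    from one[OF this] obtain k :: int where k: "z y = z x + of_int k * of_real (2 * pi)" by blast
    have e: "x ^ m = exp (\<i> * z x)" if "x \<noteq> 0" for x
    proof -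
      have "x ^ m = exp (of_nat m * (\<i> * z x / of_nat m))" using zx[OF that] by (simp only: exp_of_nat_mult)
      then show ?thesis using m by simp
    qed
    have "exp (\<i> * z y) = exp (\<i> * z x) * exp (of_int k * (of_real (2 * pi) * \<i>))"
      unfolding k by (simp add: exp_add[symmetric] algebra_simps)
    also have "exp (of_int k * (of_real (2 * pi) * \<i>)) = 1"
      using exp_integer_2pi[of "of_int k"] by (simp add: mult_ac)
    finally show ?thesis using e that by simp
  qed
  show "finite {x. x \<noteq> 0 \<and> \<gamma> x = w}"
  proof (cases "{x. x \<noteq> 0 \<and> \<gamma> x = w} = {}")
    case True
    then show ?thesis by (simp only: finite.emptyI)
  next
    case False
    then obtain y where y: "y \<noteq> 0" "\<gamma> y = w" by blast
    have "{x. x \<noteq> 0 \<and> \<gamma> x = w} \<subseteq> {x. x ^ m = y ^ m}" using pw y by blast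
    then show ?thesis using finite_nth_roots[OF m] by (rule finite_subset)
  qed
  show "norm x = norm y" if "x \<noteq> 0" "\<gamma> x = w" "y \<noteq> 0" "\<gamma> y = w"
  proof -
    have "norm x ^ m = norm y ^ m" using pw[OF that] by (simp flip: norm_power)
    then show ?thesis using m by (simp add: power_eq_iff_eq_base)
  qed
qed

end

section \<open>Polynomial left factors and polynomial right factors\<close>

lemma poly_single_critical_point:
  fixes p :: "complex poly"
  assumes "degree p \<ge> 2" and one: "\<And>w. poly (pderiv p) w = 0 \<longleftrightarrow> w = w0"
  obtains a n where "a \<noteq> 0" "n > 0" "\<And>u. poly p u = a * (u - w0) ^ n + poly p w0"
proof -
  define k where "k = order w0 (pderiv p)"
  define c where "c = lead_coeff (pderiv p)"
  have pd: "pderiv p = smult c ([:- w0, 1:] ^ k)"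
    using complex_poly_decompose[of "pderiv p"] one by (simp add: c_def k_def)
  have c0: "c \<noteq> 0" using assms(1) by (simp add: c_def pderiv_eq_0_iff)
  define a where "a = c / of_nat (Suc k)"
  define q where "q = smult a ([:- w0, 1:] ^ Suc k)"
  have "pderiv q = pderiv p"
    unfolding q_def pderiv_smult pderiv_power_Suc pd a_def
    by (simp add: pderiv_pCons del: of_nat_Suc)
  then have "pderiv (p - q) = 0" by (simp add: pderiv_diff)
  then obtain h where "p - q = [:h:]" using pderiv_iszero by blast
  then have pq: "p = q + [:h:]" by (simp add: algebra_simps)
  have pu: "poly p u = a * (u - w0) ^ Suc k + h" for u unfolding pq by (simp add: q_def algebra_simps)
  have "poly p w0 = h" using pu[of w0] by simp
  with pu have "poly p u = a * (u - w0) ^ Suc k + poly p w0" for u by simp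
  moreover have "a \<noteq> 0" using c0 by (simp add: a_def del: of_nat_Suc)
  ultimately show thesis using that[of a "Suc k"] by blast
qed

context generic_periodic
begin

text \<open>By Picard, two finite fibres leave \<open>\<gamma>\<close> bounded near infinity or with
  a pole there. Either way p o \<gamma> is bounded by a power, against
  \<open>no_growth_lower_end\<close>.\<close>

lemma growth_two_finite_fibres:
  assumes \<gamma>: "\<gamma> holomorphic_on - {0}" and ab: "a \<noteq> b"
    and fin: "finite {x. x \<noteq> 0 \<and> \<gamma> x = a}" "finite {x. x \<noteq> 0 \<and> \<gamma> x = b}"
    and m: "m > 0" and F: "\<And>z. F z = poly p (\<gamma> (exp (\<i> * z / of_nat m)))"
  shows False
proof -
  obtain C N R where CN: "\<And>x. R \<le> norm x \<Longrightarrow> norm (\<gamma> x) \<le> C * norm x ^ N"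
  proof -
    have "\<exists>C N R. \<forall>x. R \<le> norm x \<longrightarrow> norm (\<gamma> x) \<le> C * norm x ^ N" (is ?G)
      using picard_end[OF \<gamma> ab fin]
    proof
      assume "\<exists>B R. \<forall>x. R \<le> norm x \<longrightarrow> norm (\<gamma> x) \<le> B"
      then obtain B R where "\<forall>x. R \<le> norm x \<longrightarrow> norm (\<gamma> x) \<le> B * norm x ^ 0" by auto
      then show ?G by blast
    qed blast
    then show thesis using that by blast
  qed
  obtain A n where A: "\<And>u. norm (poly p u) \<le> A * (1 + norm u) ^ n" using poly_growth by blast
  have A0: "A \<ge> 0" using order_trans[OF norm_ge_zero A[of 0]] by simp
  have "norm (poly p (\<gamma> x)) \<le> (A * (1 + \<bar>C\<bar>) ^ n) * norm x ^ (N * n)" if x: "max R 1 \<le> norm x" for x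
  proof -
    have x1: "norm x \<ge> 1" "R \<le> norm x" using x by auto
    have "norm (\<gamma> x) \<le> C * norm x ^ N" by (rule CN[OF x1(2)])
    also have "\<dots> \<le> \<bar>C\<bar> * norm x ^ N" by (intro mult_right_mono) auto
    finally have "1 + norm (\<gamma> x) \<le> (1 + \<bar>C\<bar>) * norm x ^ N"
      using one_le_power[OF x1(1), of N] by (simp add: distrib_right)
    then have "(1 + norm (\<gamma> x)) ^ n \<le> ((1 + \<bar>C\<bar>) * norm x ^ N) ^ n" by (intro power_mono) auto
    then have "A * (1 + norm (\<gamma> x)) ^ n \<le> A * ((1 + \<bar>C\<bar>) * norm x ^ N) ^ n" using A0 by (rule mult_left_mono)
    then show ?thesis using A[of "\<gamma> x"] by (simp add: power_mult_distrib power_mult mult.assoc)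
  qed
  then show False
    using no_growth_lower_end[of "\<lambda>x. poly p (\<gamma> x)" m "max R 1" "A * (1 + \<bar>C\<bar>) ^ n" "N * n"] F m by blast
qed

text \<open>Every zero of p' has a finite fibre under \<open>\<gamma>\<close>, and two zeros
  suffice. With a single zero w0, p = a (u - w0)^n + b, so F = b holds only on one orbit; the
  reflection gives the same for - b.\<close>

lemma no_polynomial_left_factor:
  assumes g: "g holomorphic_on UNIV" and F: "\<And>z. F z = poly p (g z)" and d: "degree p \<ge> 2"
  shows False
proof -
  have hp: "poly p holomorphic_on UNIV" by (intro holomorphic_intros)
  have dp: "deriv (poly p) u = poly (pderiv p) u" for u by (intro DERIV_imp_deriv poly_DERIV)
  have fib: "\<exists>k::int. z2 = z1 + of_int k * of_real (2 * pi)"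
    if "poly (pderiv p) w = 0" "g z1 = w" "g z2 = w" for w z1 z2
    using critical_fibre[OF hp g F, of z1 z2] that by (simp add: dp)
  have "\<not> constant (poly (pderiv p))"
    using d by (subst constant_degree) (simp add: degree_pderiv)
  then obtain w0 where w0: "poly (pderiv p) w0 = 0"
    using fundamental_theorem_of_algebra by blast
  show False
  proof (cases "\<exists>w1. w1 \<noteq> w0 \<and> poly (pderiv p) w1 = 0")
    case True
    then obtain w1 where w1: "w1 \<noteq> w0" "poly (pderiv p) w1 = 0" by blast
    obtain m :: nat where m: "m > 0" and gm: "\<And>z. g (z + of_nat m * of_real (2 * pi)) = g z"
    proof (rule right_factor_periodic[OF hp g])
      show "poly p (g (z + of_real (2 * pi))) = poly p (g z)" for z using per F by metis
      show "\<not> (\<lambda>z. poly p (g z)) constant_on UNIV" using not_constant F by (simp add: constant_on_def)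
      show "\<exists>R>R0. \<forall>w. norm w = R \<longrightarrow> norm (poly p w) > B" for B R0
        by (rule poly_large_on_circles) (use d in simp)
    qed (rule that)
    obtain \<gamma> where \<gamma>: "\<gamma> holomorphic_on - {0}" and g\<gamma>: "\<And>z. g z = \<gamma> (exp (\<i> * z / of_nat m))"
      using periodic_factor_exp[OF g m gm] by blast
    have "finite {x. x \<noteq> 0 \<and> \<gamma> x = w}" if "poly (pderiv p) w = 0" for w
      by (rule fibre_exp(1)[of g \<gamma> m w, OF g\<gamma> m fib[OF that]])
    then show False
      using growth_two_finite_fibres[OF \<gamma> w1(1) _ _ m, of p] w1(2) w0 F g\<gamma> by simp
  next
    case False
    then obtain a n where a: "a \<noteq> 0" "n > 0" and pu: "\<And>u. poly p u = a * (u - w0) ^ n + poly p w0"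
      using poly_single_critical_point[OF d, of w0] w0 by metis
    define b where "b = poly p w0"
    have gw: "g z = w0" if "F z = b" for z
      using that a F[of z] pu[of "g z"] by (simp add: b_def)
    have one: "\<exists>k::int. z2 = z1 + of_int k * of_real (2 * pi)" if "F z1 = b" "F z2 = b" for z1 z2
      using fib[OF w0 gw[OF that(1)] gw[OF that(2)]] .
    have one': "\<exists>k::int. z2 = z1 + of_int k * of_real (2 * pi)" if "F z1 = - b" "F z2 = - b" for z1 z2
    proof -
      have "F (of_real pi - z1) = b" "F (of_real pi - z2) = b" using that by (simp_all add: anti)
      from one[OF this(2,1)] obtain k :: int where
        "of_real pi - z1 = of_real pi - z2 + of_int k * of_real (2 * pi)" by blast
      then have "z2 = z1 + of_int k * of_real (2 * pi)" by (simp add: algebra_simps)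
      then show ?thesis by blast
    qed
    show False
    \<comment> \<open>If b = 0, the two levels coincide. But then F vanishes at pi/2 and at - pi/2
      by the reflection, and these differ by pi, which is no multiple of 2 pi.\<close>
    proof (cases "b = 0")
      case True
      have "F (of_real (pi / 2)) = - F (of_real (pi / 2))"
        using anti[of "of_real (pi / 2)"] by (simp add: field_simps flip: of_real_diff)
      then have 1: "F (of_real (pi / 2)) = b" using True by simp
      have "F (of_real (- pi / 2) + of_real (2 * pi)) = - F (of_real (- pi / 2))"
        using anti[of "of_real (- pi / 2)"] by (simp add: field_simps flip: of_real_diff of_real_add)
      then have "F (of_real (- pi / 2)) = - F (of_real (- pi / 2))" by (simp only: per)
      then have 2: "F (of_real (- pi / 2)) = b" using True by simp
      obtain k :: int where "(of_real (- pi / 2) :: complex) = of_real (pi / 2) + of_int k * of_real (2 * pi)"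
        using one[OF 1 2] by blast
      then have "(of_real (- pi / 2) :: complex) = of_real (pi / 2 + real_of_int k * (2 * pi))" by simp
      then have "- pi / 2 = pi / 2 + real_of_int k * (2 * pi)" by (simp only: of_real_eq_iff)
      then have "pi * (1 + 2 * real_of_int k) = 0" by (simp add: algebra_simps)
      then have "real_of_int (1 + 2 * k) = 0" by simp
      then have "1 + 2 * k = 0" by (simp only: of_int_eq_0_iff)
      then show False by presburger
    next
      case b: False
      have F1: "F (z + of_nat 1 * of_real (2 * pi)) = F z" for z using per by simp
      obtain \<phi> where \<phi>: "\<phi> holomorphic_on - {0}" and F\<phi>: "\<And>z. F z = \<phi> (exp (\<i> * z / of_nat 1))"
        using periodic_factor_exp[OF hol zero_less_one F1] by blast
      have "b \<noteq> - b" using b by (simp add: equation_minus_iff)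
      \<comment> \<open>The two finite fibres belong to F itself as a function of exp (iz);
        \<open>[:0, 1:]\<close> is the identity.\<close>
      then show False
        using growth_two_finite_fibres[OF \<phi>, of b "- b" 1 "[:0, 1:]"]
          fibre_exp(1)[of F \<phi> 1 b, OF F\<phi> zero_less_one one] fibre_exp(1)[of F \<phi> 1 "- b", OF F\<phi> zero_less_one one'] F\<phi> by simp
    qed
  qed
qed

text \<open>At a critical point z with q' z \<noteq> 0, f' vanishes at q z, so all d + 1 solutions
  of q = q z are translates of z. Their sum does not depend on q z, which fixes (d + 1) z modulo 2
  pi.\<close>

lemma polynomial_right_factor:
  assumes f: "f holomorphic_on UNIV" and F: "\<And>z. F z = f (poly q z)"
  shows "degree q = 1"
proof (rule ccontr)
  assume d1: "degree q \<noteq> 1"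
  have hq: "poly q holomorphic_on UNIV" by (intro holomorphic_intros)
  have dq: "deriv (poly q) u = poly (pderiv q) u" for u by (intro DERIV_imp_deriv poly_DERIV)
  have "degree q \<noteq> 0"
  proof
    assume "degree q = 0"
    then obtain c where "q = [:c:]" by (meson degree_eq_zeroE)
    then have "\<And>z. F z = f c" by (simp add: F)
    then show False using not_constant by (simp add: constant_on_def)
  qed
  then obtain d where d: "degree q = Suc d" and d0: "d > 0" using d1 by (cases "degree q") auto
  define Z where "Z = {z. poly (pderiv q) z = 0}"
  have finZ: "finite Z" unfolding Z_def using d by (intro poly_roots_finite) (simp add: pderiv_eq_0_iff)
  \<comment> \<open>\<open>s\<close> is the sum of the roots of q - w for every w, because d > 0
    keeps the coefficient of index d free of w. \<open>T r\<close> solves (d + 1) z = s + 2 pi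
    r.\<close>
  define s where "s = - coeff q d / lead_coeff q"
  define T where "T = (\<lambda>r::nat. s / of_nat (Suc d) + of_real (2 * pi) * of_nat r / of_nat (Suc d))"
  have "period_orbit z \<in> period_orbit ` (Z \<union> T ` {..d})" if z: "deriv F z = 0" for z
  proof (cases "z \<in> Z")
    case False
    have "deriv F z = deriv f (poly q z) * deriv (poly q) z"
      unfolding F[abs_def]
      by (intro DERIV_imp_deriv DERIV_chain2 holomorphic_derivI[OF f] holomorphic_derivI[OF hq]) auto
    then have fz: "deriv f (poly q z) = 0" using False z by (simp add: Z_def dq)
    define w where "w = poly q z"
    define Q where "Q = q - [:w:]"
    have dQ: "degree Q = Suc d" 

    proof -
      have "Q = q + [:- w:]" by (simp add: Q_def)
      then show ?thesis using degree_add_eq_left[of "[:- w:]" q] d by (simp del: add_pCons)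
    qed
    have lQ: "lead_coeff Q = lead_coeff q" "coeff Q d = coeff q d"
      using d0 d dQ by (auto simp: Q_def coeff_pCons split: nat.split)
    obtain root where root: "smult (lead_coeff Q) (\<Prod>i<Suc d. [:- root i, 1:]) = Q"
      using complex_poly_decompose'[of Q] unfolding dQ by blast
    have "\<exists>k::int. root i = z + of_int k * of_real (2 * pi)" if "i < Suc d" for i
    proof -
      have "poly (\<Prod>i<Suc d. [:- root i, 1:]) (root i) = 0"
        unfolding poly_prod using that by (intro prod_zero) auto
      then have "poly Q (root i) = 0" by (subst root[symmetric]) simp
      then have "poly q (root i) = poly q z" by (simp add: Q_def w_def)
      then show ?thesis using critical_fibre[OF f hq F, of z "root i"] fz by simp
    qed
    then obtain k :: "nat \<Rightarrow> int" where k: "\<And>i. i < Suc d \<Longrightarrow> root i = z + of_int (k i) * of_real (2 * pi)"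
      by metis
    define K where "K = (\<Sum>i<Suc d. k i)"
    have "coeff (smult (lead_coeff Q) (\<Prod>i<Suc d. [:- root i, 1:])) d = coeff Q d" by (simp only: root)
    then have cq: "coeff q d = lead_coeff q * - (\<Sum>i<Suc d. root i)"
      unfolding coeff_smult lQ coeff_prod_linear_factors[THEN conjunct2] by (rule sym)
    have "q \<noteq> 0" using d by auto
    then have "lead_coeff q \<noteq> 0" by (rule leading_coeff_neq_0)
    then have "(\<Sum>i<Suc d. root i) = s"
      unfolding s_def cq by (simp del: sum.lessThan_Suc)
    moreover have "(\<Sum>i<Suc d. root i) = of_nat (Suc d) * z + of_int K * of_real (2 * pi)"
    proof -
      have "(\<Sum>i<Suc d. root i) = (\<Sum>i<Suc d. z + of_int (k i) * of_real (2 * pi))"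
        using k by (intro sum.cong) auto
      then show ?thesis by (simp only: sum.distrib sum_constant card_lessThan K_def of_int_sum sum_distrib_right)
    qed
    ultimately have zs: "of_nat (Suc d) * z = s + of_int (- K) * of_real (2 * pi)" by simp
    \<comment> \<open>Only - K modulo d + 1 matters; the quotient \<open>t\<close> shifts z by full
      periods.\<close>
    define r where "r = nat ((- K) mod int (Suc d))"
    define t where "t = (- K) div int (Suc d)"
    have "- K = int r + t * int (Suc d)" by (simp add: r_def t_def del: of_nat_Suc)
    then have "(of_int (- K) :: complex) = of_nat r + of_int t * of_nat (Suc d)"
      by (metis of_int_add of_int_mult of_int_of_nat_eq)
    then have "of_nat (Suc d) * z = s + of_nat r * of_real (2 * pi) + of_nat (Suc d) * (of_int t * of_real (2 * pi))"
      unfolding zs by (simp add: algebra_simps)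
    then have "z = (s + of_nat r * of_real (2 * pi) + of_nat (Suc d) * (of_int t * of_real (2 * pi))) / of_nat (Suc d)"
      by (metis nonzero_mult_div_cancel_left of_nat_neq_0)
    also have "\<dots> = T r + of_int t * of_real (2 * pi)"
      by (simp add: T_def add_divide_distrib mult_ac del: of_nat_Suc)
    finally have "period_orbit z = period_orbit (T r)" using period_orbit_shift by simp
    moreover have "r \<le> d"
    proof -
      have "(- K) mod int (Suc d) < int (Suc d)" by (intro pos_mod_bound) simp
      then show ?thesis unfolding r_def by linarith
    qed
    ultimately show ?thesis by blast
  qed blast
  then have "period_orbit ` {z. deriv F z = 0} \<subseteq> period_orbit ` (Z \<union> T ` {..d})" by blast
  then show False using crit_inf finZ finite_subset by blast
qed

end

section \<open>Transcendental left factors\<close>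

lemma poly_antiderivative:
  fixes p :: "complex poly"
  shows "\<exists>P. pderiv P = p"
proof
  define P where "P = (\<Sum>i\<le>degree p. monom (coeff p i / of_nat (Suc i)) (Suc i))"
  have sum: "pderiv (\<Sum>i\<in>A. q i) = (\<Sum>i\<in>A. pderiv (q i))" for A :: "nat set" and q :: "nat \<Rightarrow> complex poly"
    by (induction A rule: infinite_finite_induct) (simp_all add: pderiv_add)
  have "pderiv P = (\<Sum>i\<le>degree p. monom (coeff p i) i)"
    unfolding P_def sum by (intro sum.cong) (simp_all add: pderiv_monom del: of_nat_Suc)
  also have "\<dots> = p" by (rule poly_as_sum_of_monoms)
  finally show "pderiv P = p" .
qed

lemma degree_1_polyE:
  fixes p :: "complex poly"
  assumes "degree p = 1"
  obtains a b where "p = [:b, a:]" "a \<noteq> 0"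
proof -
  obtain b r where r: "p = pCons b r" by (cases p)
  with assms have "r \<noteq> 0" "degree r = 0" by (auto split: if_splits)
  then obtain a where "r = [:a:]" "a \<noteq> 0" by (metis degree_eq_zeroE pCons_0_0)
  then show thesis using r by (intro that) auto
qed

lemma polynomial_if_deriv_polynomial:
  assumes f: "f holomorphic_on UNIV" and d: "\<And>z. deriv f z = poly p z"
  shows "\<exists>P. \<forall>z. f z = poly P z"
proof -
  obtain P where P: "pderiv P = p" using poly_antiderivative by blast
  have "((\<lambda>z. f z - poly P z) has_field_derivative 0) (at z)" for z
  proof -
    have "((\<lambda>z. f z - poly P z) has_field_derivative deriv f z - poly (pderiv P) z) (at z)"
      by (intro DERIV_diff poly_DERIV holomorphic_derivI[OF f]) auto
    then show ?thesis by (simp add: d P)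
  qed
  then have "\<exists>c. \<forall>x\<in>UNIV. f x - poly P x = c"
    by (intro has_field_derivative_zero_constant) (auto intro: has_field_derivative_at_within)
  then obtain c where "\<And>x. f x - poly P x = c" by blast
  then have "f x = poly (P + [:c:]) x" for x by (metis add.commute diff_eq_eq poly_add poly_const_conv)
  then show ?thesis by blast
qed

context generic_periodic
begin

lemma transcendental_right_factor:
  assumes f: "f holomorphic_on UNIV" and nf: "\<not> (\<exists>p. \<forall>z. f z = poly p z)"
    and g: "g holomorphic_on UNIV" and ng: "\<not> (\<exists>p. \<forall>z. g z = poly p z)"
    and F: "\<And>z. F z = f (g z)"
  shows False
proof -
  obtain K \<rho> where \<rho>: "\<rho> \<ge> 1" and K: "\<And>z. norm (F z) \<le> K * exp (norm z powr \<rho>)" using growth by blast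
  have slow: "slow_growth f"
    using polya_slow_growth[OF f g ng _ \<rho>, of K] K by (simp add: F)
  have nc: "\<not> f constant_on UNIV"
  proof
    assume "f constant_on UNIV"
    then obtain c where "\<And>z. f z = poly [:c:] z" by (auto simp: constant_on_def)
    then show False using nf by blast
  qed
  obtain m :: nat where m: "m > 0" and gm: "\<And>z. g (z + of_nat m * of_real (2 * pi)) = g z"
  proof (rule right_factor_periodic[OF f g])
    show "f (g (z + of_real (2 * pi))) = f (g z)" for z using per F by metis
    show "\<not> (\<lambda>z. f (g z)) constant_on UNIV" using not_constant F by (simp add: constant_on_def)
    show "\<exists>R>R0. \<forall>w. norm w = R \<longrightarrow> norm (f w) > B" for B R0
      by (rule slow_growth_circle[OF f slow nc])
  qed (rule that)
  obtain \<gamma> where \<gamma>: "\<gamma> holomorphic_on - {0}" and g\<gamma>: "\<And>z. g z = \<gamma> (exp (\<i> * z / of_nat m))"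
    using periodic_factor_exp[OF g m gm] by blast
  have hf': "deriv f holomorphic_on UNIV" using f by (intro holomorphic_deriv) auto
  define Z where "Z = {w. deriv f w = 0}"
  have nf': "\<not> (\<exists>p. \<forall>z. deriv f z = poly p z)"
    using polynomial_if_deriv_polynomial[OF f] nf by blast
  then have infZ: "infinite Z"
    unfolding Z_def using slow_growth_finite_zeros_polynomial[OF _ hf' slow_growth_deriv[OF f slow]] by blast
  have fib: "\<exists>k::int. z2 = z1 + of_int k * of_real (2 * pi)" if "w \<in> Z" "g z1 = w" "g z2 = w" for w z1 z2
    using critical_fibre[OF f g F, of z1 z2] that by (simp add: Z_def)
  have fin: "finite {x. x \<noteq> 0 \<and> \<gamma> x = w}" if "w \<in> Z" for w
    by (rule fibre_exp(1)[of g \<gamma> m w, OF g\<gamma> m fib[OF that]])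
  obtain a where a: "a \<in> Z" using infinite_imp_nonempty[OF infZ] by blast
  obtain b where b: "b \<in> Z" "a \<noteq> b"
    using infinite_imp_nonempty[of "Z - {a}"] infZ by auto
  have F\<gamma>: "F z = (\<lambda>x. f (\<gamma> x)) (exp (\<i> * z / of_nat m))" for z by (simp add: F g\<gamma>)
  have bounded: "\<exists>C. \<forall>u. norm u \<le> B \<longrightarrow> norm (f u) \<le> C" for B
    using entire_bounded_on_cball[OF f, of B] by blast
  \<comment> \<open>Were \<open>\<gamma>\<close> bounded near infinity, F would be bounded at the
    lower end; so the pole alternative holds. It is used with modulus 1, which separates these
    preimages from those found at the other end.\<close>
  have "\<exists>R. \<forall>w. R < norm w \<longrightarrow> (\<exists>x. 1 < norm x \<and> \<gamma> x = w)"
  proof -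
    have False if h: "\<exists>B R. \<forall>x. R \<le> norm x \<longrightarrow> norm (\<gamma> x) \<le> B"
    proof -
      obtain B R where BR: "\<And>x. R \<le> norm x \<Longrightarrow> norm (\<gamma> x) \<le> B" using h by blast
      obtain C where "\<And>u. norm u \<le> B \<Longrightarrow> norm (f u) \<le> C" using bounded by blast
      then have "\<forall>x. R \<le> norm x \<longrightarrow> norm (f (\<gamma> x)) \<le> C * norm x ^ 0" using BR by simp
      then show False using no_growth_lower_end[OF F\<gamma> m] by blast
    qed
    then show ?thesis using picard_end[OF \<gamma> b(2) fin[OF a] fin[OF b(1)]] by blast
  qed
  then obtain R1 where R1: "\<And>w. R1 < norm w \<Longrightarrow> \<exists>x. 1 < norm x \<and> \<gamma> x = w" by blast
  have "\<exists>R. \<forall>w. R < norm w \<longrightarrow> (\<exists>x. 1 < norm x \<and> \<gamma> (1 / x) = w)"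
  proof -
    \<comment> \<open>The end x = 0 of \<open>\<gamma>\<close> is treated as the infinity of
      \<open>d\<close>, which inherits the finite fibres.\<close>
    define d where "d = (\<lambda>x. \<gamma> (1 / x))"
    have "\<gamma> \<circ> (\<lambda>x. 1 / x) holomorphic_on - {0}"
      by (intro holomorphic_on_compose_gen[OF _ \<gamma>] holomorphic_intros) auto
    then have d: "d holomorphic_on - {0}" by (simp add: d_def o_def)
    have find: "finite {x. x \<noteq> 0 \<and> d x = w}" if "w \<in> Z" for w
    proof -
      have "{x. x \<noteq> 0 \<and> d x = w} \<subseteq> (\<lambda>x. 1 / x) ` {x. x \<noteq> 0 \<and> \<gamma> x = w}"
      proof
        fix x assume x: "x \<in> {x. x \<noteq> 0 \<and> d x = w}"
        then have "1 / x \<in> {x. x \<noteq> 0 \<and> \<gamma> x = w}" by (simp add: d_def)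
        then have "1 / (1 / x) \<in> (\<lambda>x. 1 / x) ` {x. x \<noteq> 0 \<and> \<gamma> x = w}" by (rule imageI)
        then show "x \<in> (\<lambda>x. 1 / x) ` {x. x \<noteq> 0 \<and> \<gamma> x = w}" by simp
      qed
      then show ?thesis using fin[OF that] finite_surj by blast
    qed
    have False if h: "\<exists>B R. \<forall>x. R \<le> norm x \<longrightarrow> norm (d x) \<le> B"
    proof -
      obtain B R where BR: "\<And>x. R \<le> norm x \<Longrightarrow> norm (d x) \<le> B" using h by blast
      obtain C where "\<And>u. norm u \<le> B \<Longrightarrow> norm (f u) \<le> C" using bounded by blast
      then have "\<forall>x. R \<le> norm x \<longrightarrow> norm (f (\<gamma> (1 / x))) \<le> C * norm x ^ 0" using BR by (simp add: d_def)
      then show False using no_growth_upper_end[OF F\<gamma> m] by blast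
    qed
    then have "\<forall>\<rho>. \<exists>R. \<forall>w. R < norm w \<longrightarrow> (\<exists>x. \<rho> < norm x \<and> d x = w)"
      using picard_end[OF d b(2) find[OF a] find[OF b(1)]] by blast
    then show ?thesis unfolding d_def by blast
  qed
  then obtain R2 where R2: "\<And>w. R2 < norm w \<Longrightarrow> \<exists>x. 1 < norm x \<and> \<gamma> (1 / x) = w" by blast
  have "\<exists>w\<in>Z. max R1 R2 < norm w"
  proof (rule ccontr)
    assume "\<not> ?thesis"
    then have "Z \<subseteq> {w \<in> cball 0 (max R1 R2). deriv f w = 0}"
      by (auto simp: Z_def not_less)
    moreover have "\<not> deriv f constant_on UNIV"
    proof
      assume "deriv f constant_on UNIV"
      then obtain c where "\<And>z. deriv f z = poly [:c:] z" by (auto simp: constant_on_def)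
      then show False using nf' by blast
    qed
    then have "finite {w \<in> cball 0 (max R1 R2). deriv f w = 0}"
      by (intro holomorphic_compact_finite_zeros[OF hf']) auto
    ultimately show False using infZ finite_subset by blast
  qed
  then obtain w where w: "w \<in> Z" "R1 < norm w" "R2 < norm w" by auto
  obtain x where x: "1 < norm x" "\<gamma> x = w" using R1[OF w(2)] by blast
  obtain y where y: "1 < norm y" "\<gamma> (1 / y) = w" using R2[OF w(3)] by blast
  have "norm x = norm (1 / y)"
  proof (rule fibre_exp(2)[of g \<gamma> m w, OF g\<gamma> m fib[OF w(1)]])
    show "x \<noteq> 0" "1 / y \<noteq> 0" using x y by auto
  qed (use x y in auto)
  moreover have "norm (1 / y) < 1" using y(1) by (simp add: norm_divide divide_less_eq)
  ultimately show False using x by simp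
qed

lemma entire_factorization:
  assumes f: "f holomorphic_on UNIV" and nf: "\<not> (\<exists>p. \<forall>z. f z = poly p z)"
    and g: "g holomorphic_on UNIV" and F: "\<And>z. F z = f (g z)"
  obtains a b where "a \<noteq> 0" "\<And>z. g z = a * z + b"
proof (cases "\<exists>p. \<forall>z. g z = poly p z")
  case True
  then obtain q where q: "\<And>z. g z = poly q z" by blast
  have "degree q = 1" using F q by (intro polynomial_right_factor[OF f]) simp
  then obtain a b where "q = [:b, a:]" "a \<noteq> 0" by (rule degree_1_polyE)
  then show thesis using q by (intro that[of a b]) (simp_all add: mult.commute)
next
  case False
  then show thesis using transcendental_right_factor[OF f nf g _ F] by blast
qed

end

section \<open>Limits and poles of compositions; meromorphic left factors\<close>

lemma eventually_eq_imp_eq_at: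
  fixes u v :: "complex \<Rightarrow> complex"
  assumes "\<forall>\<^sub>F w in at z. u w = v w" "isCont u z" "isCont v z"
  shows "u z = v z"
proof -
  have "(v \<longlongrightarrow> u z) (at z)"
    using assms(2) assms(1) unfolding isCont_def by (rule Lim_transform_eventually)
  then show ?thesis using assms(3) unfolding isCont_def by (intro LIM_unique)
qed

lemma entire_isCont:
  assumes "g holomorphic_on UNIV"
  shows "isCont g z"
  using holomorphic_on_imp_continuous_on[OF assms] by (simp add: continuous_on_eq_continuous_at)

lemma entire_meromorphic: "g holomorphic_on UNIV \<Longrightarrow> g meromorphic_on UNIV"
  by (intro analytic_on_imp_meromorphic_on) (simp add: analytic_on_open)

text \<open>A limit can be passed through a composition only if the inner function avoids it nearby.
  A meromorphic \<open>g\<close> does so unless it is constantly \<open>l\<close> off isolated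
  points.\<close>

lemma meromorphic_filterlim_at:
  assumes g: "g meromorphic_on UNIV" and nc: "\<not> (\<forall>z. \<forall>\<^sub>F w in at z. g w = l)"
    and l: "(g \<longlongrightarrow> l) (at z)"
  shows "filterlim g (at l) (at z)"
proof -
  have "\<forall>\<^sub>F w in at z. g w \<noteq> l"
    using meromorphic_imp_constant_or_avoid[OF g open_UNIV connected_UNIV, of l] nc
    by (simp add: eventually_cosparse_open_eq)
  then show ?thesis using l by (simp add: filterlim_at)
qed

lemma entire_filterlim_at:
  assumes g: "g holomorphic_on UNIV" and nc: "\<not> g constant_on UNIV"
  shows "filterlim g (at (g z)) (at z)"
proof (rule meromorphic_filterlim_at[OF entire_meromorphic[OF g]])
  show "(g \<longlongrightarrow> g z) (at z)" using entire_isCont[OF g] by (simp add: isCont_def)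
  show "\<not> (\<forall>x. \<forall>\<^sub>F w in at x. g w = g z)"
  proof
    assume a: "\<forall>x. \<forall>\<^sub>F w in at x. g w = g z"
    have "g x = g z" for x
      using eventually_eq_imp_eq_at[of g "\<lambda>_. g z" x] a entire_isCont[OF g] by simp
    then show False using nc by (auto simp: constant_on_def)
  qed
qed

text \<open>A pole of \<open>f\<close> at the limit \<open>l\<close> of \<open>g\<close> would send
  F to infinity at z, where F is continuous. So the singularity of \<open>f\<close> at
  \<open>l\<close> is removable, and continuity determines its value.\<close>

lemma left_factor_value:
  fixes f g F :: "complex \<Rightarrow> complex"
  assumes f: "f meromorphic_on UNIV" and F: "isCont F z" and eq: "\<forall>\<^sub>F w in at z. F w = f (g w)"
    and g: "filterlim g (at l) (at z)"
  shows "\<not> is_pole f l" "F z = remove_sings f l" "\<forall>\<^sub>F w in at z. F w = remove_sings f (g w)"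
proof -
  have iso: "isolated_singularity_at f l" and ne: "not_essential f l"
    using f by (auto simp: meromorphic_on_altdef)
  have Fz: "((\<lambda>w. f (g w)) \<longlongrightarrow> F z) (at z)"
    using F eq unfolding isCont_def by (rule Lim_transform_eventually)
  show np: "\<not> is_pole f l"
  proof
    assume "is_pole f l"
    then have inf: "filterlim (\<lambda>w. f (g w)) at_infinity (at z)"
      unfolding is_pole_def by (rule filterlim_compose) (rule g)
    show False by (rule not_tendsto_and_filterlim_at_infinity[OF at_neq_bot Fz inf])
  qed
  then obtain c where c: "(f \<longlongrightarrow> c) (at l)" using ne by (auto simp: not_essential_def)
  then have "((\<lambda>w. f (g w)) \<longlongrightarrow> c) (at z)" by (rule filterlim_compose) (rule g)
  then have "F z = c" using Fz by (intro LIM_unique[of _ _ z])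
  then show "F z = remove_sings f l" using c by (simp add: remove_sings_eqI)
  have "\<forall>\<^sub>F u in at l. remove_sings f u = f u" by (rule eventually_remove_sings_eq_at[OF iso])
  then have "\<forall>\<^sub>F w in at z. remove_sings f (g w) = f (g w)"
    using g unfolding filterlim_iff by blast
  with eq show "\<forall>\<^sub>F w in at z. F w = remove_sings f (g w)" by eventually_elim simp
qed

lemma pole_growth:
  assumes f: "f holomorphic_on - {w0}" and pole: "is_pole f w0"
  obtains r C N where "r > 0" "\<And>w. \<lbrakk>w \<noteq> w0; norm (w - w0) < r\<rbrakk> \<Longrightarrow> norm (f w) \<le> C / norm (w - w0) ^ N"
proof -
  have "f holomorphic_on UNIV - {w0}" using f by (simp add: Compl_eq_Diff_UNIV)
  from zorder_exist_pole[OF this open_UNIV UNIV_I pole] obtain r where r: "r > 0"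
    and h: "zor_poly f w0 holomorphic_on cball w0 r"
    and fh: "\<And>w. w \<in> cball w0 r - {w0} \<Longrightarrow> f w = zor_poly f w0 w / (w - w0) ^ nat (- zorder f w0)"
    by auto
  have "compact (zor_poly f w0 ` cball w0 r)"
    by (intro compact_continuous_image holomorphic_on_imp_continuous_on[OF h]) auto
  then have "bounded (zor_poly f w0 ` cball w0 r)" by (rule compact_imp_bounded)
  then obtain C where C: "\<forall>x\<in>zor_poly f w0 ` cball w0 r. norm x \<le> C" unfolding bounded_iff ..
  have "norm (f w) \<le> C / norm (w - w0) ^ nat (- zorder f w0)" if w: "w \<noteq> w0" "norm (w - w0) < r" for w
  proof -
    have m: "w \<in> cball w0 r" using w by (simp add: dist_norm norm_minus_commute)
    then have "norm (zor_poly f w0 w) \<le> C" using C by blast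
    then show ?thesis using fh[of w] m w by (simp add: norm_divide norm_power divide_right_mono)
  qed
  then show thesis using r that by blast
qed

context generic_periodic
begin

lemma eventually_eq_not_const: "\<not> (\<forall>z. \<forall>\<^sub>F w in at z. F w = c)"
proof
  assume a: "\<forall>z. \<forall>\<^sub>F w in at z. F w = c"
  have "F x = c" for x
    using eventually_eq_imp_eq_at[of F "\<lambda>_. c" x] a entire_isCont[OF hol] by simp
  then show False using not_constant by (auto simp: constant_on_def)
qed

text \<open>Writing g = w0 + exp h makes k u = f (w0 + exp u) an entire left factor, so h is linear
  with slope a and F has period 2 pi i / a. At a critical point \<open>crit_orbit\<close> forces
  this period to be 2 pi n. Hence exp (a z) = exp (iz/n), and the pole at w0 bounds F by a power at
  one end.\<close>

lemma no_left_factor_with_pole: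
  assumes f: "f holomorphic_on - {w0}" and pole: "is_pole f w0"
    and g: "g holomorphic_on UNIV" and F: "\<And>z. F z = f (g z)" and gw: "\<And>z. g z \<noteq> w0"
  shows False
proof -
  obtain h where h: "h holomorphic_on UNIV" and gh: "\<And>z. g z - w0 = exp (h z)"
  proof -
    obtain h where "h holomorphic_on UNIV" "\<And>x. x \<in> UNIV \<Longrightarrow> exp (h x) = g x - w0"
    proof (rule holomorphic_logarithm_exists[of UNIV "\<lambda>z. g z - w0" 0])
      show "(\<lambda>z. g z - w0) holomorphic_on UNIV" using g by (intro holomorphic_intros)
    qed (use gw in auto)
    then show thesis using that[of h] by simp
  qed
  define k where "k = (\<lambda>u. f (w0 + exp u))"
  have "f \<circ> (\<lambda>u. w0 + exp u) holomorphic_on UNIV"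
    by (intro holomorphic_on_compose_gen[OF _ f] holomorphic_intros) auto
  then have k: "k holomorphic_on UNIV" by (simp add: k_def o_def)
  have Fk: "F z = k (h z)" for z unfolding k_def gh[symmetric] by (simp add: F)
  have nk: "\<not> (\<exists>p. \<forall>z. k z = poly p z)"
  proof
    assume "\<exists>p. \<forall>z. k z = poly p z"
    then obtain p where p: "\<And>z. k z = poly p z" by blast
    have kper: "k (of_nat n * (2 * of_real pi * \<i>)) = k 0" for n
      by (simp add: k_def exp_of_nat_mult)
    have "p - [:k 0:] = 0"
    proof (rule ccontr)
      assume "p - [:k 0:] \<noteq> 0"
      then have "finite {z. poly (p - [:k 0:]) z = 0}" by (rule poly_roots_finite)
      moreover have "range (\<lambda>n::nat. of_nat n * (2 * of_real pi * \<i>)) \<subseteq> {z. poly (p - [:k 0:]) z = 0}"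
        using kper by (auto simp: p)
      ultimately have "finite (range (\<lambda>n::nat. of_nat n * (2 * complex_of_real pi * \<i>)))"
        by (rule rev_finite_subset)
      moreover have "inj (\<lambda>n::nat. of_nat n * (2 * complex_of_real pi * \<i>))" by (auto simp: inj_def)
      ultimately show False using finite_imageD infinite_UNIV_nat by blast
    qed
    then have pk: "p = [:k 0:]" by simp
    have "k z = k 0" for z
    proof -
      have "k z = poly p z" by (rule p)
      also have "\<dots> = poly [:k 0:] z" using pk by (rule arg_cong)
      also have "\<dots> = k 0" by simp
      finally show ?thesis .
    qed
    then have "F z = k 0" for z by (simp add: Fk)
    then show False using not_constant by (auto simp: constant_on_def)
  qed
  obtain a b where a: "a \<noteq> 0" and hab: "\<And>z. h z = a * z + b"
    by (rule entire_factorization[OF k nk h Fk]) (rule that)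
  define t where "t = 2 * of_real pi * \<i> / a"
  have Ft: "F (z + t) = F z" for z
  proof -
    have "h (z + t) = h z + 2 * of_real pi * \<i>" using a by (simp add: hab t_def algebra_simps)
    then show ?thesis by (simp add: Fk k_def exp_add)
  qed
  obtain z0 where z0: "deriv F z0 = 0" using crit_inf by fastforce
  have "((\<lambda>z. F (z + t)) has_field_derivative deriv F (z0 + t)) (at z0)"
    by (subst DERIV_shift[symmetric]) (auto intro: holomorphic_derivI[OF hol])
  then have "deriv F (z0 + t) = deriv F z0" unfolding Ft by (rule DERIV_imp_deriv[symmetric])
  then obtain n :: int where n: "z0 + t = z0 + of_int n * of_real (2 * pi)"
    using crit_orbit[of z0 "z0 + t"] z0 Ft by auto
  then have "2 * of_real pi * \<i> / a = of_int n * (2 * of_real pi)" by (simp add: t_def)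
  then have an: "a * of_int n = \<i>" using a by (simp add: field_simps)
  then have n0: "n \<noteq> 0" by auto
  obtain r C N where r: "r > 0"
    and C: "\<And>w. \<lbrakk>w \<noteq> w0; norm (w - w0) < r\<rbrakk> \<Longrightarrow> norm (f w) \<le> C / norm (w - w0) ^ N"
    by (rule pole_growth[OF f pole]) (rule that)
  have bound: "norm (f (w0 + exp b / x)) \<le> C / norm (exp b) ^ N * norm x ^ N"
    if x: "norm (exp b) / r + 1 \<le> norm x" for x
  proof -
    have l: "norm (exp b) / r < norm x" using x by simp
    moreover have "0 < norm (exp b) / r" using r by simp
    ultimately have nx: "0 < norm x" by linarith
    have "norm (exp b) / norm x < r"
      using l r nx by (simp only: pos_divide_less_eq mult.commute)
    then have "norm (f (w0 + exp b / x)) \<le> C / norm (w0 + exp b / x - w0) ^ N"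
      using nx by (intro C) (auto simp: norm_divide)
    then show ?thesis using nx by (simp add: norm_divide power_divide)
  qed
  have Fh: "F z = f (w0 + exp b * exp (a * z))" for z
    by (simp add: Fk k_def hab exp_add mult.commute)
  define m where "m = nat \<bar>n\<bar>"
  have m: "m > 0" using n0 by (simp add: m_def)
  show False
  \<comment> \<open>The sign of n decides whether exp (a z) tends to 0, so that the argument of
    \<open>f\<close> approaches its pole, at the upper or at the lower end.\<close>
  proof (cases "n > 0")
    case True
    then have "(of_int n :: complex) = of_nat m" by (simp add: m_def)
    then have "a = \<i> / of_nat m" using an m by (simp add: field_simps)
    then have "F z = (\<lambda>x. f (w0 + exp b * x)) (exp (\<i> * z / of_nat m))" for z by (simp add: Fh)
    from no_growth_upper_end[OF this m, of "norm (exp b) / r + 1" "C / norm (exp b) ^ N" N]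
    have "\<not> (\<forall>x. norm (exp b) / r + 1 \<le> norm x \<longrightarrow>
        norm (f (w0 + exp b / x)) \<le> C / norm (exp b) ^ N * norm x ^ N)"
      by (simp only: times_divide_eq_right mult_1_right not_False_eq_True)
    then show False using bound by blast
  next
    case False
    then have "(of_int n :: complex) = - of_nat m" using n0 by (simp add: m_def)
    then have "a * of_nat m = - \<i>" using an by (metis add.inverse_inverse mult_minus_right)
    then have "a = - \<i> / of_nat m" using m by (subst nonzero_eq_divide_eq) simp_all
    then have "a * z = - (\<i> * z / of_nat m)" for z by simp
    then have "F z = (\<lambda>x. f (w0 + exp b / x)) (exp (\<i> * z / of_nat m))" for z
      by (simp only: Fh exp_minus divide_inverse)
    from no_growth_lower_end[OF this m] bound show False by blast
  qed
qed

text \<open>The nonconstant \<open>g\<close> omits every pole of \<open>f\<close>, so by little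
  Picard there is at most one. The cases of no pole and of one pole have been settled
  separately.\<close>

lemma meromorphic_left_factor:
  assumes f: "f meromorphic_on UNIV" and g: "g holomorphic_on UNIV" and eq: "mero_eq F (f \<circ> g)"
  shows "bilinear_fun f \<or> (\<exists>a b. a \<noteq> 0 \<and> (\<forall>z. g z = a * z + b))"
proof -
  define f1 where "f1 = remove_sings f"
  have nice: "f1 nicely_meromorphic_on UNIV" unfolding f1_def by (rule remove_sings_nicely_meromorphic[OF f])
  have iso: "isolated_singularity_at f w" for w using f by (auto simp: meromorphic_on_altdef)
  have pf1: "is_pole f1 w \<longleftrightarrow> is_pole f w" for w by (simp add: f1_def iso)
  have ev: "\<forall>\<^sub>F w in at z. F w = f (g w)" for z using eq by (simp add: mero_eq_def)
  have ng: "\<not> g constant_on UNIV"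
  proof
    assume "g constant_on UNIV"
    then obtain c where "\<And>z. g z = c" by (auto simp: constant_on_def)
    then show False using ev eventually_eq_not_const[of "f c"] by simp
  qed
  note val = left_factor_value[OF f entire_isCont[OF hol] ev entire_filterlim_at[OF g ng]]
  have F: "F z = f1 (g z)" for z using val(2) by (simp add: f1_def)
  have np: "\<not> is_pole f1 (g z)" for z using val(1) by (simp add: pf1)
  have an: "f1 analytic_on {w}" if "\<not> is_pole f1 w" for w
    using nice that by (intro nicely_meromorphic_on_imp_analytic_at) auto
  show ?thesis
  proof (cases "\<exists>w. is_pole f1 w")
    case False
    then have "f1 analytic_on UNIV" using an by (subst analytic_on_analytic_at) auto
    then have hf1: "f1 holomorphic_on UNIV" by (rule analytic_imp_holomorphic)
    show ?thesis
    proof (cases "\<exists>p. \<forall>z. f1 z = poly p z")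
      case True
      then obtain p where p: "\<And>z. f1 z = poly p z" by blast
      have "\<not> degree p \<ge> 2" using no_polynomial_left_factor[OF g, of p] F p by auto
      moreover have "degree p \<noteq> 0"
      proof
        assume "degree p = 0"
        then obtain c where "p = [:c:]" by (meson degree_eq_zeroE)
        then have "\<And>z. F z = c" by (simp add: F p)
        then show False using not_constant by (simp add: constant_on_def)
      qed
      ultimately have "degree p = 1" by simp
      then obtain a b where a: "p = [:b, a:]" "a \<noteq> 0" by (rule degree_1_polyE)
      have "mero_eq f (\<lambda>w. (a * w + b) / (0 * w + 1))"
        unfolding mero_eq_def
      proof
        fix z
        show "\<forall>\<^sub>F w in at z. f w = (a * w + b) / (0 * w + 1)"
          using eventually_remove_sings_eq_at[OF iso[of z]]
          by eventually_elim (use p a in \<open>simp add: f1_def algebra_simps\<close>)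
      qed
      then have "bilinear_fun f" unfolding bilinear_fun_def using a by (intro exI[of _ a] exI[of _ b] exI[of _ 0] exI[of _ 1]) auto
      then show ?thesis ..
    next
      case False
      show ?thesis by (rule entire_factorization[OF hf1 False g F]) blast
    qed
  next
    case True
    then obtain w0 where w0: "is_pole f1 w0" by blast
    have gw: "g z \<noteq> w0" for z using np w0 by blast
    have "\<not> is_pole f1 w" if w: "w \<noteq> w0" for w
    proof
      assume "is_pole f1 w"
      then have "\<And>z. g z \<noteq> w" using np by blast
      then have "range g \<inter> {w, w0} = {}" using gw by auto
      then obtain c where "g = (\<lambda>x. c)" using little_Picard[OF g w] by blast
      then show False using ng by (auto simp: constant_on_def)
    qed
    then have "f1 analytic_on - {w0}" using an by (subst analytic_on_analytic_at) auto
    then have "f1 holomorphic_on - {w0}" by (rule analytic_imp_holomorphic)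
    then show ?thesis using no_left_factor_with_pole[OF _ w0 g F gw] by blast
  qed
qed

end

section \<open>Rational left factors with meromorphic right factors\<close>

lemma eventually_not_in_finite:
  fixes z :: complex
  assumes "finite S"
  shows "\<forall>\<^sub>F w in at z. w \<notin> S"
proof -
  have "open (- (S - {z}))" using assms by (intro open_Compl finite_imp_closed) simp
  then show ?thesis unfolding eventually_at_topological by (intro exI[of _ "- (S - {z})"]) auto
qed

lemma poly_meromorphic:
  assumes "h meromorphic_on A"
  shows "(\<lambda>w. poly p (h w)) meromorphic_on A"
  unfolding poly_altdef by (intro meromorphic_intros assms)

text \<open>Near infinity \<open>q\<close> is bounded away from 0, so \<open>f\<close> is bounded by
  a power there and Liouville's theorem applies.\<close>

lemma entire_quotient_polynomial:
  fixes p q :: "complex poly"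
  assumes f: "f holomorphic_on UNIV" and q: "q \<noteq> 0" and eq: "\<And>w. f w * poly q w = poly p w"
  shows "\<exists>P. \<forall>w. f w = poly P w"
proof -
  have "\<exists>c>0. \<exists>R. \<forall>w. R \<le> norm w \<longrightarrow> c \<le> norm (poly q w)"
  proof (cases "degree q = 0")
    case True
    then obtain c where c: "q = [:c:]" by (meson degree_eq_zeroE)
    then have "norm c > 0" using q by auto
    then show ?thesis by (intro exI[of _ "norm c"]) (simp add: c)
  next
    case False
    obtain a r where r: "q = pCons a r" by (cases q)
    with False have "r \<noteq> 0" by auto
    from poly_infinity[OF this, of 1 a] show ?thesis unfolding r by (intro exI[of _ 1]) auto
  qed
  then obtain c R where c: "c > 0" and R: "\<And>w. R \<le> norm w \<Longrightarrow> c \<le> norm (poly q w)" by blast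
  obtain A n where A: "\<And>u. norm (poly p u) \<le> A * (1 + norm u) ^ n" using poly_growth by blast
  have A0: "A \<ge> 0" using order_trans[OF norm_ge_zero A[of 0]] by simp
  have bd: "norm (f w) \<le> (A * 2 ^ n / c) * norm w ^ n" if w: "max 1 R \<le> norm w" for w
  proof -
    have w1: "1 \<le> norm w" "R \<le> norm w" using w by auto
    have "c * norm (f w) \<le> norm (poly q w) * norm (f w)" using R[OF w1(2)] by (rule mult_right_mono) simp
    also have "\<dots> = norm (poly p w)" by (simp flip: eq add: norm_mult)
    also have "\<dots> \<le> A * (1 + norm w) ^ n" by (rule A)
    also have "\<dots> \<le> A * (2 * norm w) ^ n" using w1 A0 by (intro mult_left_mono power_mono) auto
    finally show ?thesis using c by (simp add: field_simps power_mult_distrib)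
  qed
  have "f w = poly (\<Sum>k\<le>n. monom ((deriv ^^ k) f 0 / fact k) k) w" for w
    using Liouville_polynomial[OF f, where A = "max 1 R" and B = "A * 2 ^ n / c" and n = n and \<xi> = w, OF bd] by (simp add: poly_sum poly_monom)
  then show ?thesis by blast
qed

text \<open>Undoes the substitution w = b + 1 / u: inserting u = 1 / (w - b) into a bilinear
  function only changes the sign of its determinant. \<open>S\<close> collects the points where the
  computation would divide by zero.\<close>

lemma bilinear_fun_pullback:
  fixes p q :: "complex poly"
  assumes q: "q \<noteq> 0" and f: "mero_eq f (\<lambda>w. poly p w / poly q w)"
    and bil: "bilinear_fun (\<lambda>u. poly p (b + inverse u) / poly q (b + inverse u))"
  shows "bilinear_fun f"
proof -
  let ?r = "\<lambda>w. poly p w / poly q w"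
  obtain A B C D where det: "A * D - B * C \<noteq> 0"
    and eq: "\<And>z. \<forall>\<^sub>F u in at z. ?r (b + inverse u) = (A * u + B) / (C * u + D)"
    using bil unfolding bilinear_fun_def mero_eq_def by blast
  define S where "S = {b} \<union> {w. poly q w = 0} \<union> {w. poly [:C - D * b, D:] w = 0}"
  have "[:C - D * b, D:] \<noteq> 0" using det by auto
  then have finS: "finite S"
    unfolding S_def using q by (intro finite_UnI poly_roots_finite) simp_all
  have r: "?r w = (B * w + (A - B * b)) / (D * w + (C - D * b))" if w: "w \<notin> S" for w
  proof -
    define u where "u = inverse (w - b)"
    have wb: "w - b \<noteq> 0" using w by (simp add: S_def)
    have u0: "u \<noteq> 0" and bu: "b + inverse u = w" using wb by (simp_all add: u_def)
    have qw: "poly q w \<noteq> 0" and dw: "D * w + (C - D * b) \<noteq> 0" using w by (auto simp: S_def algebra_simps)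
    have wu: "(w - b) * u = 1" using wb by (simp add: u_def)
    have cu: "(C * u + D) * (w - b) = D * w + (C - D * b)"
      using wu by (simp add: algebra_simps)
    then have cud: "C * u + D \<noteq> 0" using dw by auto
    have "?r (b + inverse u) = (A * u + B) / (C * u + D)"
    proof (rule eventually_eq_imp_eq_at[OF eq])
      have "isCont (\<lambda>u. b + inverse u) u" using u0 by (intro continuous_intros)
      then show "isCont (\<lambda>u. ?r (b + inverse u)) u"
        using qw bu u0 by (intro continuous_intros) auto
      show "isCont (\<lambda>u. (A * u + B) / (C * u + D)) u"
        using cud by (intro continuous_intros)
    qed
    also have "\<dots> = ((A * u + B) * (w - b)) / ((C * u + D) * (w - b))" using wb by simp
    also have "(A * u + B) * (w - b) = B * w + (A - B * b)"
      using wu by (simp add: algebra_simps)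
    finally show ?thesis unfolding cu bu .
  qed
  have "\<forall>\<^sub>F w in at z. f w = (B * w + (A - B * b)) / (D * w + (C - D * b))" for z
  proof -
    have "\<forall>\<^sub>F w in at z. f w = ?r w" using f by (simp add: mero_eq_def)
    then show ?thesis using eventually_not_in_finite[OF finS, of z] by eventually_elim (simp add: r)
  qed
  moreover have "B * (C - D * b) - (A - B * b) * D \<noteq> 0" using det by (simp add: algebra_simps)
  ultimately show ?thesis unfolding bilinear_fun_def mero_eq_def by blast
qed

context generic_periodic
begin

text \<open>If \<open>g\<close> has a pole, then so does \<open>f\<close>, at some \<open>b\<close> omitted by \<open>g\<close>; the substitution
  \<open>u = 1 / (w - b)\<close> turns \<open>g\<close> into an entire function.\<close>

lemma rational_left_factor:
  assumes q: "q \<noteq> 0" and fr: "mero_eq f (\<lambda>w. poly p w / poly q w)"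
    and g: "g meromorphic_on UNIV" and eq: "mero_eq F (f \<circ> g)"
  shows "bilinear_fun f \<or> linear_fun g"
proof -
  let ?r = "\<lambda>w. poly p w / poly q w"
  have evr: "\<forall>\<^sub>F w in at z. f w = ?r w" for z using fr by (simp add: mero_eq_def)
  have ev: "\<forall>\<^sub>F w in at z. F w = f (g w)" for z using eq by (simp add: mero_eq_def)
  have hpoly: "poly h holomorphic_on UNIV" for h :: "complex poly" by (intro holomorphic_intros)
  have "?r meromorphic_on UNIV" by (intro meromorphic_intros entire_meromorphic hpoly)
  then have f: "f meromorphic_on UNIV" using meromorphic_on_cong[of UNIV f ?r] evr by blast
  have isof: "isolated_singularity_at f w" for w using f by (auto simp: meromorphic_on_altdef)
  have isog: "isolated_singularity_at g w" and neg: "not_essential g w" for w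
    using g by (auto simp: meromorphic_on_altdef)
  have evg: "\<forall>\<^sub>F w in at z. remove_sings g w = g w" for z by (rule eventually_remove_sings_eq_at[OF isog])
  show ?thesis
  proof (cases "\<exists>z. is_pole g z")
    case False
    then have "remove_sings g analytic_on UNIV"
      using remove_sings_nicely_meromorphic[OF g] isog by (intro nicely_meromorphic_without_singularities) auto
    then have hg: "remove_sings g holomorphic_on UNIV" by (rule analytic_imp_holomorphic)
    have "mero_eq F (f \<circ> remove_sings g)"
      unfolding mero_eq_def
    proof
      fix z show "\<forall>\<^sub>F w in at z. F w = (f \<circ> remove_sings g) w"
        using ev[of z] evg[of z] by eventually_elim simp
    qed
    from meromorphic_left_factor[OF f hg this] show ?thesis
    proof
      assume "\<exists>a b. a \<noteq> 0 \<and> (\<forall>z. remove_sings g z = a * z + b)"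
      then obtain a b where a: "a \<noteq> 0" and ab: "\<And>z. remove_sings g z = a * z + b" by blast
      have "mero_eq g (\<lambda>w. a * w + b)"
        unfolding mero_eq_def
      proof
        fix z show "\<forall>\<^sub>F w in at z. g w = a * w + b"
          using evg[of z] by eventually_elim (simp add: ab)
      qed
      then show ?thesis unfolding linear_fun_def using a by blast
    qed blast
  next
    case True
    then obtain z0 where z0: "is_pole g z0" by blast
    \<comment> \<open>Having a pole, \<open>g\<close> is not constant off isolated points, so it
      avoids each of its finite limits nearby.\<close>
    have "\<not> (\<forall>\<^sub>F w in at z0. g w = l)" for l
    proof
      assume "\<forall>\<^sub>F w in at z0. g w = l"
      then have lim: "(g \<longlongrightarrow> l) (at z0)" by (rule tendsto_eventually)
      show False
        by (rule not_tendsto_and_filterlim_at_infinity[OF at_neq_bot lim z0[unfolded is_pole_def]])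
    qed
    then have flim: "filterlim g (at l) (at z)" if "(g \<longlongrightarrow> l) (at z)" for l z
      using meromorphic_filterlim_at[OF g _ that] by blast
    have val: "\<not> is_pole f l" "F z = remove_sings f l" if "(g \<longlongrightarrow> l) (at z)" for l z
      using left_factor_value(1,2)[OF f entire_isCont[OF hol] ev flim[OF that]] by auto
    have fr_val: "remove_sings f l = ?r l" if "poly q l \<noteq> 0" for l
    proof (rule remove_sings_eqI)
      have "isCont ?r l" using that by (intro continuous_intros)
      then show "(f \<longlongrightarrow> ?r l) (at l)"
        unfolding isCont_def by (rule Lim_transform_eventually) (use evr[of l] in \<open>auto elim: eventually_mono\<close>)
    qed
    have inf_q: "\<forall>\<^sub>F w in at z. poly h (g w) \<noteq> 0" if "is_pole g z" "h \<noteq> 0" for z and h :: "complex poly"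
    proof -
      have "bounded {w. poly h w = 0}" using that(2) by (intro finite_imp_bounded poly_roots_finite)
      then obtain B where B: "\<And>w. poly h w = 0 \<Longrightarrow> norm w \<le> B" unfolding bounded_iff by blast
      have "\<forall>\<^sub>F w in at z. B + 1 \<le> norm (g w)"
        using that(1) unfolding is_pole_def filterlim_at_infinity_conv_norm_at_top filterlim_at_top by blast
      then show ?thesis by eventually_elim (use B in force)
    qed
    \<comment> \<open>Values of \<open>g\<close> at isolated points are arbitrary; near z, apart
      from z itself, they are genuine limits.\<close>
    have evan: "\<forall>\<^sub>F w in at z. (g \<longlongrightarrow> g w) (at w)" for z
    proof -
      obtain r where r: "r > 0" "g analytic_on ball z r - {z}" using isog[of z] unfolding isolated_singularity_at_def by blast
      have "\<forall>\<^sub>F w in at z. w \<in> ball z r - {z}" using r(1) eventually_at_ball'[of r z UNIV] by auto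
      then show ?thesis
      proof eventually_elim
        fix w assume "w \<in> ball z r - {z}"
        then have "g analytic_on {w}" by (intro analytic_on_subset[OF r(2)]) simp
        then have "isCont g w" by (rule analytic_at_imp_isCont)
        then show "(g \<longlongrightarrow> g w) (at w)" by (simp add: isCont_def)
      qed
    qed
    \<comment> \<open>\<open>f\<close> equals p / q only off isolated points, so the exchange inside
      the composition needs care: near a pole of \<open>g\<close> the bounded zeros of
      \<open>q\<close> are avoided, and elsewhere \<open>g\<close> avoids its own limit.\<close>
    have evF: "\<forall>\<^sub>F w in at z. F w = ?r (g w)" for z
    proof (cases "is_pole g z")
      case True
      show ?thesis using evan[of z] inf_q[OF True q]
        by eventually_elim (use val(2) fr_val in metis)
    next
      case False
      then obtain l where l: "(g \<longlongrightarrow> l) (at z)" using neg[of z] by (auto simp: not_essential_def)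
      have "\<forall>\<^sub>F w in at z. f (g w) = ?r (g w)"
        using flim[OF l] evr[of l] unfolding filterlim_iff by blast
      then show ?thesis using ev[of z] by eventually_elim simp
    qed
    show ?thesis
    proof (cases "\<exists>b. is_pole f b")
      case False
      then have "remove_sings f analytic_on UNIV"
        using remove_sings_nicely_meromorphic[OF f] isof by (intro nicely_meromorphic_without_singularities) auto
      then have hf: "remove_sings f holomorphic_on UNIV" by (rule analytic_imp_holomorphic)
      have "remove_sings f w * poly q w = poly p w" for w
      proof (rule eventually_eq_imp_eq_at[where u = "\<lambda>w. remove_sings f w * poly q w" and v = "poly p"])
        show "isCont (\<lambda>w. remove_sings f w * poly q w) w" by (intro continuous_intros entire_isCont hf)
        show "isCont (poly p) w" by (rule entire_isCont[OF hpoly])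
        have "finite {w. poly q w = 0}" using q by (rule poly_roots_finite)
        from eventually_not_in_finite[OF this, of w]
        show "\<forall>\<^sub>F w in at w. remove_sings f w * poly q w = poly p w"
          by eventually_elim (simp add: fr_val)
      qed
      then obtain P where P: "\<And>w. remove_sings f w = poly P w"
        using entire_quotient_polynomial[OF hf q] by blast
      have FP: "\<forall>\<^sub>F w in at z0. F w = poly P (g w)"
        using evan[of z0] by eventually_elim (use val(2) P in metis)
      \<comment> \<open>At the pole z0 of \<open>g\<close> a nonconstant \<open>P\<close> would send
        P o g to infinity, whereas F has a finite limit.\<close>
      have "P = [:F z0:]"
      proof (rule ccontr)
        assume ne: "P \<noteq> [:F z0:]"
        have "degree P > 0"
        proof (rule ccontr)
          assume "\<not> degree P > 0"
          then obtain c where c: "P = [:c:]" by (meson degree_eq_zeroE gr0I)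
          then have "\<forall>\<^sub>F w in at z0. c = F w" using FP by (auto elim: eventually_mono)
          then have "c = F z0" using eventually_eq_imp_eq_at[of "\<lambda>_. c" F z0] entire_isCont[OF hol] by simp
          then show False using ne c by simp
        qed
        obtain a r where r: "P = pCons a r" by (cases P)
        with \<open>degree P > 0\<close> have "r \<noteq> 0" by auto
        have "filterlim (\<lambda>w. poly P (g w)) at_infinity (at z0)"
          unfolding filterlim_at_infinity_conv_norm_at_top filterlim_at_top
        proof
          fix d
          obtain B where B: "\<And>w. B \<le> norm w \<Longrightarrow> d \<le> norm (poly P w)"
            using poly_infinity[OF \<open>r \<noteq> 0\<close>, of d a] unfolding r by blast
          have "\<forall>\<^sub>F w in at z0. B \<le> norm (g w)"
            using z0 unfolding is_pole_def filterlim_at_infinity_conv_norm_at_top filterlim_at_top by blast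
          then show "\<forall>\<^sub>F w in at z0. d \<le> norm (poly P (g w))" by eventually_elim (rule B)
        qed
        moreover have "((\<lambda>w. poly P (g w)) \<longlongrightarrow> F z0) (at z0)"
          using entire_isCont[OF hol, of z0] FP unfolding isCont_def by (rule Lim_transform_eventually)
        ultimately show False using not_tendsto_and_filterlim_at_infinity[OF at_neq_bot] by blast
      qed
      have "\<forall>\<^sub>F w in at z. F w = F z0" for z
        using evan[of z]
      proof eventually_elim
        fix w assume "(g \<longlongrightarrow> g w) (at w)"
        then have "F w = poly P (g w)" using val(2) P by metis
        also have "\<dots> = poly [:F z0:] (g w)" using \<open>P = [:F z0:]\<close> by (rule arg_cong)
        finally show "F w = F z0" by simp
      qed
      then show ?thesis using eventually_eq_not_const by blast
    next
      case True
      then obtain b where b: "is_pole f b" by blast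
      define G0 where "G0 = (\<lambda>z. inverse (g z - b))"
      define G where "G = remove_sings G0"
      have mG0: "G0 meromorphic_on UNIV" unfolding G0_def by (intro meromorphic_intros g)
      have isoG: "isolated_singularity_at G0 w" for w using mG0 by (auto simp: meromorphic_on_altdef)
      have "\<exists>c. (G0 \<longlongrightarrow> c) (at z)" for z
      proof (cases "is_pole g z")
        case True
        then have "filterlim (\<lambda>w. g w + - b) at_infinity (at z)"
          unfolding is_pole_def by (intro tendsto_add_filterlim_at_infinity') auto
        then have "((\<lambda>w. inverse (g w + - b)) \<longlongrightarrow> 0) (at z)"
          by (rule filterlim_compose[OF tendsto_inverse_0])
        then show ?thesis unfolding G0_def by auto
      next
        case False
        then obtain l where l: "(g \<longlongrightarrow> l) (at z)" using neg[of z] by (auto simp: not_essential_def)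
        then have "l - b \<noteq> 0" using val(1)[OF l] b by auto
        then have "(G0 \<longlongrightarrow> inverse (l - b)) (at z)" unfolding G0_def by (intro tendsto_intros l)
        then show ?thesis by blast
      qed
      then have "G analytic_on {z}" for z unfolding G_def using remove_sings_analytic_at[OF isoG] by blast
      then have "G analytic_on UNIV" by (subst analytic_on_analytic_at) auto
      then have hG: "G holomorphic_on UNIV" by (rule analytic_imp_holomorphic)
      have evG: "\<forall>\<^sub>F w in at z. G w = G0 w" for z unfolding G_def by (rule eventually_remove_sings_eq_at[OF isoG])
      define fs where "fs = (\<lambda>u. ?r (b + inverse u))"
      have mfs: "fs meromorphic_on UNIV" unfolding fs_def by (intro meromorphic_intros poly_meromorphic)
      have "mero_eq F (fs \<circ> G)" unfolding mero_eq_def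
      proof
        fix z show "\<forall>\<^sub>F w in at z. F w = (fs \<circ> G) w"
          using evF[of z] evG[of z] by eventually_elim (simp add: fs_def G0_def)
      qed
      from meromorphic_left_factor[OF mfs hG this] show ?thesis
      proof
        assume "bilinear_fun fs"
        then have "bilinear_fun f" unfolding fs_def by (rule bilinear_fun_pullback[OF q fr])
        then show ?thesis ..
      next
        assume "\<exists>a c. a \<noteq> 0 \<and> (\<forall>z. G z = a * z + c)"
        then obtain a c where a: "a \<noteq> 0" and Gac: "\<And>z. G z = a * z + c" by blast
        have FG: "F w = remove_sings f (b + inverse (G w))" if "G w \<noteq> 0" for w
        proof (rule val(2))
          have "(G \<longlongrightarrow> G w) (at w)" using entire_isCont[OF hG] by (simp add: isCont_def)
          then have "((\<lambda>x. b + inverse (G x)) \<longlongrightarrow> b + inverse (G w)) (at w)"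
            using that by (intro tendsto_intros)
          then show "(g \<longlongrightarrow> b + inverse (G w)) (at w)"
            by (rule Lim_transform_eventually) (use evG[of w] in \<open>auto elim!: eventually_mono simp: G0_def\<close>)
        qed
        \<comment> \<open>Along the points 2 pi n a linear \<open>G\<close> tends to infinity, so
          the argument of \<open>f\<close> tends to its pole b, while F is constant on these
          points.\<close>
        define t where "t = (\<lambda>n::nat. 0 + of_nat n * of_real (2 * pi) :: complex)"
        have Ft: "F (t n) = F 0" for n unfolding t_def by (rule periodic_nat[of F "of_real (2 * pi)", OF per])
        have Gt: "filterlim (\<lambda>n. G (t n)) at_infinity sequentially"
        proof -
          have "filterlim (\<lambda>n. of_nat n :: complex) at_infinity sequentially"
            by (rule tendsto_of_nat)
          then have "filterlim (\<lambda>n. (a * of_real (2 * pi)) * (of_nat n :: complex)) at_infinity sequentially"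
            using a by (intro tendsto_mult_filterlim_at_infinity[of _ "a * of_real (2 * pi)"]) auto
          then have "filterlim (\<lambda>n. c + (a * of_real (2 * pi)) * (of_nat n :: complex)) at_infinity sequentially"
            by (intro tendsto_add_filterlim_at_infinity) auto
          then show ?thesis by (simp add: Gac t_def algebra_simps)
        qed
        have nz: "\<forall>\<^sub>F n in sequentially. G (t n) \<noteq> 0"
        proof -
          have "\<forall>\<^sub>F n in sequentially. 1 \<le> norm (G (t n))"
            using Gt unfolding filterlim_at_infinity_conv_norm_at_top filterlim_at_top by blast
          then show ?thesis by eventually_elim auto
        qed
        have "filterlim (\<lambda>n. b + inverse (G (t n))) (at b) sequentially"
          unfolding filterlim_at
        proof
          show "\<forall>\<^sub>F n in sequentially. b + inverse (G (t n)) \<in> UNIV \<and> b + inverse (G (t n)) \<noteq> b"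
            using nz by eventually_elim simp
          have "(\<lambda>n. b + inverse (G (t n))) \<longlonglongrightarrow> b + 0"
            by (intro tendsto_intros filterlim_compose[OF tendsto_inverse_0 Gt])
          then show "(\<lambda>n. b + inverse (G (t n))) \<longlonglongrightarrow> b" by simp
        qed
        moreover have "filterlim (remove_sings f) at_infinity (at b)"
          using b isof by (simp flip: is_pole_def)
        ultimately have inf: "filterlim (\<lambda>n. remove_sings f (b + inverse (G (t n)))) at_infinity sequentially"
          by (rule filterlim_compose[rotated])
        have "\<forall>\<^sub>F n in sequentially. remove_sings f (b + inverse (G (t n))) = F 0"
          using nz by eventually_elim (use FG Ft in metis)
        then have lim: "(\<lambda>n. remove_sings f (b + inverse (G (t n)))) \<longlonglongrightarrow> F 0" by (rule tendsto_eventually)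
        have False
          by (rule not_tendsto_and_filterlim_at_infinity[OF sequentially_bot lim inf])
        then show ?thesis ..
      qed
    qed
  qed
qed

lemma prime: "prime_fun F"
  unfolding prime_fun_def
proof (intro conjI allI impI; elim conjE)
  fix f g :: "complex \<Rightarrow> complex"
  assume "f meromorphic_on UNIV" "g holomorphic_on UNIV" "mero_eq F (f \<circ> g)"
  from meromorphic_left_factor[OF this] show "bilinear_fun f \<or> linear_fun g"
    unfolding linear_fun_def mero_eq_def by auto
next
  fix f g :: "complex \<Rightarrow> complex"
  assume "rational_fun f" "g meromorphic_on UNIV" "mero_eq F (f \<circ> g)"
  then show "bilinear_fun f \<or> linear_fun g"
    unfolding rational_fun_def using rational_left_factor by blast
qed

end

section \<open>The critical points of the given family\<close>

text \<open>Each point is isolated by a member of a countable basis, and different points need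
  different members.\<close>

lemma no_limit_points_countable:
  fixes A :: "'a::second_countable_topology set"
  assumes "\<And>x. x \<in> A \<Longrightarrow> \<not> x islimpt A"
  shows "countable A"
proof -
  obtain B :: "'a set set" where B: "countable B" "topological_basis B" using ex_countable_basis by blast
  have "\<exists>b\<in>B. b \<inter> A = {x}" if x: "x \<in> A" for x
  proof -
    obtain T where T: "open T" "x \<in> T" "\<And>y. \<lbrakk>y \<in> A; y \<in> T\<rbrakk> \<Longrightarrow> y = x"
      using assms[OF x] unfolding islimpt_def by blast
    obtain b where "b \<in> B" "x \<in> b" "b \<subseteq> T" using topological_basisE[OF B(2) T(1,2)] by blast
    then show ?thesis using T(3) x by blast
  qed
  then obtain b where b: "\<And>x. x \<in> A \<Longrightarrow> b x \<in> B \<and> b x \<inter> A = {x}" by metis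
  have "inj_on b A"
  proof (rule inj_onI)
    fix x y assume "x \<in> A" "y \<in> A" "b x = b y"
    then have "{x} = {y}" using b by metis
    then show "x = y" by simp
  qed
  moreover have "countable (b ` A)" using b B(1) by (intro countable_subset[OF _ B(1)]) auto
  ultimately show ?thesis by (rule countable_image_inj_on[rotated])
qed

section \<open>Growth of the family and of its derivative\<close>

lemma norm_sin_le_exp: "norm (sin z) \<le> exp \<bar>Im z\<bar>" for z :: complex
proof -
  have "norm (sin z) = norm (exp (\<i> * z) - exp (- (\<i> * z))) / 2"
    unfolding sin_exp_eq by (simp add: norm_divide norm_mult)
  also have "norm (exp (\<i> * z) - exp (- (\<i> * z))) \<le> norm (exp (\<i> * z)) + norm (exp (- (\<i> * z)))"
    by (rule norm_triangle_ineq4)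
  also have "\<dots> \<le> exp \<bar>Im z\<bar> + exp \<bar>Im z\<bar>" by (intro add_mono) auto
  finally show ?thesis by simp
qed

lemma norm_sin_ge_exp:
  assumes "2 \<le> exp (Im z)"
  shows "exp (Im z) \<le> 4 * norm (sin z)"
proof -
  have 1: "norm (exp (- (\<i> * z))) = exp (Im z)" "norm (exp (\<i> * z)) = exp (- Im z)" by simp_all
  have "exp (Im z) - exp (- Im z) \<le> norm (exp (\<i> * z) - exp (- (\<i> * z)))"
    using norm_triangle_ineq2[of "exp (- (\<i> * z))" "exp (\<i> * z)"] by (simp add: 1 norm_minus_commute)
  also have "\<dots> = 2 * norm (sin z)" unfolding sin_exp_eq by (simp add: norm_divide norm_mult)
  finally have "exp (Im z) - exp (- Im z) \<le> 2 * norm (sin z)" .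
  moreover have "exp (- Im z) \<le> 1 / 2" using assms by (simp add: exp_minus field_simps)
  ultimately show ?thesis using assms by linarith
qed

lemma norm_cos_ge_1:
  assumes "4 \<le> exp (Im z)"
  shows "1 \<le> norm (cos z)"
proof -
  have 1: "norm (exp (- (\<i> * z))) = exp (Im z)" "norm (exp (\<i> * z)) = exp (- Im z)" by simp_all
  have "exp (Im z) - exp (- Im z) \<le> norm (exp (\<i> * z) + exp (- (\<i> * z)))"
    using norm_triangle_ineq2[of "exp (- (\<i> * z))" "- exp (\<i> * z)"] by (simp add: 1 add.commute)
  also have "\<dots> = 2 * norm (cos z)" unfolding cos_exp_eq by (simp add: norm_divide norm_mult)
  finally have "exp (Im z) - exp (- Im z) \<le> 2 * norm (cos z)" .
  moreover have "exp (- Im z) \<le> 1 / 4" using assms by (simp add: exp_minus field_simps)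
  ultimately show ?thesis using assms by linarith
qed

lemma sin_surj_upper:
  obtains z where "sin z = s" "0 \<le> Im z"
proof (cases "0 \<le> Im (Arcsin s)")
  case True
  then show thesis by (intro that[of "Arcsin s"]) auto
next
  case False
  have "sin (of_real pi - Arcsin s) = s" by (simp add: sin_diff)
  with False show thesis by (intro that[of "of_real pi - Arcsin s"]) auto
qed

text \<open>At the upper end \<open>sin z\<close> is comparable to exp (Im z) and
  \<open>cos z\<close> stays away from 0. The bound would become a power bound for \<open>H\<close>
  in s = sin z, and Liouville would make \<open>H\<close> a polynomial.\<close>

lemma Hfun_no_end_growth:
  assumes H: "transcendental_entire H"
  shows "\<not> (\<forall>z. Y \<le> Im z \<longrightarrow> norm (Hfun H a z) \<le> C * exp (real N * Im z))"
proof
  assume le: "\<forall>z. Y \<le> Im z \<longrightarrow> norm (Hfun H a z) \<le> C * exp (real N * Im z)"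
  have hol: "H holomorphic_on UNIV" and np: "\<not> (\<exists>p. \<forall>z. H z = poly p z)"
    using H by (auto simp: transcendental_entire_def)
  define B where "B = \<bar>C\<bar> * 4 ^ N + 2 * norm a"
  have bd: "norm (H s) \<le> B * norm s ^ N" if s: "max (exp Y) 4 \<le> norm s" for s
  proof -
    have s4: "4 \<le> norm s" "exp Y \<le> norm s" using s by auto
    obtain z where z: "sin z = s" "0 \<le> Im z" by (rule sin_surj_upper)
    have se: "norm s \<le> exp (Im z)" using norm_sin_le_exp[of z] z by simp
    then have "exp Y \<le> exp (Im z)" using s4 by linarith
    then have Y: "Y \<le> Im z" by simp
    have c1: "1 \<le> norm (cos z)" by (rule norm_cos_ge_1) (use se s4 in linarith)
    have e4: "exp (Im z) \<le> 4 * norm s" using norm_sin_ge_exp[of z] se s4 z by simp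
    have "norm (H s + 2 * a) \<le> norm (cos z) * norm (H s + 2 * a)"
      using mult_right_mono[OF c1, of "norm (H s + 2 * a)"] by simp
    also have "\<dots> = norm (Hfun H a z)" by (simp add: Hfun_def z norm_mult)
    also have "\<dots> \<le> C * exp (real N * Im z)" using le Y by blast
    also have "\<dots> \<le> \<bar>C\<bar> * exp (real N * Im z)" by (intro mult_right_mono) auto
    also have "exp (real N * Im z) = exp (Im z) ^ N" by (rule exp_of_nat_mult)
    also have "\<bar>C\<bar> * exp (Im z) ^ N \<le> \<bar>C\<bar> * (4 * norm s) ^ N"
      using e4 by (intro mult_left_mono power_mono) auto
    finally have "norm (H s + 2 * a) \<le> \<bar>C\<bar> * 4 ^ N * norm s ^ N" by (simp add: power_mult_distrib)
    moreover have "norm (H s) \<le> norm (H s + 2 * a) + 2 * norm a"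
      using norm_triangle_ineq4[of "H s + 2 * a" "2 * a"] by (simp add: norm_mult)
    moreover have "2 * norm a * 1 \<le> 2 * norm a * norm s ^ N"
      using s4 by (intro mult_left_mono one_le_power) auto
    ultimately show ?thesis unfolding B_def distrib_right by linarith
  qed
  have "H s = poly (\<Sum>k\<le>N. monom ((deriv ^^ k) H 0 / fact k) k) s" for s
    using Liouville_polynomial[OF hol, where A = "max (exp Y) 4" and B = B and n = N and \<xi> = s, OF bd]
    by (simp add: poly_sum poly_monom)
  then show False using np by blast
qed

lemma entire_growth_at_infinity:
  assumes f: "f holomorphic_on UNIV" and le: "\<And>s. R \<le> norm s \<Longrightarrow> norm (f s) \<le> A * norm s ^ n"
  obtains A' where "A' \<ge> 0" "\<And>s. norm (f s) \<le> A' * (1 + norm s) ^ n"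
proof -
  obtain B where B: "\<And>w. norm w \<le> R \<Longrightarrow> norm (f w) \<le> B" using entire_bounded_on_cball[OF f] by blast
  have "norm (f s) \<le> (\<bar>A\<bar> + \<bar>B\<bar>) * (1 + norm s) ^ n" for s
  proof (cases "R \<le> norm s")
    case True
    have "norm (f s) \<le> A * norm s ^ n" by (rule le[OF True])
    also have "\<dots> \<le> (\<bar>A\<bar> + \<bar>B\<bar>) * (1 + norm s) ^ n" by (intro mult_mono power_mono) auto
    finally show ?thesis .
  next
    case False
    then have "norm (f s) \<le> (\<bar>A\<bar> + \<bar>B\<bar>) * 1" using B[of s] by simp
    also have "\<dots> \<le> (\<bar>A\<bar> + \<bar>B\<bar>) * (1 + norm s) ^ n" by (intro mult_left_mono one_le_power) auto
    finally show ?thesis .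
  qed
  then show thesis by (intro that[of "\<bar>A\<bar> + \<bar>B\<bar>"]) auto
qed

text \<open>\<open>Kfun H \<circ> sin\<close> is the derivative of \<open>Hfun H 0\<close>.\<close>

definition Kfun :: "(complex \<Rightarrow> complex) \<Rightarrow> complex \<Rightarrow> complex" where
  "Kfun H s = (1 - s ^ 2) * deriv H s - s * H s"

lemma Kfun_holomorphic:
  assumes "H holomorphic_on UNIV"
  shows "Kfun H holomorphic_on UNIV"
proof -
  have "deriv H holomorphic_on UNIV" using assms by (rule holomorphic_deriv) simp
  then show ?thesis unfolding Kfun_def[abs_def] by (intro holomorphic_intros assms) auto
qed

text \<open>Replacing cos^2 by 1 - sin^2 leaves \<open>sin z\<close> as the only variable, so
  critical points can be counted through s = sin z.\<close>

lemma DERIV_Hfun: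
  assumes H: "H holomorphic_on UNIV"
  shows "(Hfun H a has_field_derivative Kfun H (sin z) - 2 * a * sin z) (at z)"
proof -
  have "((\<lambda>z. H (sin z)) has_field_derivative deriv H (sin z) * cos z) (at z)"
    by (rule DERIV_chain2[OF holomorphic_derivI[OF H] DERIV_sin]) auto
  then have "((\<lambda>z. cos z * (H (sin z) + 2 * a)) has_field_derivative
      - sin z * (H (sin z) + 2 * a) + deriv H (sin z) * cos z * cos z) (at z)"
    by (auto intro!: derivative_eq_intros)
  moreover have "- sin z * (H (sin z) + 2 * a) + deriv H (sin z) * cos z * cos z = Kfun H (sin z) - 2 * a * sin z"
    unfolding Kfun_def cos_squared_eq[symmetric] by (simp add: algebra_simps power2_eq_square)
  ultimately show ?thesis unfolding Hfun_def[abs_def] by simp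
qed

lemma sin_cos_shift_2pi:
  fixes z :: complex
  shows "sin (z + of_real (2 * pi)) = sin z" "cos (z + of_real (2 * pi)) = cos z"
  by (simp_all only: sin_add cos_add sin_of_real cos_of_real sin_two_pi cos_two_pi
      of_real_0 of_real_1 mult_zero_right mult_1_right add_0_right diff_0_right)

lemma Hfun_periodic: "Hfun H a (z + of_real (2 * pi)) = Hfun H a z"
  unfolding Hfun_def sin_cos_shift_2pi ..

text \<open>Composed with \<open>sin\<close>, a power bound becomes a bound for the derivative of
  \<open>Hfun H 0\<close> by a power of exp (Im z). Integration from 0, with z shifted into a period
  strip, contradicts \<open>Hfun_no_end_growth\<close>.\<close>

lemma Kfun_no_polynomial_growth:
  assumes H: "transcendental_entire H"
  shows "\<not> (\<forall>s. R \<le> norm s \<longrightarrow> norm (Kfun H s) \<le> A * norm s ^ n)"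
proof
  assume le: "\<forall>s. R \<le> norm s \<longrightarrow> norm (Kfun H s) \<le> A * norm s ^ n"
  have hol: "H holomorphic_on UNIV" using H by (simp add: transcendental_entire_def)
  obtain B where B0: "B \<ge> 0" and B: "\<And>s. norm (Kfun H s) \<le> B * (1 + norm s) ^ n"
    using entire_growth_at_infinity[OF Kfun_holomorphic[OF hol]] le by blast
  define F where "F = Hfun H 0"
  define C where "C = norm (F 0) + B * 2 ^ n * 8"
  have "norm (F z) \<le> C * exp (real (Suc n) * Im z)" if z: "0 \<le> Im z" for z
  proof -
    obtain k :: int where k: "\<bar>Re (z + of_int k * of_real (2 * pi))\<bar> \<le> 2 * pi" by (rule shift_into_strip)
    define z' where "z' = z + of_int k * of_real (2 * pi)"
    have Imz: "Im z' = Im z" by (simp add: z'_def)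
    define y where "y = Im z"
    have ey: "1 + y \<le> exp y" by (rule exp_ge_add_one_self)
    have e1: "1 \<le> exp y" using z by (simp add: y_def)
    have "norm z' \<le> \<bar>Re z'\<bar> + \<bar>Im z'\<bar>" by (rule cmod_le)
    also have "\<dots> \<le> 2 * pi + y" using k z by (simp add: z'_def y_def)
    \<comment> \<open>2 pi < 8 and y \<le> exp y - 1 give 7 + exp y, and exp y \<ge> 1.\<close>
    also have "\<dots> \<le> 8 * exp y" using pi_less_4 ey e1 by linarith
    finally have nz: "norm z' \<le> 8 * exp y" .
    have "norm (F z' - F 0) \<le> (B * (2 * exp y) ^ n) * norm (z' - 0)"
    proof (rule field_differentiable_bound[where S = "{w. \<bar>Im w\<bar> \<le> y}"])
      have "{w. \<bar>Im w\<bar> \<le> y} = {w. Im w \<le> y} \<inter> {w. - y \<le> Im w}" by auto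
      then show "convex {w. \<bar>Im w\<bar> \<le> y}"
        using convex_Int[OF convex_halfspace_Im_le convex_halfspace_Im_ge] by simp
      fix w assume w: "w \<in> {w. \<bar>Im w\<bar> \<le> y}"
      show "(F has_field_derivative Kfun H (sin w)) (at w within {w. \<bar>Im w\<bar> \<le> y})"
        unfolding F_def using DERIV_Hfun[OF hol, of 0 w] by (simp add: has_field_derivative_at_within)
      have "norm (sin w) \<le> exp y" using norm_sin_le_exp[of w] w by (elim order_trans) simp
      then have "1 + norm (sin w) \<le> 2 * exp y" using e1 by linarith
      then have "B * (1 + norm (sin w)) ^ n \<le> B * (2 * exp y) ^ n"
        using B0 by (intro mult_left_mono power_mono) auto
      then show "norm (Kfun H (sin w)) \<le> B * (2 * exp y) ^ n" by (rule order_trans[OF B])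
    qed (use z Imz in \<open>auto simp: y_def\<close>)
    also have "\<dots> \<le> (B * (2 * exp y) ^ n) * (8 * exp y)"
      using nz B0 by (intro mult_left_mono) auto
    also have "\<dots> = (B * 2 ^ n * 8) * exp y ^ Suc n" by (simp add: power_mult_distrib)
    finally have "norm (F z') \<le> norm (F 0) + (B * 2 ^ n * 8) * exp y ^ Suc n"
      using norm_triangle_ineq2[of "F z'" "F 0"] by simp
    moreover have "norm (F 0) * 1 \<le> norm (F 0) * exp y ^ Suc n"
      using e1 by (intro mult_left_mono one_le_power) auto
    ultimately have "norm (F z') \<le> C * exp y ^ Suc n" unfolding C_def distrib_right by linarith
    moreover have "F z' = F z"
      unfolding z'_def by (rule periodic_int[of F "of_real (2 * pi)"]) (simp only: F_def Hfun_periodic)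
    ultimately show ?thesis by (simp only: exp_of_nat_mult y_def)
  qed
  then show False using Hfun_no_end_growth[OF H, of 0 0 C "Suc n"] unfolding F_def by blast
qed

lemma Hfun_growth:
  assumes fin: "finite_order (\<lambda>z. H (sin z))" and hol: "Hfun H a holomorphic_on UNIV"
  shows "\<exists>K \<rho>. \<rho> \<ge> 1 \<and> (\<forall>z. norm (Hfun H a z) \<le> K * exp (norm z powr \<rho>))"
proof -
  obtain \<rho>0 R where R: "\<And>z. R \<le> norm z \<Longrightarrow> norm (H (sin z)) \<le> exp (norm z powr \<rho>0)"
    using fin unfolding finite_order_def by blast
  define \<rho> where "\<rho> = max \<rho>0 1"
  obtain B where B: "\<And>w. norm w \<le> max R 2 \<Longrightarrow> norm (Hfun H a w) \<le> B" using entire_bounded_on_cball[OF hol] by blast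
  define K where "K = 1 + 2 * norm a + \<bar>B\<bar>"
  have "norm (Hfun H a z) \<le> K * exp (norm z powr (\<rho> + 1))" for z
  proof (cases "max R 2 \<le> norm z")
    case True
    then have z2: "2 \<le> norm z" "R \<le> norm z" by auto
    define e where "e = norm z powr \<rho>"
    have e1: "norm z powr 1 \<le> e" "norm z powr \<rho>0 \<le> e"
      unfolding e_def \<rho>_def using z2 by (intro powr_mono; simp)+
    then have ze: "norm z \<le> e" using z2 by simp
    \<comment> \<open>The bounds for \<open>cos z\<close> and \<open>H (sin z)\<close> multiply to
      exp (2 e); for norm z \<ge> 2 one more power of norm z absorbs the 2.\<close>
    have "2 * e \<le> norm z * e" using z2 by (intro mult_right_mono) (auto simp: e_def)
    also have "\<dots> = norm z powr (\<rho> + 1)" using z2 by (simp add: e_def powr_add mult.commute)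
    finally have e2: "2 * e \<le> norm z powr (\<rho> + 1)" .
    have "norm (H (sin z)) \<le> exp e" using R[OF z2(2)] e1(2) by (meson exp_le_cancel_iff order_trans)
    moreover have "2 * norm a * 1 \<le> 2 * norm a * exp e" using ze z2 by (intro mult_left_mono) auto
    moreover have "norm (H (sin z) + 2 * a) \<le> norm (H (sin z)) + 2 * norm a"
      using norm_triangle_ineq[of "H (sin z)" "2 * a"] by (simp add: norm_mult)
    ultimately have h: "norm (H (sin z) + 2 * a) \<le> (1 + 2 * norm a) * exp e"
      unfolding distrib_right by linarith
    have "norm (cos z) \<le> exp e" using norm_cos_le[of z] ze by (meson exp_le_cancel_iff order_trans)
    then have "norm (Hfun H a z) \<le> exp e * ((1 + 2 * norm a) * exp e)"
      unfolding Hfun_def norm_mult using h by (intro mult_mono) auto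
    also have "\<dots> = (1 + 2 * norm a) * exp (2 * e)" by (simp add: exp_double power2_eq_square)
    also have "\<dots> \<le> K * exp (norm z powr (\<rho> + 1))" using e2 by (intro mult_mono) (auto simp: K_def)
    finally show ?thesis .
  next
    case False
    then have "norm (Hfun H a z) \<le> B" by (intro B less_imp_le) (simp only: not_le)
    then have "norm (Hfun H a z) \<le> K * 1"
      unfolding K_def mult_1_right using abs_ge_self[of B] norm_ge_zero[of a] by linarith
    also have "\<dots> \<le> K * exp (norm z powr (\<rho> + 1))" by (intro mult_left_mono) (auto simp: K_def)
    finally show ?thesis .
  qed
  moreover have "\<rho> + 1 \<ge> 1" by (simp add: \<rho>_def)
  ultimately show ?thesis by blast
qed

section \<open>Exceptional parameters\<close>

lemma tendsto_difference_quotient_ratio: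
  fixes N V :: "complex \<Rightarrow> complex"
  assumes N: "(N has_field_derivative n) (at z)" and V: "(V has_field_derivative v) (at z)" and n: "n \<noteq> 0"
  shows "((\<lambda>u. (V u - V z) / (N u - N z)) \<longlongrightarrow> v / n) (at z)" "\<forall>\<^sub>F u in at z. N u \<noteq> N z"
proof -
  have q: "((\<lambda>u. (N u - N z) / (u - z)) \<longlongrightarrow> n) (at z)" "((\<lambda>u. (V u - V z) / (u - z)) \<longlongrightarrow> v) (at z)"
    using N V by (simp_all add: has_field_derivative_iff)
  have "((\<lambda>u. ((V u - V z) / (u - z)) / ((N u - N z) / (u - z))) \<longlongrightarrow> v / n) (at z)"
    using q n by (intro tendsto_divide)
  then show "((\<lambda>u. (V u - V z) / (N u - N z)) \<longlongrightarrow> v / n) (at z)"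
    by (rule Lim_transform_eventually) (auto simp: eventually_at_filter)
  have "\<forall>\<^sub>F u in at z. (N u - N z) / (u - z) \<noteq> 0"
    by (rule tendsto_imp_eventually_ne[OF q(1) n])
  then show "\<forall>\<^sub>F u in at z. N u \<noteq> N z" by eventually_elim auto
qed

text \<open>A family of critical points \<open>z\<close> with parameter value \<open>N z\<close> and critical value \<open>V z\<close> satisfies
  \<open>dV / dN = 2 cos z\<close>. So two branches with different cosines can share parameter and critical value
  only at isolated points.\<close>

lemma bad_pairs_countable:
  fixes N V c :: "complex \<Rightarrow> complex"
  assumes X: "\<And>z. z \<in> X \<Longrightarrow> \<exists>n. n \<noteq> 0 \<and> (N has_field_derivative n) (at z) \<and> (V has_field_derivative c z * n) (at z)"
  shows "countable {(z1, z2). z1 \<in> X \<and> z2 \<in> X \<and> N z1 = N z2 \<and> V z1 = V z2 \<and> c z1 \<noteq> c z2}"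
    (is "countable ?P")
proof (rule no_limit_points_countable)
  fix x assume x: "x \<in> ?P"
  obtain z1 z2 where z: "x = (z1, z2)" by (cases x)
  have zX: "z1 \<in> X" "z2 \<in> X" and eqs: "N z1 = N z2" "V z1 = V z2" "c z1 \<noteq> c z2" using x z by auto
  obtain n1 where n1: "n1 \<noteq> 0" "(N has_field_derivative n1) (at z1)" "(V has_field_derivative c z1 * n1) (at z1)"
    using X[OF zX(1)] by blast
  obtain n2 where n2: "n2 \<noteq> 0" "(N has_field_derivative n2) (at z2)" "(V has_field_derivative c z2 * n2) (at z2)"
    using X[OF zX(2)] by blast
  note L1 = tendsto_difference_quotient_ratio[OF n1(2,3,1)] and L2 = tendsto_difference_quotient_ratio[OF n2(2,3,1)]
  show "\<not> x islimpt ?P"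
  proof
    assume "x islimpt ?P"
    then obtain f where f: "\<And>n::nat. f n \<in> ?P - {x}" and lim: "f \<longlonglongrightarrow> x" unfolding islimpt_sequential by blast
    define u where "u = fst \<circ> f"
    define v where "v = snd \<circ> f"
    have uv: "f n = (u n, v n)" for n by (simp add: u_def v_def)
    have P: "N (u n) = N (v n)" "V (u n) = V (v n)" for n using f[of n] by (auto simp: uv)
    have ul: "u \<longlonglongrightarrow> z1" and vl: "v \<longlonglongrightarrow> z2"
      using tendsto_fst[OF lim] tendsto_snd[OF lim] by (simp_all add: u_def v_def o_def z)
    have e1: "\<forall>\<^sub>F u in nhds z1. u \<noteq> z1 \<longrightarrow> N u \<noteq> N z1" and e2: "\<forall>\<^sub>F u in nhds z2. u \<noteq> z2 \<longrightarrow> N u \<noteq> N z2"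
      using L1(2) L2(2) by (simp_all add: eventually_at_filter)
    have u1: "\<forall>\<^sub>F n in sequentially. u n \<noteq> z1 \<longrightarrow> N (u n) \<noteq> N z1"
      by (rule eventually_compose_filterlim[OF e1 ul])
    have v1: "\<forall>\<^sub>F n in sequentially. v n \<noteq> z2 \<longrightarrow> N (v n) \<noteq> N z2"
      by (rule eventually_compose_filterlim[OF e2 vl])
    \<comment> \<open>Since f n differs from x, one coordinate differs from its limit.
      \<open>N\<close> agrees across each pair and is locally different from its value at the limit,
      so the other coordinate differs too and both quotients below make sense.\<close>
    have "\<forall>\<^sub>F n in sequentially. u n \<noteq> z1 \<and> v n \<noteq> z2"
      using u1 v1
    proof eventually_elim
      case (elim n)
      have "\<not> (u n = z1 \<and> v n = z2)" using f[of n] by (auto simp: uv z)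
      then show ?case using elim P(1)[of n] eqs(1) by metis
    qed
    then have "\<forall>\<^sub>F n in sequentially. u n \<in> UNIV \<and> u n \<noteq> z1" "\<forall>\<^sub>F n in sequentially. v n \<in> UNIV \<and> v n \<noteq> z2"
      by (auto elim: eventually_mono)
    then have u': "filterlim u (at z1) sequentially" and v': "filterlim v (at z2) sequentially"
      using ul vl by (simp_all add: filterlim_at)
    have "(\<lambda>n. (V (u n) - V z1) / (N (u n) - N z1)) \<longlonglongrightarrow> c z1 * n1 / n1"
      by (rule filterlim_compose[OF L1(1) u'])
    moreover have "(\<lambda>n. (V (v n) - V z2) / (N (v n) - N z2)) \<longlonglongrightarrow> c z2 * n2 / n2"
      by (rule filterlim_compose[OF L2(1) v'])
    ultimately have "c z1 * n1 / n1 = c z2 * n2 / n2"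
      unfolding P eqs(1,2) by (intro LIMSEQ_unique)
    then show False using eqs(3) n1(1) n2(1) by simp
  qed
qed

text \<open>\<open>Kfun H s / (2 * s)\<close> is the parameter for which s = sin z is critical. By
  Picard, two finite fibres would bound it by a power near infinity.\<close>

lemma finite_fibre_unique:
  assumes H: "transcendental_entire H"
    and fin: "finite {s. s \<noteq> 0 \<and> Kfun H s / (2 * s) = a}" "finite {s. s \<noteq> 0 \<and> Kfun H s / (2 * s) = b}"
  shows "a = b"
proof (rule ccontr)
  assume ab: "a \<noteq> b"
  have hol: "H holomorphic_on UNIV" using H by (simp add: transcendental_entire_def)
  have M: "(\<lambda>s. Kfun H s / (2 * s)) holomorphic_on - {0}"
    using holomorphic_on_subset[OF Kfun_holomorphic[OF hol]] by (intro holomorphic_intros) auto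
  have "\<exists>C N R. \<forall>s. R \<le> norm s \<longrightarrow> norm (Kfun H s / (2 * s)) \<le> C * norm s ^ N" (is ?G)
    using picard_end[OF M ab fin]
  proof
    assume "\<exists>B R. \<forall>s. R \<le> norm s \<longrightarrow> norm (Kfun H s / (2 * s)) \<le> B"
    then obtain B R where "\<forall>s. R \<le> norm s \<longrightarrow> norm (Kfun H s / (2 * s)) \<le> B * norm s ^ 0" by auto
    then show ?G by blast
  qed blast
  then obtain C N R where C: "\<And>s. R \<le> norm s \<Longrightarrow> norm (Kfun H s / (2 * s)) \<le> C * norm s ^ N" by blast
  have "norm (Kfun H s) \<le> (2 * C) * norm s ^ Suc N" if s: "max R 1 \<le> norm s" for s
  proof -
    have s1: "R \<le> norm s" "1 \<le> norm s" using s by auto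
    then have "norm (Kfun H s) = norm (Kfun H s / (2 * s)) * (2 * norm s)" by (auto simp: norm_divide norm_mult)
    also have "\<dots> \<le> (C * norm s ^ N) * (2 * norm s)" by (intro mult_right_mono C[OF s1(1)]) auto
    finally show ?thesis by (simp add: mult_ac)
  qed
  then show False using Kfun_no_polynomial_growth[OF H, of "max R 1" "2 * C" "Suc N"] by blast
qed

lemma generic_Hfun:
  assumes H: "transcendental_entire H" and odd: "\<And>z. H (- z) = - H z"
    and H'0: "deriv H 0 \<noteq> 0" and fin: "finite_order (\<lambda>z. H (sin z))"
  obtains E where "countable E" "\<And>a. a \<notin> E \<Longrightarrow> generic_periodic (Hfun H a)"
proof -
  have hol: "H holomorphic_on UNIV" using H by (simp add: transcendental_entire_def)
  define D where "D = (\<lambda>z. Kfun H (sin z))"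
  have holD: "D holomorphic_on UNIV"
    unfolding D_def by (intro holomorphic_compose_entire[OF Kfun_holomorphic[OF hol]] holomorphic_intros)
  have DD: "(D has_field_derivative deriv D z) (at z)" for z by (rule holomorphic_derivI[OF holD]) auto
  have dF: "(Hfun H a has_field_derivative D z - 2 * a * sin z) (at z)" for a z
    unfolding D_def by (rule DERIV_Hfun[OF hol])
  have dF1: "deriv (Hfun H a) = (\<lambda>z. D z - 2 * a * sin z)" for a
    using dF by (intro ext DERIV_imp_deriv)
  have dF2: "deriv (deriv (Hfun H a)) z = deriv D z - 2 * a * cos z" for a z
    unfolding dF1 by (intro DERIV_imp_deriv) (auto intro!: derivative_eq_intros DD)
  have holF: "Hfun H a holomorphic_on UNIV" for a
    using dF by (auto simp: holomorphic_on_def field_differentiable_def)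
  have K0: "Kfun H 0 = deriv H 0" by (simp add: Kfun_def)
  have "Kfun H (- s) = Kfun H s" for s
  proof -
    have "(H has_field_derivative deriv H (- s)) (at (- s))" by (rule holomorphic_derivI[OF hol]) auto
    moreover have "((\<lambda>s. - s) has_field_derivative - 1) (at s)" by (auto intro!: derivative_eq_intros)
    ultimately have "((\<lambda>s. H (- s)) has_field_derivative deriv H (- s) * - 1) (at s)"
      by (rule DERIV_chain2)
    then have "((\<lambda>s. - H s) has_field_derivative - deriv H (- s)) (at s)" by (simp add: odd)
    moreover have "((\<lambda>s. - H s) has_field_derivative - deriv H s) (at s)"
      by (intro DERIV_minus holomorphic_derivI[OF hol]) auto
    ultimately have "deriv H (- s) = deriv H s" using DERIV_unique by fastforce
    then show ?thesis by (simp add: Kfun_def odd)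
  qed
  note Keven = this
  \<comment> \<open>\<open>N z\<close> is the parameter that makes z critical, \<open>V z\<close>
    the resulting critical value, and W / (2 sin^2) the derivative of \<open>N\<close>. At zeros of
    sin, \<open>N\<close> has the default value 0; H'(0) \<noteq> 0 excludes critical points
    there.\<close>
  define N where "N = (\<lambda>z. D z / (2 * sin z))"
  define W where "W = (\<lambda>z. deriv D z * sin z - D z * cos z)"
  define V where "V = (\<lambda>z. Hfun H (N z) z)"
  define X where "X = {z. sin z \<noteq> 0 \<and> W z \<noteq> 0}"
  have crit: "sin z \<noteq> 0 \<and> N z = a" if "deriv (Hfun H a) z = 0" for a z
  proof -
    have Dz: "D z = 2 * a * sin z" using that by (simp add: dF1)
    have "sin z \<noteq> 0"
    proof
      assume "sin z = 0"
      then show False using Dz H'0 K0 by (simp add: D_def)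
    qed
    then show ?thesis using Dz by (simp add: N_def)
  qed
  have crit2: "deriv (deriv (Hfun H a)) z * sin z = W z" if "deriv (Hfun H a) z = 0" for a z
  proof -
    have "D z = 2 * a * sin z" using that by (simp add: dF1)
    then show ?thesis by (simp add: dF2 W_def algebra_simps)
  qed
  have holW: "W holomorphic_on UNIV"
  proof -
    have "deriv D holomorphic_on UNIV" using holD by (rule holomorphic_deriv) simp
    then show ?thesis unfolding W_def by (intro holomorphic_intros holD) auto
  qed
  have "W 0 \<noteq> 0" using H'0 K0 by (simp add: W_def D_def)
  have cW: "countable {z. W z = 0}"
  proof (cases "W constant_on UNIV")
    case True
    then obtain c where "\<And>z. W z = c" by (auto simp: constant_on_def)
    then have "{z. W z = 0} = {}" using \<open>W 0 \<noteq> 0\<close> by auto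
    then show ?thesis by simp
  next
    case False
    have "fsigma (UNIV :: complex set)" using fsigma.intros[of "\<lambda>_. UNIV"] by simp
    then show ?thesis using holomorphic_countable_zeros[OF holW open_UNIV connected_UNIV _ False] by simp
  qed
  define P where "P = {(z1, z2). z1 \<in> X \<and> z2 \<in> X \<and> N z1 = N z2 \<and> V z1 = V z2 \<and> 2 * cos z1 \<noteq> 2 * cos z2}"
  have cP: "countable P" unfolding P_def
  proof (rule bad_pairs_countable[where c = "\<lambda>z. 2 * cos z"])
    fix z assume "z \<in> X"
    then have sz: "sin z \<noteq> 0" and Wz: "W z \<noteq> 0" by (auto simp: X_def)
    define n where "n = W z / (2 * sin z ^ 2)"
    have dN: "(N has_field_derivative n) (at z)"
      unfolding N_def n_def W_def using sz
      by (auto intro!: derivative_eq_intros DD simp: field_simps power2_eq_square)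
    \<comment> \<open>In the derivative of \<open>V\<close> the terms D and - 2 N sin cancel by the
      definition of \<open>N\<close>, leaving 2 cos z times N'.\<close>
    have Veq: "V = (\<lambda>z. Hfun H 0 z + 2 * N z * cos z)" by (simp add: V_def Hfun_def fun_eq_iff algebra_simps)
    have "(V has_field_derivative (D z - 2 * 0 * sin z) + (2 * n * cos z - 2 * N z * sin z)) (at z)"
      unfolding Veq by (auto intro!: derivative_eq_intros dF dN)
    moreover have "(D z - 2 * 0 * sin z) + (2 * n * cos z - 2 * N z * sin z) = 2 * cos z * n"
      using sz by (simp add: N_def)
    ultimately have "(V has_field_derivative 2 * cos z * n) (at z)" by (simp only:)
    moreover have "n \<noteq> 0" using sz Wz by (simp add: n_def)
    ultimately show "\<exists>n. n \<noteq> 0 \<and> (N has_field_derivative n) (at z) \<and> (V has_field_derivative 2 * cos z * n) (at z)"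
      using dN by blast
  qed
  define E3 where "E3 = {a. finite {s. s \<noteq> 0 \<and> Kfun H s / (2 * s) = a}}"
  have "countable E3"
  proof (cases "E3 = {}")
    case False
    then obtain b where b: "b \<in> E3" by blast
    have "a = b" if "a \<in> E3" for a
      using that b unfolding E3_def mem_Collect_eq by (rule finite_fibre_unique[OF H])
    then have "E3 \<subseteq> {b}" by blast
    then show ?thesis by (rule countable_subset) simp
  qed simp
  \<comment> \<open>0 is excluded to refute a = - a, the zeros of \<open>W\<close> for simplicity of
    critical points, \<open>P\<close> for different cosines on one level, and \<open>E3\<close> for
    finitely many orbits.\<close>
  define E where "E = {0} \<union> N ` {z. W z = 0} \<union> N ` fst ` P \<union> E3"
  have "countable E" unfolding E_def using cW cP \<open>countable E3\<close> by simp
  moreover have "generic_periodic (Hfun H a)" if a: "a \<notin> E" for a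
  proof
    show "Hfun H a holomorphic_on UNIV" by (rule holF)
    show "Hfun H a (z + of_real (2 * pi)) = Hfun H a z" for z by (rule Hfun_periodic)
    show "Hfun H a (of_real pi - z) = - Hfun H a z" for z by (simp add: Hfun_def sin_diff cos_diff)
    show "\<exists>K \<rho>. \<rho> \<ge> 1 \<and> (\<forall>z. norm (Hfun H a z) \<le> K * exp (norm z powr \<rho>))"
      by (rule Hfun_growth[OF fin holF])
    show "\<not> (\<forall>z. Y \<le> Im z \<longrightarrow> norm (Hfun H a z) \<le> C * exp (real N * Im z))" for C N Y
      by (rule Hfun_no_end_growth[OF H])
    have WX: "W z \<noteq> 0" "z \<in> X" if "deriv (Hfun H a) z = 0" for z
      using crit[OF that] a by (auto simp: E_def X_def)
    show "deriv (deriv (Hfun H a)) z \<noteq> 0" if "deriv (Hfun H a) z = 0" for z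
      using crit2[OF that] WX[OF that] by auto
    show "\<exists>k::int. z2 = z1 + of_int k * of_real (2 * pi)"
      if z1: "deriv (Hfun H a) z1 = 0" and z2: "deriv (Hfun H a) z2 = 0" and eq: "Hfun H a z1 = Hfun H a z2" for z1 z2
    proof -
      have "N z1 = a" "N z2 = a" and s2: "sin z1 \<noteq> 0" "sin z2 \<noteq> 0" using crit z1 z2 by auto
      then have "N z1 = N z2" "V z1 = V z2" using eq by (simp_all add: V_def)
      have c: "cos z1 = cos z2"
      proof (rule ccontr)
        assume "cos z1 \<noteq> cos z2"
        then have "(z1, z2) \<in> P" using WX z1 z2 \<open>N z1 = N z2\<close> \<open>V z1 = V z2\<close> by (simp add: P_def)
        then have "N z1 \<in> N ` fst ` P" by force
        then show False using a \<open>N z1 = a\<close> by (simp add: E_def)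
      qed
      \<comment> \<open>Equal cosines determine the sines up to sign. Opposite sines would give N z2
        = - N z1, because \<open>Kfun H\<close> is even.\<close>
      have s: "sin z1 = sin z2"
      proof (rule ccontr)
        assume "sin z1 \<noteq> sin z2"
        moreover have "sin z1 ^ 2 = sin z2 ^ 2" using c by (simp add: sin_squared_eq)
        ultimately have "sin z2 = - sin z1" by (metis power2_eq_iff minus_minus)
        then have "N z2 = - N z1" by (simp add: N_def D_def Keven)
        then have "a = - a" using \<open>N z1 = a\<close> \<open>N z2 = a\<close> by simp
        then show False using a by (simp add: E_def)
      qed
      have "exp (\<i> * z2) = exp (\<i> * z1)" by (simp add: exp_Euler s c)
      then obtain n :: int where "\<i> * z2 = \<i> * z1 + complex_of_real (of_int (2 * n) * pi) * \<i>"
        unfolding exp_eq by blast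
      then have "\<i> * z2 = \<i> * (z1 + of_int n * of_real (2 * pi))" by (simp add: algebra_simps)
      then have "z2 = z1 + of_int n * of_real (2 * pi)" by simp
      then show ?thesis by blast
    qed
    show "infinite (period_orbit ` {z. deriv (Hfun H a) z = 0})"
    proof
      assume fo: "finite (period_orbit ` {z. deriv (Hfun H a) z = 0})"
      have orb: "sin w = sin z" if w: "w \<in> period_orbit z" for w z
      proof -
        obtain n :: int where "w = z + of_int n * 2 * of_real pi"
          using w by (auto simp: period_orbit_def)
        then have "w = z + of_int n * of_real (2 * pi)" by simp
        then show ?thesis
          by (simp only: periodic_int[of sin "of_real (2 * pi)", OF sin_cos_shift_2pi(1)])
      qed
      have self: "z \<in> period_orbit z" for z unfolding period_orbit_def by (auto intro!: exI[of _ 0])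
      \<comment> \<open>Each solution s lifts through \<open>sin\<close> to a critical point, and
        \<open>sin\<close> is constant on orbits; finitely many orbits would leave finitely many s,
        so a would lie in \<open>E3\<close>.\<close>
      have "{s. s \<noteq> 0 \<and> Kfun H s / (2 * s) = a} \<subseteq>
          (\<lambda>S. sin (SOME z. z \<in> S)) ` period_orbit ` {z. deriv (Hfun H a) z = 0}"
      proof
        fix s assume "s \<in> {s. s \<noteq> 0 \<and> Kfun H s / (2 * s) = a}"
        then have s: "s \<noteq> 0" "Kfun H s = 2 * a * s" by (auto simp: field_simps)
        obtain z where z: "sin z = s" "0 \<le> Im z" by (rule sin_surj_upper)
        have "deriv (Hfun H a) z = 0" by (simp add: dF1 D_def z s)
        moreover have "(SOME w. w \<in> period_orbit z) \<in> period_orbit z" using self by (rule someI)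
        then have "s = sin (SOME w. w \<in> period_orbit z)" using orb z by metis
        ultimately show "s \<in> (\<lambda>S. sin (SOME z. z \<in> S)) ` period_orbit ` {z. deriv (Hfun H a) z = 0}" by blast
      qed
      then have "finite {s. s \<noteq> 0 \<and> Kfun H s / (2 * s) = a}" by (rule finite_subset) (use fo in simp)
      then show False using a by (simp add: E_def E3_def)
    qed
  qed
  ultimately show thesis by (rule that)
qed

theorem theorem2p3:
  fixes H :: "complex \<Rightarrow> complex"
  assumes "transcendental_entire H"
    and "\<And>z. H (- z) = - H z"
    and "deriv H 0 \<noteq> 0"
    and "finite_order (\<lambda>z. H (sin z))"
  shows "\<exists>E :: complex set. countable E \<and>
    (\<forall>a. a \<notin> E \<longrightarrow>
       prime_fun (Hfun H a) \<and>
       infinite (period_orbit ` {z. deriv (Hfun H a) z = 0}) \<and>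
       (\<forall>c z1 z2. Hfun H a z1 = c \<and> deriv (Hfun H a) z1 = 0 \<and>
                  Hfun H a z2 = c \<and> deriv (Hfun H a) z2 = 0 \<longrightarrow> cos z1 = cos z2) \<and>
       (\<forall>z. deriv (Hfun H a) z = 0 \<longrightarrow> deriv (deriv (Hfun H a)) z \<noteq> 0))"
proof -
  obtain E where E: "countable E" and gen: "\<And>a. a \<notin> E \<Longrightarrow> generic_periodic (Hfun H a)"
    using generic_Hfun[OF assms] by blast
  have cos_per: "cos (z + of_int k * of_real (2 * pi)) = cos z" for z :: complex and k :: int
    by (rule periodic_int[of cos "of_real (2 * pi)", OF sin_cos_shift_2pi(2)])
  show ?thesis
  proof (intro exI[of _ E] conjI E allI impI; (elim conjE)?)
    fix a assume "a \<notin> E"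
    then interpret generic_periodic "Hfun H a" by (rule gen)
    show "prime_fun (Hfun H a)" by (rule prime)
    show "infinite (period_orbit ` {z. deriv (Hfun H a) z = 0})" by (rule crit_inf)
    show "deriv (deriv (Hfun H a)) z \<noteq> 0" if "deriv (Hfun H a) z = 0" for z using that by (rule crit_simple)
    show "cos z1 = cos z2" if "Hfun H a z1 = c" "deriv (Hfun H a) z1 = 0" "Hfun H a z2 = c" "deriv (Hfun H a) z2 = 0" for c z1 z2
      using crit_orbit[of z1 z2] that cos_per by auto
  qed
qed

end
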